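(* Let $L>0$, let $m=n^p$ with $p\in(0,1/2)$, and suppose $m\ge 5\log n$. For arbitrary $0<s_1<s_2\le \frac{1}{4p}-\frac12$ there exists a distributed estimator $\hat f$ with numbers of transmitted bits $(\hat B^{(1)},\dots,\hat B^{(m)})$ such that $\hat B^{(i)}\le n^{\frac{1}{1+2s_1}}\log n$ for $i=1,\dots,m$, and such that for all $s\in\{s_1,s_2\}$ $$\max_{i\in\{1,\dots,m\}}\ \sup_{f_0\in B^{s}_{2,\infty}(L)}E^{(i)}_{f_0}\hat B^{(i)}\lesssim n^{\frac{1}{1+2s}}\log n$$ and $$\sup_{f_0\in B^{s}_{2,\infty}(L)}E_{f_0}\|\hat f-f_0\|_2^2\lesssim n^{-\frac{2s}{1+2s}}.$$
   Context: Model (distributed Gaussian white noise): there are $m=m_n$ machines; machine $i\in\{1,\dots,m\}$ observes the process $X^{(i)}$ with $dX^{(i)}_t=f_0(t)\,dt+\sqrt{m/n}\,dW^{(i)}_t$, $t\in[0,1]$, where $W^{(1)},\dots,W^{(m)}$ are independent standard Wiener processes and $f_0\in L_2[0,1]$ is unknown. $E_{f_0}$ denotes expectation under the joint law of all data (and any randomization), $E^{(i)}_{f_0}$ expectation under the law of $X^{(i)}$ (and the local randomization of machine $i$). When $m=n^p$, $n^p$ is understood as rounded to an integer if necessary. Distributed estimator: independently of each other, each machine $i$ produces from its own data $X^{(i)}$ (possibly with additional local randomization independent of everything else) a random finite binary string $Y^{(i)}$ of length $\hat B^{(i)}$ (number of transmitted bits), and $\hat f$ is a measurable function of $(Y^{(1)},\dots,Y^{(m)})$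 only. Statements concern sequences of such procedures indexed by $n$. Besov balls: let $\{\psi_{jk}: j\ge 0,\ 1\le k\le 2^j\}$ be a compactly supported orthonormal $N$-regular Cohen–Daubechies–Vial wavelet basis of $L_2[0,1]$, with $N$ larger than all regularities considered, and $f_{jk}=\langle f,\psi_{jk}\rangle$. Then $\|f\|^2_{B^s_{2,\infty}}=\sup_{j\ge 0}2^{2js}\sum_{k=1}^{2^j}f_{jk}^2$ and $B^s_{2,\infty}(L)=\{f\in L_2[0,1]:\|f\|_{B^s_{2,\infty}}<L\}$. $\log$ is the base-2 logarithm. $a_n\lesssim b_n$ means $a_n\le C b_n$ for all sufficiently large $n$, with $C>0$ not depending on $n$, $i$ or $f_0$ (it may depend on fixed parameters such as $s_1,s_2,L,p$). *)

theory Defs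
  imports "HOL-Probability.Probability"
begin

section \<open>Square integrable functions\<close>

text \<open>Elements of $L_2(A)$ are represented by functions; only their values on $A$, up to
  Lebesgue null sets, matter.\<close>

definition L2_space :: "real set \<Rightarrow> (real \<Rightarrow> real) set" where
  "L2_space A = {f. f \<in> borel_measurable (lebesgue_on A) \<and>
                    integrable (lebesgue_on A) (\<lambda>x. (f x)\<^sup>2)}"

definition L2_inner :: "real set \<Rightarrow> (real \<Rightarrow> real) \<Rightarrow> (real \<Rightarrow> real) \<Rightarrow> real" where
  "L2_inner A f g = (LINT x|lebesgue_on A. f x * g x)"

definition L2_dist_sq :: "real set \<Rightarrow> (real \<Rightarrow> real) \<Rightarrow> (real \<Rightarrow> real) \<Rightarrow> ennreal" where
  "L2_dist_sq A f g = (\<integral>\<^sup>+x. ennreal ((f x - g x)\<^sup>2) \<partial>lebesgue_on A)"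


section \<open>Cohen--Daubechies--Vial wavelet bases of the unit interval\<close>

text \<open>Father and mother wavelet on the line of a Daubechies family with \<open>N\<close> vanishing moments,
  translated so that both live on $[1-N,N]$; \<open>h\<close> is the low-pass filter. For a given \<open>N\<close> this
  covers the extremal-phase as well as the least-asymmetric choice of the filter.\<close>

definition daubechies_pair :: "nat \<Rightarrow> (real \<Rightarrow> real) \<Rightarrow> (real \<Rightarrow> real) \<Rightarrow> bool" where
  "daubechies_pair N \<phi> \<psi> \<longleftrightarrow>
     N \<ge> 1 \<and> \<phi> \<in> L2_space UNIV \<and> \<psi> \<in> L2_space UNIV \<and>
     (\<forall>x. x \<notin> {1 - real N..real N} \<longrightarrow> \<phi> x = 0 \<and> \<psi> x = 0) \<and>
     (LINT x|lebesgue. \<phi> x) = 1 \<and>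
     (\<forall>k::int. L2_inner UNIV \<phi> (\<lambda>x. \<phi> (x - of_int k)) = (if k = 0 then 1 else 0)) \<and>
     (\<exists>h :: int \<Rightarrow> real.
        (AE x in lebesgue. \<phi> x = sqrt 2 * (\<Sum>k = 1 - int N..int N. h k * \<phi> (2 * x - of_int k))) \<and>
        (AE x in lebesgue. \<psi> x = sqrt 2 * (\<Sum>k = 1 - int N..int N.
                              (if even k then 1 else - 1) * h (1 - k) * \<phi> (2 * x - of_int k)))) \<and>
     (\<forall>l<N. (LINT x|lebesgue. x ^ l * \<psi> x) = 0)"

definition dilate :: "(real \<Rightarrow> real) \<Rightarrow> nat \<Rightarrow> int \<Rightarrow> real \<Rightarrow> real" where
  "dilate g j k x = 2 powr (real j / 2) * g (2 ^ j * x - of_int k)"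

text \<open>The multiresolution space $V_j$ on the unit interval is spanned by the interior scaling
  functions $\phi_{jk}$, $N \le k < 2^j - N$, and, at each end point, by the restrictions to
  $[0,1]$ of $\sum_k k^a \phi_{jk}$, $a < N$, where \<open>k\<close> runs through the $2N-1$ shifts that are
  not interior but whose support meets $(0,1)$ near that end point. Hence $V_j$ contains the
  polynomials of degree less than \<open>N\<close> and has dimension $2^j$ whenever $2^j \ge 2N$.\<close>

definition cdv_generators :: "nat \<Rightarrow> (real \<Rightarrow> real) \<Rightarrow> nat \<Rightarrow> (real \<Rightarrow> real) set" where
  "cdv_generators N \<phi> j =
     (\<lambda>k. dilate \<phi> j k) ` {int N..<2 ^ j - int N} \<union>
     (\<lambda>a x. \<Sum>k = 1 - int N..int N - 1. of_int k ^ a * dilate \<phi> j k x) ` {..<N} \<union>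
     (\<lambda>a x. \<Sum>k = 2 ^ j - int N..2 ^ j + int N - 2. of_int k ^ a * dilate \<phi> j k x) ` {..<N}"

definition cdv_space :: "nat \<Rightarrow> (real \<Rightarrow> real) \<Rightarrow> nat \<Rightarrow> (real \<Rightarrow> real) set" where
  "cdv_space N \<phi> j =
     {f. \<exists>c. AE x in lebesgue_on {0..1}. f x = (\<Sum>g\<in>cdv_generators N \<phi> j. c g * g x)}"

text \<open>Level \<open>j\<close> functions, numbered by $k < 2^j$: first \<open>N\<close> functions adapted to the left end
  point, then the interior translates, then \<open>N\<close> functions adapted to the right end point.\<close>

definition cdv_function ::
  "nat \<Rightarrow> (real \<Rightarrow> real) \<Rightarrow> (nat \<Rightarrow> real \<Rightarrow> real) \<Rightarrow> (nat \<Rightarrow> real \<Rightarrow> real) \<Rightarrow> nat \<Rightarrow> nat \<Rightarrow> real \<Rightarrow> real" where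
  "cdv_function N g gL gR j k x =
     (if k < N then 2 powr (real j / 2) * gL k (2 ^ j * x)
      else if k < 2 ^ j - N then dilate g j (int k) x
      else 2 powr (real j / 2) * gR (2 ^ j - 1 - k) (2 ^ j * (1 - x)))"

definition edge_functions :: "nat \<Rightarrow> (nat \<Rightarrow> real \<Rightarrow> real) \<Rightarrow> bool" where
  "edge_functions N e \<longleftrightarrow> (\<forall>k<N. \<forall>x. x \<notin> {0..real (N + k)} \<longrightarrow> e k x = 0)"

text \<open>The basis is written $\psi_{jk}$ with $j \ge 0$ and $1 \le k \le 2^j$. Starting from a coarsest
  level $j_0$, there are $2^{j_0}$ scaling functions, whereas the levels $j < j_0$ only provide
  $2^{j_0} - 1$ labels. One more label \<open>(0, 0)\<close> is therefore needed.\<close>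

definition level :: "nat \<Rightarrow> nat set" where
  "level j = (if j = 0 then {0, 1} else {1..2 ^ j})"

definition orthonormal_basis01 :: "(nat \<Rightarrow> nat \<Rightarrow> real \<Rightarrow> real) \<Rightarrow> bool" where
  "orthonormal_basis01 \<psi> \<longleftrightarrow>
     (\<forall>j. \<forall>k\<in>level j. \<psi> j k \<in> L2_space {0..1}) \<and>
     (\<forall>j. \<forall>k\<in>level j. \<forall>j'. \<forall>k'\<in>level j'.
        L2_inner {0..1} (\<psi> j k) (\<psi> j' k') = (if j = j' \<and> k = k' then 1 else 0)) \<and>
     (\<forall>f\<in>L2_space {0..1}.
        (\<lambda>J. L2_dist_sq {0..1} f
               (\<lambda>x. \<Sum>j<J. \<Sum>k\<in>level j. L2_inner {0..1} f (\<psi> j k) * \<psi> j k x)) \<longlonglongrightarrow> 0)"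

text \<open>The levels $j < j_0$, with the additional label, enumerate the scaling functions of $V_{j_0}$:
  \<open>(0, 0)\<close> is the first one, and \<open>(j, k)\<close> with $k \ge 1$ has position $2^j + k - 1$ (counting from 0).
  The levels $j \ge j_0$ carry the wavelets. Since $\dim V_j \le 2^j$, orthonormality together with
  $\psi_{jk} \in V_{j+1}$ forces $\{\psi_{jk}\}_k$ to be a basis of $V_{j+1} \ominus V_j$.\<close>

definition cdv_wavelet_basis :: "nat \<Rightarrow> (nat \<Rightarrow> nat \<Rightarrow> real \<Rightarrow> real) \<Rightarrow> bool" where
  "cdv_wavelet_basis N \<psi> \<longleftrightarrow>
     orthonormal_basis01 \<psi> \<and>
     (\<exists>j0 \<phi> \<eta> \<phi>L \<phi>R \<eta>L \<eta>R.
        daubechies_pair N \<phi> \<eta> \<and> 2 * N \<le> 2 ^ j0 \<and>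
        edge_functions N \<phi>L \<and> edge_functions N \<phi>R \<and>
        edge_functions N \<eta>L \<and> edge_functions N \<eta>R \<and>
        (\<forall>j<j0. \<forall>k\<in>level j.
           (\<forall>x\<in>{0..1}. \<psi> j k x =
              cdv_function N \<phi> \<phi>L \<phi>R j0 (if k = 0 then 0 else 2 ^ j + k - 1) x) \<and>
           \<psi> j k \<in> cdv_space N \<phi> j0) \<and>
        (\<forall>j\<ge>j0. \<forall>k\<in>level j.
           (\<forall>x\<in>{0..1}. \<psi> j k x = cdv_function N \<eta> \<eta>L \<eta>R j (k - 1) x) \<and>
           \<psi> j k \<in> cdv_space N \<phi> (Suc j)))"


section \<open>Besov balls\<close>

definition besov_norm_sq :: "(nat \<Rightarrow> nat \<Rightarrow> real \<Rightarrow> real) \<Rightarrow> real \<Rightarrow> (real \<Rightarrow> real) \<Rightarrow> ennreal" where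
  "besov_norm_sq \<psi> s f =
     (SUP j. ennreal (2 powr (2 * real j * s) * (\<Sum>k\<in>level j. (L2_inner {0..1} f (\<psi> j k))\<^sup>2)))"

definition besov_ball :: "(nat \<Rightarrow> nat \<Rightarrow> real \<Rightarrow> real) \<Rightarrow> real \<Rightarrow> real \<Rightarrow> (real \<Rightarrow> real) set" where
  "besov_ball \<psi> s L = {f \<in> L2_space {0..1}. besov_norm_sq \<psi> s f < ennreal (L\<^sup>2)}"


section \<open>Distributed Gaussian white noise\<close>

text \<open>The space $C[0,1]$ with the sigma algebra of the coordinate maps (which is its Borel sigma
  algebra).\<close>

definition path_space :: "(real \<Rightarrow> real) measure" where
  "path_space = restrict_space (\<Pi>\<^sub>M t\<in>{0..1::real}. (borel :: real measure))
                               {w. continuous_on {0..1} w}"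

text \<open>\<open>P\<close> is the law on \<open>path_space\<close> of a standard Wiener process indexed by $[0,1]$. These
  conditions determine \<open>P\<close> uniquely.\<close>

definition wiener_law :: "(real \<Rightarrow> real) measure \<Rightarrow> bool" where
  "wiener_law P \<longleftrightarrow>
     prob_space P \<and> sets P = sets path_space \<and>
     (AE w in P. w 0 = 0) \<and>
     (\<forall>s t. 0 \<le> s \<and> s < t \<and> t \<le> 1 \<longrightarrow>
        distributed P lborel (\<lambda>w. w t - w s) (normal_density 0 (sqrt (t - s)))) \<and>
     (\<forall>(ts :: nat \<Rightarrow> real) r. (\<forall>k\<le>r. ts k \<in> {0..1}) \<and> (\<forall>k<r. ts k \<le> ts (Suc k)) \<longrightarrow>
        prob_space.indep_vars P (\<lambda>_. borel) (\<lambda>k w. w (ts (Suc k)) - w (ts k)) {..<r})"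

text \<open>The solution of $dX_t = f(t)\,dt + \sqrt{m/n}\,dW_t$, $X_0 = W_0$, on $[0,1]$.\<close>

definition observed_path :: "nat \<Rightarrow> nat \<Rightarrow> (real \<Rightarrow> real) \<Rightarrow> (real \<Rightarrow> real) \<Rightarrow> real \<Rightarrow> real" where
  "observed_path m n f w =
     (\<lambda>t\<in>{0..1}. (LINT x|lebesgue_on {0..t}. f x) + sqrt (real m / real n) * w t)"

text \<open>Machine \<open>i\<close> draws a private random seed from \<open>seed i\<close> and sends the string obtained by
  applying \<open>encode i\<close> to its observed path and its seed. The strings of all machines are passed to
  \<open>decode\<close>.\<close>

record distributed_procedure =
  seed :: "nat \<Rightarrow> real measure"
  encode :: "nat \<Rightarrow> (real \<Rightarrow> real) \<Rightarrow> real \<Rightarrow> bool list"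
  decode :: "(nat \<Rightarrow> bool list) \<Rightarrow> real \<Rightarrow> real"

text \<open>No measurability condition on \<open>decode\<close> as a map into $L_2$ is needed, because it is defined on
  the countable discrete space of \<open>m\<close>-tuples of finite binary strings.\<close>

definition distributed_estimator :: "nat \<Rightarrow> distributed_procedure \<Rightarrow> bool" where
  "distributed_estimator m D \<longleftrightarrow>
     (\<forall>i\<in>{1..m}. prob_space (seed D i) \<and> sets (seed D i) = sets borel \<and>
        (\<lambda>(x, u). encode D i x u) \<in> path_space \<Otimes>\<^sub>M borel \<rightarrow>\<^sub>M count_space UNIV) \<and>
     (\<forall>y \<in> {1..m} \<rightarrow>\<^sub>E UNIV. decode D y \<in> L2_space {0..1})"

definition machine_law ::
  "(real \<Rightarrow> real) measure \<Rightarrow> nat \<Rightarrow> nat \<Rightarrow> (real \<Rightarrow> real) \<Rightarrow> distributed_procedure \<Rightarrow> nat \<Rightarrow>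
   ((real \<Rightarrow> real) \<times> real) measure" where
  "machine_law P m n f D i = distr P path_space (observed_path m n f) \<Otimes>\<^sub>M seed D i"

definition joint_law ::
  "(real \<Rightarrow> real) measure \<Rightarrow> nat \<Rightarrow> nat \<Rightarrow> (real \<Rightarrow> real) \<Rightarrow> distributed_procedure \<Rightarrow>
   (nat \<Rightarrow> (real \<Rightarrow> real) \<times> real) measure" where
  "joint_law P m n f D = (\<Pi>\<^sub>M i\<in>{1..m}. machine_law P m n f D i)"

definition message :: "distributed_procedure \<Rightarrow> nat \<Rightarrow> (real \<Rightarrow> real) \<times> real \<Rightarrow> bool list" where
  "message D i = (\<lambda>(x, u). encode D i x u)"

definition estimate ::
  "nat \<Rightarrow> distributed_procedure \<Rightarrow> (nat \<Rightarrow> (real \<Rightarrow> real) \<times> real) \<Rightarrow> real \<Rightarrow> real" where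
  "estimate m D \<omega> = decode D (\<lambda>i\<in>{1..m}. message D i (\<omega> i))"

definition expected_bits ::
  "(real \<Rightarrow> real) measure \<Rightarrow> nat \<Rightarrow> nat \<Rightarrow> (real \<Rightarrow> real) \<Rightarrow> distributed_procedure \<Rightarrow> nat \<Rightarrow> ennreal" where
  "expected_bits P m n f D i =
     (\<integral>\<^sup>+z. of_nat (length (message D i z)) \<partial>machine_law P m n f D i)"

definition risk ::
  "(real \<Rightarrow> real) measure \<Rightarrow> nat \<Rightarrow> nat \<Rightarrow> (real \<Rightarrow> real) \<Rightarrow> distributed_procedure \<Rightarrow> ennreal" where
  "risk P m n f D = (\<integral>\<^sup>+\<omega>. L2_dist_sq {0..1} (estimate m D \<omega>) f \<partial>joint_law P m n f D)"

end

theory Submission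
  imports Defs
begin

text \<open>Each machine always sends its quantized coefficients on the levels below $J_2$, where
  $2^{J_2} \approx n^{1/(1+2s_2)}$, and it sends a level $j \in [J_2, J_1)$ with
  $2^{J_1} \approx n^{1/(1+2s_1)}$ only if the empirical energy of that level exceeds its noise part
  by $\tau 2^j/n$. The centre averages a level over its senders if at least a quarter of the machines
  send it, and estimates it by 0 otherwise.

  Since $m^2 \lesssim 2^{J_2}$, the threshold is $2^{(j-J_2)/2}$ standard deviations of the local
  energy statistic. For $f \in B^{s_2}_{2,\infty}$ a level is therefore sent with a probability of
  order $4^{-(j-J_2)}$, and the expected message stays short. If a level carries energy far above
  $2^j/n$, almost all machines send it, except with a probability exponentially small in
  $m \ge 5 \log n$. Selecting the senders by their own data biases the average only by a vector of
  norm at most $\sqrt{m/n}$, and $m \le C 2^j$ on the tested levels, so no splitting of the sample is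
  needed.

  To avoid stochastic integrals, the coefficients are computed from increments of the path on a fine
  grid: projecting the basis functions on step functions can only decrease their Gram matrix, hence
  the noise is sub-Gaussian with variance proxy at most that of white noise.\<close>

section \<open>Sub-Gaussian noise vectors\<close>

text \<open>The upper bound on s2 says 2p <= 1/(1+2*s2), that is, m^2 is at most a constant times
  2^J2. This is the exact point where the local test becomes possible: to keep the rate it must
  react to energies of order 2^j/n, while one machine sees the energy of level j only up to
  2^(j/2)*m/n. The two errors of the test need different evidence. A level overlooked by one machine
  is harmless as long as most machines send it, so a constant error probability suffices and
  independence of the machines amplifies it. The lower tail can therefore be polynomial and needs no
  independence of the coordinates of the grid noise. The quota of one quarter fixes two constants:
  16^(3/4) = 8 and (2^12)^(1/4) = 8, and 2^m/8^m = 4^(-m). This is why one machine must err with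
  probability at most 1/16 in one direction and 2^(-12) in the other. With n^5 <= 2^m the factor
  4^(-m) beats every energy bounded by n.\<close>

lemma nn_integral_normal_exp:
  assumes "s > 0"
  shows "(\<integral>\<^sup>+x. ennreal (normal_density 0 s x) * ennreal (exp (c * x)) \<partial>lborel) =
    ennreal (exp (c\<^sup>2 * s\<^sup>2 / 2))"
proof -
  have *: "normal_density 0 s x * exp (c * x) = exp (c\<^sup>2 * s\<^sup>2 / 2) * normal_density (c * s\<^sup>2) s x" for x
  proof -
    have "- (x - 0)\<^sup>2 / (2 * s\<^sup>2) + c * x = c\<^sup>2 * s\<^sup>2 / 2 + - (x - c * s\<^sup>2)\<^sup>2 / (2 * s\<^sup>2)"
      using assms by (simp add: field_simps power2_eq_square)
    then have "exp (- (x - 0)\<^sup>2 / (2 * s\<^sup>2)) * exp (c * x) =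
        exp (c\<^sup>2 * s\<^sup>2 / 2) * exp (- (x - c * s\<^sup>2)\<^sup>2 / (2 * s\<^sup>2))"
      by (simp only: exp_add [symmetric])
    then show ?thesis by (simp add: normal_density_def)
  qed
  interpret N: prob_space "density lborel (normal_density (c * s\<^sup>2) s)"
    by (rule prob_space_normal_density) fact
  have 1: "(\<integral>\<^sup>+x. ennreal (normal_density (c * s\<^sup>2) s x) \<partial>lborel) = 1"
    using N.emeasure_space_1 by (simp add: emeasure_density)
  show ?thesis
    by (simp add: ennreal_mult [symmetric] *) (simp add: ennreal_mult nn_integral_cmult 1)
qed

text \<open>With l = 0 it turns the exponential of a square into an average of exponentials of
  linear forms; with the given l it evaluates the Gaussian integral left at the end of that
  linearization. The restriction l < 1/2 is integrability.\<close>

lemma nn_integral_std_normal_exp_quadratic: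
  assumes "l < 1 / 2"
  shows "(\<integral>\<^sup>+x. ennreal (std_normal_density x) * ennreal (exp (l * x\<^sup>2 + c * x)) \<partial>lborel) =
    ennreal (exp (c\<^sup>2 / (2 * (1 - 2 * l))) / sqrt (1 - 2 * l))"
proof -
  define s where "s = 1 / sqrt (1 - 2 * l)"
  have s: "s > 0" "s\<^sup>2 = 1 / (1 - 2 * l)" using assms by (auto simp: s_def power_divide)
  have *: "std_normal_density x * exp (l * x\<^sup>2 + c * x) = s * (normal_density 0 s x * exp (c * x))" for x
  proof -
    have "exp (- x\<^sup>2 / 2) * exp (l * x\<^sup>2 + c * x) = exp (- (x - 0)\<^sup>2 / (2 * s\<^sup>2)) * exp (c * x)"
      using assms by (simp only: exp_add [symmetric] s) (simp add: field_simps)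
    moreover have "sqrt (2 * pi * s\<^sup>2) = s * sqrt (2 * pi)"
      using s(1) by (simp add: real_sqrt_mult)
    ultimately show ?thesis using s(1) by (simp add: normal_density_def std_normal_density_def)
  qed
  have "(\<integral>\<^sup>+x. ennreal (std_normal_density x) * ennreal (exp (l * x\<^sup>2 + c * x)) \<partial>lborel) =
      (\<integral>\<^sup>+x. ennreal s * (ennreal (normal_density 0 s x) * ennreal (exp (c * x))) \<partial>lborel)"
    using s(1) by (intro nn_integral_cong) (simp add: ennreal_mult [symmetric] *)
  also have "\<dots> = ennreal s * ennreal (exp (c\<^sup>2 * s\<^sup>2 / 2))"
    by (subst nn_integral_cmult) (simp_all add: nn_integral_normal_exp [OF s(1)])
  also have "\<dots> = ennreal (exp (c\<^sup>2 / (2 * (1 - 2 * l))) / sqrt (1 - 2 * l))"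
    using s by (simp add: ennreal_mult [symmetric] s_def mult.commute)
  finally show ?thesis .
qed

text \<open>Domination by white noise in every direction. Neither independence nor equality of
  covariances is asked, because statistics built from grid increments may be correlated and have
  variances slightly below one.\<close>

definition subgaussian :: "'a measure \<Rightarrow> 'i set \<Rightarrow> ('i \<Rightarrow> 'a \<Rightarrow> real) \<Rightarrow> bool" where
  "subgaussian M K Z \<longleftrightarrow> finite K \<and> (\<forall>k\<in>K. Z k \<in> borel_measurable M) \<and>
     (\<forall>g. (\<integral>\<^sup>+x. ennreal (exp (\<Sum>k\<in>K. g k * Z k x)) \<partial>M) \<le> ennreal (exp ((\<Sum>k\<in>K. (g k)\<^sup>2) / 2))) \<and>
     (\<forall>g. (\<integral>\<^sup>+x. ennreal ((\<Sum>k\<in>K. g k * Z k x)\<^sup>2) \<partial>M) \<le> ennreal (\<Sum>k\<in>K. (g k)\<^sup>2))"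

lemma subgaussianD:
  assumes "subgaussian M K Z"
  shows "finite K" and "\<And>k. k \<in> K \<Longrightarrow> Z k \<in> borel_measurable M"
    and "\<And>g. (\<integral>\<^sup>+x. ennreal (exp (\<Sum>k\<in>K. g k * Z k x)) \<partial>M) \<le> ennreal (exp ((\<Sum>k\<in>K. (g k)\<^sup>2) / 2))"
    and "\<And>g. (\<integral>\<^sup>+x. ennreal ((\<Sum>k\<in>K. g k * Z k x)\<^sup>2) \<partial>M) \<le> ennreal (\<Sum>k\<in>K. (g k)\<^sup>2)"
  using assms by (auto simp: subgaussian_def)

lemma subgaussian_subset:
  assumes "subgaussian M K Z" "J \<subseteq> K"
  shows "subgaussian M J Z"
proof -
  note * = subgaussianD [OF assms(1)]
  have e: "(\<Sum>k\<in>K. (if k \<in> J then g k else 0) * Z k x) = (\<Sum>k\<in>J. g k * Z k x)"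
    "(\<Sum>k\<in>K. (if k \<in> J then g k else 0)\<^sup>2) = (\<Sum>k\<in>J. (g k)\<^sup>2)" for g x
    using assms(2) *(1) by (auto intro!: sum.mono_neutral_cong_right)
  show ?thesis
    unfolding subgaussian_def
    using *(1,2) *(3) [of "\<lambda>k. if k \<in> J then _ k else 0", unfolded e]
      *(4) [of "\<lambda>k. if k \<in> J then _ k else 0", unfolded e] assms(2)
    by (auto intro: finite_subset)
qed

text \<open>Gaussian linearization: \<open>exp (l * v^2)\<close> is the mean of
  \<open>exp (c * v * g)\<close> over a standard normal g, where \<open>c = sqrt (2 * l)\<close>.
  Exchanging the integrals leaves linear exponential moments of \<open>Z\<close>, and the remaining
  integral over g is explicit. The bound is the value attained by a true standard normal
  vector.\<close>

lemma (in prob_space) subgaussian_sq_mgf: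
  assumes Z: "subgaussian M K Z" and l: "0 \<le> l" "l < 1 / 2"
  shows "(\<integral>\<^sup>+x. ennreal (exp (l * (\<Sum>k\<in>K. (a k + Z k x)\<^sup>2))) \<partial>M)
    \<le> ennreal (exp (l * (\<Sum>k\<in>K. (a k)\<^sup>2) / (1 - 2 * l)) / sqrt (1 - 2 * l) ^ card K)"
proof -
  note [simp] = subgaussianD(1) [OF Z] and [measurable] = subgaussianD(2) [OF Z]
  define c where "c = sqrt (2 * l)"
  have c2: "c\<^sup>2 = 2 * l" using l by (simp add: c_def)
  define G where "G = density lborel (\<lambda>x. ennreal (std_normal_density x))"
  interpret G: prob_space G unfolding G_def by (rule prob_space_normal_density) simp
  interpret P: product_sigma_finite "\<lambda>_. G" ..
  interpret GP: prob_space "PiM K (\<lambda>_. G)" by (rule prob_space_PiM) (rule G.prob_space_axioms)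
  interpret pair_sigma_finite M "PiM K (\<lambda>_. G)" ..
  have [measurable_cong]: "sets G = sets borel" by (simp add: G_def)
  have intG: "(\<integral>\<^sup>+g. f g \<partial>G) = (\<integral>\<^sup>+g. ennreal (std_normal_density g) * f g \<partial>lborel)"
    if "f \<in> borel_measurable borel" for f
    unfolding G_def using that by (subst nn_integral_density) auto
  have HS: "ennreal (exp (l * v\<^sup>2)) = (\<integral>\<^sup>+g. ennreal (exp (c * v * g)) \<partial>G)" for v
    using nn_integral_std_normal_exp_quadratic [of 0 "c * v"]
    by (simp add: intG power_mult_distrib c2)
  have prodeq: "(\<Prod>k\<in>K. ennreal (exp (f k))) = ennreal (exp (\<Sum>k\<in>K. f k))" for f :: "'b \<Rightarrow> real"
    by (subst prod_ennreal) (auto simp: exp_sum)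
  have "(\<integral>\<^sup>+x. ennreal (exp (l * (\<Sum>k\<in>K. (a k + Z k x)\<^sup>2))) \<partial>M) =
      (\<integral>\<^sup>+x. (\<Prod>k\<in>K. \<integral>\<^sup>+g. ennreal (exp (c * (a k + Z k x) * g)) \<partial>G) \<partial>M)"
    by (simp add: HS [symmetric] prodeq sum_distrib_left)
  also have "\<dots> = (\<integral>\<^sup>+x. (\<integral>\<^sup>+g. ennreal (exp (\<Sum>k\<in>K. c * (a k + Z k x) * g k)) \<partial>PiM K (\<lambda>_. G)) \<partial>M)"
    by (subst P.product_nn_integral_prod [symmetric]) (auto simp: prodeq)
  also have "\<dots> = (\<integral>\<^sup>+g. (\<integral>\<^sup>+x. ennreal (exp (\<Sum>k\<in>K. c * (a k + Z k x) * g k)) \<partial>M) \<partial>PiM K (\<lambda>_. G))"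
    by (rule Fubini' [symmetric]) (measurable)
  also have "\<dots> \<le> (\<integral>\<^sup>+g. ennreal (exp (\<Sum>k\<in>K. l * (g k)\<^sup>2 + c * a k * g k)) \<partial>PiM K (\<lambda>_. G))"
  proof (rule nn_integral_mono)
    fix g
    have "(\<integral>\<^sup>+x. ennreal (exp (\<Sum>k\<in>K. c * (a k + Z k x) * g k)) \<partial>M) =
       (\<integral>\<^sup>+x. ennreal (exp (\<Sum>k\<in>K. c * a k * g k)) * ennreal (exp (\<Sum>k\<in>K. (c * g k) * Z k x)) \<partial>M)"
      by (simp add: ennreal_mult [symmetric] exp_add [symmetric] sum.distrib [symmetric] algebra_simps)
    also have "\<dots> = ennreal (exp (\<Sum>k\<in>K. c * a k * g k)) * (\<integral>\<^sup>+x. ennreal (exp (\<Sum>k\<in>K. (c * g k) * Z k x)) \<partial>M)"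
      by (rule nn_integral_cmult) measurable
    also have "\<dots> \<le> ennreal (exp (\<Sum>k\<in>K. c * a k * g k)) * ennreal (exp ((\<Sum>k\<in>K. (c * g k)\<^sup>2) / 2))"
      by (rule mult_left_mono) (rule subgaussianD(3) [OF Z], simp)
    also have "\<dots> = ennreal (exp (\<Sum>k\<in>K. l * (g k)\<^sup>2 + c * a k * g k))"
      by (simp add: ennreal_mult [symmetric] exp_add [symmetric] sum.distrib power_mult_distrib c2
          sum_divide_distrib add.commute)
    finally show "(\<integral>\<^sup>+x. ennreal (exp (\<Sum>k\<in>K. c * (a k + Z k x) * g k)) \<partial>M)
      \<le> ennreal (exp (\<Sum>k\<in>K. l * (g k)\<^sup>2 + c * a k * g k))" .
  qed
  \<comment> \<open>The product form comes from the auxiliary Gaussian variables; the coordinates of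
    \<open>Z\<close> may be dependent.\<close>
  also have "\<dots> = (\<Prod>k\<in>K. \<integral>\<^sup>+g. ennreal (exp (l * g\<^sup>2 + c * a k * g)) \<partial>G)"
    by (subst P.product_nn_integral_prod [symmetric]) (auto simp: prodeq)
  also have "\<dots> = (\<Prod>k\<in>K. ennreal (exp (l * (a k)\<^sup>2 / (1 - 2 * l)) / sqrt (1 - 2 * l)))"
  proof -
    have "(c * y)\<^sup>2 / (2 * (1 - 2 * l)) = l * y\<^sup>2 / (1 - 2 * l)" for y
      using l by (simp add: power_mult_distrib c2 field_simps)
    then show ?thesis
      using l by (simp add: intG nn_integral_std_normal_exp_quadratic del: mult_minus_right)
  qed
  also have "\<dots> = ennreal (exp (l * (\<Sum>k\<in>K. (a k)\<^sup>2) / (1 - 2 * l)) / sqrt (1 - 2 * l) ^ card K)"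
    using l by (subst prod_ennreal) (auto simp: prod_dividef exp_sum sum_distrib_left sum_divide_distrib)
  finally show ?thesis .
qed

lemma power_le_fact_exp:
  fixes x :: real
  assumes "0 \<le> x"
  shows "x ^ n \<le> fact n * exp x"
proof -
  have s: "(\<lambda>n. inverse (fact n) * x ^ n) sums exp x"
    using exp_converges [of x] by (simp add: field_simps)
  have "(\<Sum>k\<in>{n}. inverse (fact k) * x ^ k) \<le> exp x"
    unfolding sums_unique [OF s] using assms by (intro sum_le_suminf sums_summable [OF s]) auto
  then show ?thesis by (simp add: field_simps)
qed

context prob_space
begin

lemma subgaussian_integrable_sq:
  assumes "subgaussian M K Z" "k \<in> K"
  shows "integrable M (\<lambda>x. (Z k x)\<^sup>2)" and "integrable M (Z k)"
    and "(\<integral>\<^sup>+x. ennreal ((Z k x)\<^sup>2) \<partial>M) \<le> 1"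
proof -
  note [simp] = subgaussianD(1) [OF assms(1)] and [measurable] = subgaussianD(2) [OF assms(1,2)]
  have "(\<Sum>k'\<in>K. (if k' = k then 1 else 0) * Z k' x) = (\<Sum>k'\<in>K. if k' = k then Z k x else 0)" for x
    by (rule sum.cong) auto
  then have e: "(\<Sum>k'\<in>K. (if k' = k then 1 else 0) * Z k' x) = Z k x" for x
    using assms(2) by simp
  have e': "(\<Sum>k'\<in>K. (if k' = k then 1 else 0 :: real)\<^sup>2) = 1"
    using assms(2) by (simp add: if_distrib [of "\<lambda>x. x\<^sup>2"] cong: if_cong)
  show 1: "(\<integral>\<^sup>+x. ennreal ((Z k x)\<^sup>2) \<partial>M) \<le> 1"
    using subgaussianD(4) [OF assms(1), of "\<lambda>k'. if k' = k then 1 else 0"] unfolding e e' by simp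
  show 2: "integrable M (\<lambda>x. (Z k x)\<^sup>2)"
    using 1 by (intro integrableI_bounded) (auto intro: le_less_trans)
  show "integrable M (Z k)"
    by (rule square_integrable_imp_integrable) (use 2 in auto)
qed

lemma subgaussian_nn_integral_sum_sq:
  assumes "subgaussian M K Z"
  shows "(\<integral>\<^sup>+x. ennreal (\<Sum>k\<in>K. (Z k x)\<^sup>2) \<partial>M) \<le> of_nat (card K)"
proof -
  note [simp] = subgaussianD(1) [OF assms(1)] and [measurable] = subgaussianD(2) [OF assms(1)]
  have "(\<integral>\<^sup>+x. ennreal (\<Sum>k\<in>K. (Z k x)\<^sup>2) \<partial>M) = (\<Sum>k\<in>K. \<integral>\<^sup>+x. ennreal ((Z k x)\<^sup>2) \<partial>M)"
    by (subst sum_ennreal [symmetric], simp, subst nn_integral_sum) auto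
  also have "\<dots> \<le> (\<Sum>k\<in>K. 1)"
    by (intro sum_mono subgaussian_integrable_sq(3) [OF assms])
  finally show ?thesis by simp
qed

text \<open>x^4 <= 4! * (exp x + exp (-x)), and both exponential moments are at most exp (1/2) <= 2,
  hence 24 * 4 = 96. The fourth moment is what controls overflow of the quantizer.\<close>

lemma subgaussian_fourth_moment:
  assumes "subgaussian M K Z" "k \<in> K"
  shows "(\<integral>\<^sup>+x. ennreal ((Z k x) ^ 4) \<partial>M) \<le> 96"
proof -
  note [simp] = subgaussianD(1) [OF assms(1)] and [measurable] = subgaussianD(2) [OF assms(1,2)]
  have ex: "(\<integral>\<^sup>+x. ennreal (exp (c * Z k x)) \<partial>M) \<le> 2" if "c\<^sup>2 = 1" for c
  proof -
    have "(\<Sum>k'\<in>K. (if k' = k then c else 0) * Z k' x) = (\<Sum>k'\<in>K. if k' = k then c * Z k x else 0)" for x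
      by (rule sum.cong) auto
    then have e: "(\<Sum>k'\<in>K. (if k' = k then c else 0) * Z k' x) = c * Z k x" for x
      using assms(2) by simp
    have e': "(\<Sum>k'\<in>K. (if k' = k then c else 0)\<^sup>2) = 1"
      using assms(2) that by (simp add: if_distrib [of "\<lambda>x. x\<^sup>2"] cong: if_cong)
    have "exp (1 / 2 :: real) \<le> 2" by (rule exp_half_le2)
    then have "ennreal (exp (1 / 2)) \<le> ennreal 2" by (rule ennreal_leI)
    then show ?thesis
      using subgaussianD(3) [OF assms(1), of "\<lambda>k'. if k' = k then c else 0"] unfolding e e'
      by simp
  qed
  have "(Z k x) ^ 4 \<le> 24 * (exp (1 * Z k x) + exp ((- 1) * Z k x))" for x
  proof -
    have "(Z k x) ^ 4 \<le> 24 * exp \<bar>Z k x\<bar>"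
      using power_le_fact_exp [of "\<bar>Z k x\<bar>" 4] by (simp add: fact_numeral power_abs [symmetric])
    also have "\<dots> \<le> 24 * (exp (1 * Z k x) + exp ((- 1) * Z k x))"
      by (cases "Z k x \<ge> 0") auto
    finally show ?thesis .
  qed
  then have "(\<integral>\<^sup>+x. ennreal ((Z k x) ^ 4) \<partial>M)
      \<le> (\<integral>\<^sup>+x. 24 * (ennreal (exp (1 * Z k x)) + ennreal (exp ((- 1) * Z k x))) \<partial>M)"
    by (intro nn_integral_mono)
      (auto simp: ennreal_plus [symmetric] ennreal_mult' [symmetric] simp del: ennreal_plus
        simp flip: ennreal_numeral intro!: ennreal_leI)
  also have "\<dots> = 24 * ((\<integral>\<^sup>+x. ennreal (exp (1 * Z k x)) \<partial>M) + (\<integral>\<^sup>+x. ennreal (exp ((- 1) * Z k x)) \<partial>M))"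
    by (subst nn_integral_cmult, measurable, subst nn_integral_add) auto
  also have "\<dots> \<le> 24 * (2 + 2)"
    by (intro mult_left_mono add_mono ex) auto
  finally show ?thesis by simp
qed

text \<open>Although the decision \<open>A\<close> may depend on the noise, the bias it causes has norm at most one,
  whatever the dimension: project on the direction of the bias.\<close>

lemma subgaussian_selection_bias:
  assumes "subgaussian M K Z" and [measurable]: "A \<in> sets M"
  shows "(\<Sum>k\<in>K. (\<integral>x. Z k x * indicator A x \<partial>M)\<^sup>2) \<le> 1"
proof -
  note [simp] = subgaussianD(1) [OF assms(1)] and [measurable] = subgaussianD(2) [OF assms(1)]
  note int = subgaussian_integrable_sq [OF assms(1)]
  define v where "v k = (\<integral>x. Z k x * indicator A x \<partial>M)" for k
  define s where "s = sqrt (\<Sum>k\<in>K. (v k)\<^sup>2)"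
  have s2: "s\<^sup>2 = (\<Sum>k\<in>K. (v k)\<^sup>2)" "s \<ge> 0" by (auto simp: s_def sum_nonneg)
  have "s \<le> 1"
  proof (cases "s = 0")
    case False
    then have s: "s > 0" using s2 by simp
    define w where "w x = (\<Sum>k\<in>K. v k * Z k x)" for x
    have [measurable]: "w \<in> borel_measurable M" unfolding w_def by measurable
    have w2: "(\<integral>\<^sup>+x. ennreal ((w x)\<^sup>2) \<partial>M) \<le> ennreal (s\<^sup>2)"
      unfolding w_def s2 by (rule subgaussianD(4) [OF assms(1)])
    have iw2: "integrable M (\<lambda>x. (w x)\<^sup>2)"
      using w2 by (intro integrableI_bounded) (auto intro: le_less_trans)
    have iw: "integrable M w"
      by (rule square_integrable_imp_integrable) (use iw2 in auto)
    have E2: "(\<integral>x. (w x)\<^sup>2 \<partial>M) \<le> s\<^sup>2"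
      using w2 by (subst (asm) nn_integral_eq_integral [OF iw2]) auto
    have "s\<^sup>2 = (\<Sum>k\<in>K. \<integral>x. v k * (Z k x * indicator A x) \<partial>M)"
      unfolding s2 by (simp add: power2_eq_square) (simp add: v_def)
    also have "\<dots> = (\<integral>x. w x * indicator A x \<partial>M)"
      using int(2) unfolding w_def sum_distrib_right
      by (subst Bochner_Integration.integral_sum [symmetric])
        (auto simp: mult.assoc intro!: integrable_mult_right integrable_real_mult_indicator)
    \<comment> \<open>The arithmetic-geometric mean inequality with weight s stands in for
      Cauchy-Schwarz: the second moment of \<open>w\<close> is at most s^2, so the right side is at
      most s, and s^2 <= s follows.\<close>
    also have "\<dots> \<le> (\<integral>x. ((w x)\<^sup>2 / s + s) / 2 \<partial>M)"
    proof (rule integral_mono)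
      fix x
      have "0 \<le> (\<bar>w x\<bar> - s)\<^sup>2" by simp
      then have "2 * \<bar>w x\<bar> * s \<le> (w x)\<^sup>2 + s * s" by (simp add: power2_eq_square algebra_simps)
      then have "\<bar>w x\<bar> \<le> ((w x)\<^sup>2 / s + s) / 2" using s by (simp add: field_simps)
      moreover have "w x * indicator A x \<le> \<bar>w x\<bar>" by (auto simp: indicator_def)
      ultimately show "w x * indicator A x \<le> ((w x)\<^sup>2 / s + s) / 2" by linarith
    qed (use iw iw2 in \<open>auto intro!: integrable_real_mult_indicator\<close>)
    also have "\<dots> = ((\<integral>x. (w x)\<^sup>2 \<partial>M) / s + s) / 2"
      using iw2 by (simp add: prob_space)
    also have "\<dots> \<le> (s\<^sup>2 / s + s) / 2"
      using s E2 by (simp add: divide_right_mono)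
    also have "\<dots> = s" using s by (simp add: power2_eq_square)
    finally show ?thesis using s by (simp add: power2_eq_square)
  qed auto
  then have "s\<^sup>2 \<le> 1" using s2(2) by (simp add: power_le_one)
  then show ?thesis by (simp add: s2 v_def)
qed

section \<open>Tails of the energy of a shifted noise vector\<close>

lemma subgaussian_sq_mgf':
  fixes a :: "'i \<Rightarrow> real"
  assumes Z: "subgaussian M K Z" and l: "0 \<le> l" "l \<le> 1 / 4"
  shows "(\<integral>\<^sup>+x. ennreal (exp (l * ((\<Sum>k\<in>K. (a k + Z k x)\<^sup>2) - card K))) \<partial>M)
    \<le> ennreal (exp (4 * l\<^sup>2 * card K + 2 * l * (\<Sum>k\<in>K. (a k)\<^sup>2)))"
proof -
  note [simp] = subgaussianD(1) [OF Z] and [measurable] = subgaussianD(2) [OF Z]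
  \<comment> \<open>Two bounds valid for l <= 1/4: -ln (1 - 2*l) / 2 <= l + 4*l^2 and l / (1 - 2*l)
    <= 2*l. Centring by \<open>card K\<close> removes the linear part of the first one.\<close>
  have "- (2 * l) - 2 * (2 * l)\<^sup>2 \<le> ln (1 - 2 * l)"
    by (rule ln_one_minus_pos_lower_bound) (use l in auto)
  then have "- (l + 4 * l\<^sup>2) \<le> ln (sqrt (1 - 2 * l))"
    using l by (simp add: ln_sqrt power_mult_distrib)
  then have "exp (- (l + 4 * l\<^sup>2)) \<le> exp (ln (sqrt (1 - 2 * l)))"
    by (simp only: exp_le_cancel_iff)
  then have "exp (- (l + 4 * l\<^sup>2)) \<le> sqrt (1 - 2 * l)" using l by simp
  then have "inverse (sqrt (1 - 2 * l)) \<le> inverse (exp (- (l + 4 * l\<^sup>2)))"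
    by (rule le_imp_inverse_le) simp
  then have "inverse (sqrt (1 - 2 * l)) \<le> exp (l + 4 * l\<^sup>2)"
    by (simp only: exp_minus inverse_inverse_eq)
  then have 1: "inverse (sqrt (1 - 2 * l)) ^ card K \<le> exp (l + 4 * l\<^sup>2) ^ card K"
    using l by (intro power_mono) auto
  have "l / (1 - 2 * l) \<le> 2 * l" using l mult_left_mono [of "4 * l" 1 l] by (simp add: field_simps)
  then have "l / (1 - 2 * l) * (\<Sum>k\<in>K. (a k)\<^sup>2) \<le> 2 * l * (\<Sum>k\<in>K. (a k)\<^sup>2)"
    by (rule mult_right_mono) (simp add: sum_nonneg)
  then have "exp (l * (\<Sum>k\<in>K. (a k)\<^sup>2) / (1 - 2 * l)) * inverse (sqrt (1 - 2 * l)) ^ card K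
      \<le> exp (2 * l * (\<Sum>k\<in>K. (a k)\<^sup>2)) * exp (l + 4 * l\<^sup>2) ^ card K"
    using l by (intro mult_mono 1) auto
  also have "\<dots> = exp (l * card K) * exp (4 * l\<^sup>2 * card K + 2 * l * (\<Sum>k\<in>K. (a k)\<^sup>2))"
    by (simp add: exp_of_nat_mult [symmetric] exp_add [symmetric] algebra_simps)
  finally have 2: "exp (l * (\<Sum>k\<in>K. (a k)\<^sup>2) / (1 - 2 * l)) / sqrt (1 - 2 * l) ^ card K \<le> \<dots>"
    by (simp add: divide_inverse power_inverse)
  have "(\<integral>\<^sup>+x. ennreal (exp (l * ((\<Sum>k\<in>K. (a k + Z k x)\<^sup>2) - card K))) \<partial>M) =
      (\<integral>\<^sup>+x. ennreal (exp (- l * card K)) * ennreal (exp (l * (\<Sum>k\<in>K. (a k + Z k x)\<^sup>2))) \<partial>M)"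
    by (simp add: ennreal_mult [symmetric] exp_add [symmetric] algebra_simps)
  also have "\<dots> = ennreal (exp (- l * card K)) * (\<integral>\<^sup>+x. ennreal (exp (l * (\<Sum>k\<in>K. (a k + Z k x)\<^sup>2))) \<partial>M)"
    by (rule nn_integral_cmult) measurable
  also have "\<dots> \<le> ennreal (exp (- l * card K)) *
      ennreal (exp (l * card K) * exp (4 * l\<^sup>2 * card K + 2 * l * (\<Sum>k\<in>K. (a k)\<^sup>2)))"
    using l by (intro mult_left_mono order.trans [OF subgaussian_sq_mgf [OF Z]] ennreal_leI 2) auto
  also have "\<dots> = ennreal (exp (4 * l\<^sup>2 * card K + 2 * l * (\<Sum>k\<in>K. (a k)\<^sup>2)))"
    by (simp add: ennreal_mult [symmetric] exp_add [symmetric])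
  finally show ?thesis .
qed

text \<open>Markov's inequality for the exponential moment. The parameter l stays free and is later
  taken of the order of one over the standard deviation of the noise energy.\<close>

lemma subgaussian_upper_tail:
  fixes a :: "'i \<Rightarrow> real" and l t :: real
  assumes Z: "subgaussian M K Z" and l: "0 \<le> l" "l \<le> 1 / 4"
  shows "prob {x \<in> space M. real (card K) + t < (\<Sum>k\<in>K. (a k + Z k x)\<^sup>2)}
    \<le> exp (4 * l\<^sup>2 * card K + 2 * l * (\<Sum>k\<in>K. (a k)\<^sup>2) - l * t)"
proof -
  note [simp] = subgaussianD(1) [OF Z] and [measurable] = subgaussianD(2) [OF Z]
  let ?B = "{x \<in> space M. real (card K) + t < (\<Sum>k\<in>K. (a k + Z k x)\<^sup>2)}"
  have "emeasure M ?B = (\<integral>\<^sup>+x. indicator ?B x \<partial>M)" by simp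
  also have "\<dots> \<le> (\<integral>\<^sup>+x. ennreal (exp (- l * t)) * ennreal (exp (l * ((\<Sum>k\<in>K. (a k + Z k x)\<^sup>2) - card K))) \<partial>M)"
  proof (rule nn_integral_mono)
    fix x
    have "1 \<le> exp (- l * t) * exp (l * ((\<Sum>k\<in>K. (a k + Z k x)\<^sup>2) - card K))" if "x \<in> ?B"
    proof -
      have "0 \<le> l * ((\<Sum>k\<in>K. (a k + Z k x)\<^sup>2) - card K - t)"
        using that l by (intro mult_nonneg_nonneg) auto
      then show ?thesis by (simp add: exp_add [symmetric] algebra_simps)
    qed
    then show "indicator ?B x \<le> ennreal (exp (- l * t)) * ennreal (exp (l * ((\<Sum>k\<in>K. (a k + Z k x)\<^sup>2) - card K)))"
      by (auto simp: ennreal_mult [symmetric] indicator_def simp flip: ennreal_1 intro!: ennreal_leI)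
  qed
  also have "\<dots> = ennreal (exp (- l * t)) * (\<integral>\<^sup>+x. ennreal (exp (l * ((\<Sum>k\<in>K. (a k + Z k x)\<^sup>2) - card K))) \<partial>M)"
    by (rule nn_integral_cmult) measurable
  also have "\<dots> \<le> ennreal (exp (- l * t)) * ennreal (exp (4 * l\<^sup>2 * card K + 2 * l * (\<Sum>k\<in>K. (a k)\<^sup>2)))"
    by (intro mult_left_mono subgaussian_sq_mgf' assms) auto
  also have "\<dots> = ennreal (exp (4 * l\<^sup>2 * card K + 2 * l * (\<Sum>k\<in>K. (a k)\<^sup>2) - l * t))"
    by (simp add: ennreal_mult [symmetric] exp_add [symmetric])
  finally show ?thesis by (simp add: emeasure_eq_measure)
qed

text \<open>Z = 0 is also sub-Gaussian, so upper moment bounds cannot keep the noise energy from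
  being small. The hypothesis \<open>var\<close> supplies its mean; a bound on the mean of its
  positive fluctuation then bounds the negative one, and Markov's inequality applies.\<close>

lemma subgaussian_lower_tail:
  fixes a :: "'i \<Rightarrow> real" and r t :: real
  assumes Z: "subgaussian M K Z" and r: "r \<ge> 1" "card K \<le> 2 * r\<^sup>2"
    and var: "real (card K) - 1 \<le> (\<Sum>k\<in>K. \<integral>x. (Z k x)\<^sup>2 \<partial>M)"
    and t: "t > 0" "4 * t \<le> (\<Sum>k\<in>K. (a k)\<^sup>2)"
  shows "prob {x \<in> space M. (\<Sum>k\<in>K. (a k + Z k x)\<^sup>2) \<le> real (card K) + t} \<le> 13 * r / t"
proof -
  note [simp] = subgaussianD(1) [OF Z] and [measurable] = subgaussianD(2) [OF Z]
  note int = subgaussian_integrable_sq [OF Z]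
  define Y where "Y x = (\<Sum>k\<in>K. (Z k x)\<^sup>2) - card K" for x
  define w where "w x = (\<Sum>k\<in>K. a k * Z k x)" for x
  define S where "S = (\<Sum>k\<in>K. (a k)\<^sup>2)"
  have [measurable]: "Y \<in> borel_measurable M" "w \<in> borel_measurable M"
    unfolding Y_def w_def by measurable
  have iY: "integrable M Y" unfolding Y_def using int(1) by auto
  have S: "S > 0" "4 * t \<le> S" using t by (auto simp: S_def)
  \<comment> \<open>The shifted energy is S + 2*w + Y + \<open>card K\<close>. If it is at most
    \<open>card K\<close> + t although Y > -t, then 2*w <= 2*t - S <= -S/2.\<close>
  have sub: "{x \<in> space M. (\<Sum>k\<in>K. (a k + Z k x)\<^sup>2) \<le> real (card K) + t} \<subseteq>
     {x \<in> space M. S\<^sup>2 / 16 \<le> (w x)\<^sup>2} \<union> {x \<in> space M. t \<le> max 0 (- Y x)}"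
  proof clarify
    fix x assume x: "x \<in> space M" "(\<Sum>k\<in>K. (a k + Z k x)\<^sup>2) \<le> real (card K) + t" "\<not> t \<le> max 0 (- Y x)"
    have "(\<Sum>k\<in>K. (a k + Z k x)\<^sup>2) = S + 2 * w x + Y x + card K"
      by (simp add: S_def w_def Y_def power2_sum sum.distrib sum_distrib_left mult.assoc)
    then have "S / 4 \<le> - w x" using x S by auto
    then have "(S / 4)\<^sup>2 \<le> (- w x)\<^sup>2" using S by (intro power_mono) auto
    then show "S\<^sup>2 / 16 \<le> (w x)\<^sup>2" by (simp add: power_divide)
  qed
  have w2: "(\<integral>\<^sup>+x. ennreal ((w x)\<^sup>2) \<partial>M) \<le> ennreal S"
    unfolding w_def S_def by (rule subgaussianD(4) [OF Z])
  have iw2: "integrable M (\<lambda>x. (w x)\<^sup>2)"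
    using w2 by (intro integrableI_bounded) (auto intro: le_less_trans)
  have "prob {x \<in> space M. S\<^sup>2 / 16 \<le> (w x)\<^sup>2} \<le> (\<integral>x. (w x)\<^sup>2 \<partial>M) / (S\<^sup>2 / 16)"
    using S by (intro integral_Markov_inequality_measure [where A = "{}"] iw2) auto
  also have "\<dots> \<le> S / (S\<^sup>2 / 16)"
    using w2 S by (intro divide_right_mono) (auto simp: nn_integral_eq_integral [OF iw2])
  also have "\<dots> \<le> 4 / t" using S t by (simp add: power2_eq_square field_simps)
  also have "\<dots> \<le> 4 * r / t" using r t by (simp add: field_simps)
  finally have 1: "prob {x \<in> space M. S\<^sup>2 / 16 \<le> (w x)\<^sup>2} \<le> 4 * r / t" .
  \<comment> \<open>Uses u <= exp u for u = Y / (4*r). The choice l = 1 / (4*r) keeps 4 * l^2 *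
    \<open>card K\<close> below 1/2, so the exponential moment is at most 2.\<close>
  have pos: "(\<integral>x. max 0 (Y x) \<partial>M) \<le> 8 * r"
  proof -
    define l where "l = 1 / (4 * r)"
    have l: "0 < l" "l \<le> 1 / 4" "4 * l\<^sup>2 * card K \<le> 1 / 2"
      using r by (auto simp: l_def power_divide power2_eq_square field_simps)
    have "ennreal (\<integral>x. max 0 (Y x) \<partial>M) = (\<integral>\<^sup>+x. ennreal (max 0 (Y x)) \<partial>M)"
      using iY by (intro nn_integral_eq_integral [symmetric]) auto
    also have "\<dots> \<le> (\<integral>\<^sup>+x. ennreal (4 * r) * ennreal (exp (l * Y x)) \<partial>M)"
    proof (rule nn_integral_mono)
      fix x
      have "l * Y x \<le> exp (l * Y x)" using exp_ge_add_one_self [of "l * Y x"] by linarith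
      moreover have "4 * r * (l * Y x) = Y x" using r by (simp add: l_def)
      moreover have "4 * r * (l * Y x) \<le> 4 * r * exp (l * Y x)"
        using r calculation(1) by (intro mult_left_mono) auto
      ultimately have "Y x \<le> 4 * r * exp (l * Y x)" by linarith
      then have "max 0 (Y x) \<le> 4 * r * exp (l * Y x)" using r by auto
      then show "ennreal (max 0 (Y x)) \<le> ennreal (4 * r) * ennreal (exp (l * Y x))"
        using r by (simp add: ennreal_mult [symmetric] ennreal_leI del: ennreal_max_0)
    qed
    also have "\<dots> = ennreal (4 * r) * (\<integral>\<^sup>+x. ennreal (exp (l * Y x)) \<partial>M)"
      by (rule nn_integral_cmult) measurable
    also have "\<dots> \<le> ennreal (4 * r) * ennreal (exp (4 * l\<^sup>2 * card K))"
      using subgaussian_sq_mgf' [OF Z, of l "\<lambda>_. 0"] l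
      by (intro mult_left_mono) (auto simp: Y_def)
    also have "\<dots> \<le> ennreal (4 * r) * ennreal 2"
    proof (intro mult_left_mono ennreal_leI)
      have "exp (4 * l\<^sup>2 * card K) \<le> exp (1 / 2)" using l by simp
      also have "\<dots> \<le> (2 :: real)" by (rule exp_half_le2)
      finally show "exp (4 * l\<^sup>2 * card K) \<le> 2" .
    qed auto
    also have "\<dots> = ennreal (8 * r)" using r by (subst ennreal_mult [symmetric]) auto
    finally show ?thesis using r by simp
  qed
  \<comment> \<open>The mean of the negative part is the mean of the positive part minus that of Y,
    which is at least -1 by \<open>var\<close>. This gives 8*r + 1 <= 9*r.\<close>
  have "(\<integral>x. max 0 (- Y x) \<partial>M) = (\<integral>x. max 0 (Y x) - Y x \<partial>M)"
    by (rule Bochner_Integration.integral_cong) auto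
  also have "\<dots> = (\<integral>x. max 0 (Y x) \<partial>M) - (\<integral>x. Y x \<partial>M)"
    using iY by simp
  finally have "(\<integral>x. max 0 (- Y x) \<partial>M) = (\<integral>x. max 0 (Y x) \<partial>M) - (\<integral>x. Y x \<partial>M)" .
  moreover have "- 1 \<le> (\<integral>x. Y x \<partial>M)"
    using var int(1) by (simp add: Y_def prob_space)
  ultimately have "(\<integral>x. max 0 (- Y x) \<partial>M) \<le> 9 * r" using pos r by simp
  moreover have "prob {x \<in> space M. t \<le> max 0 (- Y x)} \<le> (\<integral>x. max 0 (- Y x) \<partial>M) / t"
    using iY t by (intro integral_Markov_inequality_measure [where A = "{}"]) auto
  ultimately have 2: "prob {x \<in> space M. t \<le> max 0 (- Y x)} \<le> 9 * r / t"
    using t by (meson divide_right_mono less_imp_le order_trans)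
  have "prob {x \<in> space M. (\<Sum>k\<in>K. (a k + Z k x)\<^sup>2) \<le> real (card K) + t} \<le>
     prob ({x \<in> space M. S\<^sup>2 / 16 \<le> (w x)\<^sup>2} \<union> {x \<in> space M. t \<le> max 0 (- Y x)})"
    by (intro finite_measure_mono sub) auto
  also have "\<dots> \<le> prob {x \<in> space M. S\<^sup>2 / 16 \<le> (w x)\<^sup>2} + prob {x \<in> space M. t \<le> max 0 (- Y x)}"
    by (rule measure_subadditive) auto
  also have "\<dots> \<le> 4 * r / t + 9 * r / t" using 1 2 by linarith
  finally show ?thesis by (simp add: add_divide_distrib [symmetric])
qed

end

section \<open>Averaging over the machines that send a level\<close>

definition senders :: "'b set \<Rightarrow> 'a set \<Rightarrow> ('b \<Rightarrow> 'a) \<Rightarrow> 'b set" where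
  "senders T A \<omega> = {i \<in> T. \<omega> i \<in> A}"

text \<open>The rule of the centre for a single coefficient, modelled on the product space:
  \<open>A\<close> is the event that one machine sends the level, and \<open>V\<close> is the
  quantized value it would send.\<close>

definition sender_mean :: "'b set \<Rightarrow> 'a set \<Rightarrow> ('a \<Rightarrow> real) \<Rightarrow> ('b \<Rightarrow> 'a) \<Rightarrow> real" where
  "sender_mean T A V \<omega> =
     (if card T \<le> 4 * card (senders T A \<omega>)
      then (\<Sum>i\<in>senders T A \<omega>. V (\<omega> i)) / card (senders T A \<omega>) else 0)"

lemma finite_senders [simp]: "finite T \<Longrightarrow> finite (senders T A \<omega>)"
  by (simp add: senders_def)

lemma card_senders: "finite T \<Longrightarrow> real (card (senders T A \<omega>)) = (\<Sum>i\<in>T. indicator A (\<omega> i))"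
  by (simp add: senders_def indicator_def sum.If_cases Int_def)

lemma power_card_senders: "finite T \<Longrightarrow> (\<Prod>i\<in>T. if \<omega> i \<in> A then t else 1) = t ^ card (senders T A \<omega>)"
  for t :: "'c::comm_semiring_1"
  by (simp add: senders_def prod.If_cases Int_def)

text \<open>Turns a sum over a random index set into a sum of independent terms, one per
  machine.\<close>

lemma sum_senders: "finite T \<Longrightarrow> (\<Sum>i\<in>senders T A \<omega>. V (\<omega> i)) = (\<Sum>i\<in>T. V (\<omega> i) * indicator A (\<omega> i))"
  for V :: "'a \<Rightarrow> real"
  unfolding senders_def by (rule sum.mono_neutral_cong_left) (auto simp: indicator_def)

lemma three_sq_le: "(a + b + c)\<^sup>2 \<le> 3 * (a\<^sup>2 + b\<^sup>2 + c\<^sup>2)" for a b c :: real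
proof -
  have "0 \<le> (a - b)\<^sup>2 + (b - c)\<^sup>2 + (a - c)\<^sup>2" by simp
  then show ?thesis by (simp add: power2_eq_square algebra_simps)
qed

section \<open>Independent machines and the number of senders\<close>

context prob_space
begin

abbreviation reject_prob :: "'b set \<Rightarrow> 'a set \<Rightarrow> ennreal" where
  "reject_prob T A \<equiv> \<integral>\<^sup>+\<omega>. (if card T \<le> 4 * card (senders T A \<omega>) then 0 else 1) \<partial>PiM T (\<lambda>_. M)"

lemma pred_card_senders [measurable]:
  assumes [simp]: "finite T" and [measurable]: "A \<in> sets M"
  shows "Measurable.pred (PiM T (\<lambda>_. M)) (\<lambda>\<omega>. card T \<le> 4 * card (senders T A \<omega>))"
proof -
  have "Measurable.pred (PiM T (\<lambda>_. M)) (\<lambda>\<omega>. real (card T) \<le> 4 * (\<Sum>i\<in>T. indicator A (\<omega> i)))"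
    by measurable
  moreover have "real (card T) \<le> 4 * (\<Sum>i\<in>T. indicator A (\<omega> i)) \<longleftrightarrow> card T \<le> 4 * card (senders T A \<omega>)" for \<omega> :: "'b \<Rightarrow> 'a"
    unfolding card_senders [OF assms(1), symmetric] by linarith
  ultimately show ?thesis by simp
qed

lemma nn_integral_PiM_component:
  assumes "finite T" "i \<in> T" "f \<in> borel_measurable M"
  shows "(\<integral>\<^sup>+\<omega>. f (\<omega> i) \<partial>PiM T (\<lambda>_. M)) = (\<integral>\<^sup>+x. f x \<partial>M)"
proof -
  have "distr (PiM T (\<lambda>_. M)) M (\<lambda>\<omega>. \<omega> i) = M"
    by (rule distr_PiM_component) (use assms prob_space_axioms in auto)
  then have "(\<integral>\<^sup>+x. f x \<partial>M) = (\<integral>\<^sup>+x. f x \<partial>distr (PiM T (\<lambda>_. M)) M (\<lambda>\<omega>. \<omega> i))" by simp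
  also have "\<dots> = (\<integral>\<^sup>+\<omega>. f (\<omega> i) \<partial>PiM T (\<lambda>_. M))"
    using assms by (intro nn_integral_distr) auto
  finally show ?thesis by simp
qed

lemma nn_integral_PiM_sum:
  assumes "finite T" and [measurable]: "f \<in> borel_measurable M"
  shows "(\<integral>\<^sup>+\<omega>. (\<Sum>i\<in>T. f (\<omega> i)) \<partial>PiM T (\<lambda>_. M)) = of_nat (card T) * (\<integral>\<^sup>+x. f x \<partial>M)"
  using assms by (subst nn_integral_sum) (auto simp: nn_integral_PiM_component)

lemma nn_integral_PiM_sum_sq:
  fixes W :: "'a \<Rightarrow> real"
  assumes T: "finite T" and [measurable]: "W \<in> borel_measurable M" and W2: "integrable M (\<lambda>x. (W x)\<^sup>2)"
  shows "(\<integral>\<^sup>+\<omega>. ennreal ((\<Sum>i\<in>T. W (\<omega> i))\<^sup>2) \<partial>PiM T (\<lambda>_. M)) \<le>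
    ennreal (card T * (\<integral>x. (W x)\<^sup>2 \<partial>M) + (card T)\<^sup>2 * (\<integral>x. W x \<partial>M)\<^sup>2)"
proof -
  interpret P: product_sigma_finite "\<lambda>_ :: 'b. M" ..
  define e where "e = (\<integral>x. W x \<partial>M)"
  define e2 where "e2 = (\<integral>x. (W x)\<^sup>2 \<partial>M)"
  have W1: "integrable M W" by (rule square_integrable_imp_integrable) (use W2 in auto)
  have e2: "0 \<le> e2" by (simp add: e2_def)
  have *: "integrable (PiM T (\<lambda>_. M)) (\<lambda>\<omega>. W (\<omega> i) * W (\<omega> j)) \<and>
     (\<integral>\<omega>. W (\<omega> i) * W (\<omega> j) \<partial>PiM T (\<lambda>_. M)) \<le> (if i = j then e2 else 0) + e\<^sup>2"
    if ij: "i \<in> T" "j \<in> T" for i j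
  proof -
    \<comment> \<open>One factor per machine: \<open>W\<close> at the positions i and j, hence its
      square when they coincide, and 1 elsewhere. Both cases then are products of independent
      integrals.\<close>
    define F where "F k x = (if k = i then W x else 1) * (if k = j then W x else 1)" for k x
    have int: "integrable M (F k)" for k
      using W1 W2 unfolding F_def by (cases "k = i"; cases "k = j"; simp add: power2_eq_square)
    have eq: "(\<Prod>k\<in>T. F k (\<omega> k)) = W (\<omega> i) * W (\<omega> j)" for \<omega>
    proof -
      have "(\<Prod>k\<in>T. F k (\<omega> k)) = (\<Prod>k\<in>T. (if k = i then W (\<omega> i) else 1) * (if k = j then W (\<omega> j) else 1))"
        by (rule prod.cong) (auto simp: F_def)
      then show ?thesis using ij T by (simp add: prod.distrib)
    qed
    have "(\<Prod>k\<in>T. \<integral>x. F k x \<partial>M) \<le> (if i = j then e2 else 0) + e\<^sup>2"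
    proof (cases "i = j")
      case True
      then have "(\<Prod>k\<in>T. \<integral>x. F k x \<partial>M) = (\<Prod>k\<in>T. if k = i then e2 else 1)"
        by (intro prod.cong) (auto simp: F_def e2_def power2_eq_square prob_space)
      then show ?thesis using ij T True by simp
    next
      case False
      then have "(\<Prod>k\<in>T. \<integral>x. F k x \<partial>M) = (\<Prod>k\<in>T. (if k = i then e else 1) * (if k = j then e else 1))"
        by (intro prod.cong) (auto simp: F_def e_def prob_space)
      then show ?thesis using ij T False by (simp add: prod.distrib power2_eq_square)
    qed
    then show ?thesis
      using P.product_integral_prod [OF T, of F] P.product_integrable_prod [OF T, of F] int
      by (simp add: eq)
  qed
  have sq: "(\<Sum>i\<in>T. W (\<omega> i))\<^sup>2 = (\<Sum>i\<in>T. \<Sum>j\<in>T. W (\<omega> i) * W (\<omega> j))" for \<omega>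
    by (simp add: power2_eq_square sum_product)
  have int: "integrable (PiM T (\<lambda>_. M)) (\<lambda>\<omega>. (\<Sum>i\<in>T. W (\<omega> i))\<^sup>2)"
    unfolding sq using * by (intro Bochner_Integration.integrable_sum) auto
  have "(\<integral>\<omega>. (\<Sum>i\<in>T. W (\<omega> i))\<^sup>2 \<partial>PiM T (\<lambda>_. M)) =
      (\<Sum>i\<in>T. \<Sum>j\<in>T. \<integral>\<omega>. W (\<omega> i) * W (\<omega> j) \<partial>PiM T (\<lambda>_. M))"
    unfolding sq using *
    by (subst Bochner_Integration.integral_sum)
      (auto intro!: sum.cong Bochner_Integration.integral_sum Bochner_Integration.integrable_sum)
  also have "\<dots> \<le> (\<Sum>i\<in>T. \<Sum>j\<in>T. (if i = j then e2 else 0) + e\<^sup>2)"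
    using * by (intro sum_mono) auto
  also have "\<dots> = card T * e2 + (card T)\<^sup>2 * e\<^sup>2"
    using T by (simp add: sum.distrib power2_eq_square algebra_simps)
  finally show ?thesis
    unfolding nn_integral_eq_integral [OF int, simplified] e_def e2_def by (rule ennreal_leI)
qed

text \<open>Exponential tilting by the number of machines in \<open>B\<close>, where machine i
  carries a weight that may depend on its own membership in \<open>B\<close>. Every other machine
  contributes at most 1 + t * \<open>prob B\<close> <= 2; for machine i the tilt is simply bounded
  by t.\<close>

lemma nn_integral_PiM_tilted:
  assumes T: "finite T" "i \<in> T" and [measurable]: "B \<in> sets M" "Y \<in> borel_measurable M"
    and t: "1 \<le> t" "prob B \<le> 1 / t"
  shows "(\<integral>\<^sup>+\<omega>. Y (\<omega> i) * ennreal (t ^ card (senders T B \<omega>)) \<partial>PiM T (\<lambda>_. M))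
    \<le> ennreal t * (\<integral>\<^sup>+x. Y x \<partial>M) * 2 ^ card T"
proof -
  interpret P: product_sigma_finite "\<lambda>_ :: 'b. M" ..
  define F where "F k x = (if k = i then Y x else 1) * (if x \<in> B then ennreal t else 1)" for k x
  have [measurable]: "F k \<in> borel_measurable M" for k unfolding F_def by measurable
  have "Y (\<omega> i) * ennreal (t ^ card (senders T B \<omega>)) = (\<Prod>k\<in>T. F k (\<omega> k))" for \<omega>
  proof -
    have "(\<Prod>k\<in>T. F k (\<omega> k)) = (\<Prod>k\<in>T. (if k = i then Y (\<omega> i) else 1) * (if \<omega> k \<in> B then ennreal t else 1))"
      by (rule prod.cong) (auto simp: F_def)
    also have "\<dots> = Y (\<omega> i) * ennreal t ^ card (senders T B \<omega>)"
      using T by (simp add: prod.distrib power_card_senders)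
    finally show ?thesis using t by (simp add: ennreal_power)
  qed
  then have "(\<integral>\<^sup>+\<omega>. Y (\<omega> i) * ennreal (t ^ card (senders T B \<omega>)) \<partial>PiM T (\<lambda>_. M)) =
     (\<Prod>k\<in>T. \<integral>\<^sup>+x. F k x \<partial>M)"
    by (simp add: P.product_nn_integral_prod [OF T(1)])
  also have "\<dots> \<le> (\<Prod>k\<in>T. (if k = i then ennreal t * (\<integral>\<^sup>+x. Y x \<partial>M) else 1) * 2)"
  proof (rule prod_mono_ennreal)
    fix k
    show "(\<integral>\<^sup>+x. F k x \<partial>M) \<le> (if k = i then ennreal t * (\<integral>\<^sup>+x. Y x \<partial>M) else 1) * 2"
    proof (cases "k = i")
      case True
      have "(\<integral>\<^sup>+x. F k x \<partial>M) \<le> (\<integral>\<^sup>+x. ennreal t * Y x \<partial>M)"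
        using True t by (intro nn_integral_mono)
          (auto simp: F_def mult.commute intro!: mult_left_mono simp flip: ennreal_1
            intro: ennreal_leI order.trans [of _ "1 * _"] mult_right_mono)
      also have "\<dots> = ennreal t * (\<integral>\<^sup>+x. Y x \<partial>M)" by (rule nn_integral_cmult) measurable
      also have "\<dots> \<le> ennreal t * (\<integral>\<^sup>+x. Y x \<partial>M) * 2"
        by (subst mult.right_neutral [symmetric], rule mult_left_mono) auto
      finally show ?thesis using True by simp
    next
      case False
      have "(\<integral>\<^sup>+x. F k x \<partial>M) \<le> (\<integral>\<^sup>+x. 1 + ennreal t * indicator B x \<partial>M)"
        using False by (intro nn_integral_mono) (auto simp: F_def)
      also have "\<dots> = 1 + ennreal t * emeasure M B"
        by (subst nn_integral_add) (auto simp: nn_integral_cmult_indicator emeasure_space_1)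
      also have "\<dots> \<le> 1 + ennreal t * ennreal (1 / t)"
        using t by (auto simp: emeasure_eq_measure intro!: add_left_mono mult_left_mono ennreal_leI)
      also have "\<dots> = 2" using t by (simp add: ennreal_mult [symmetric])
      finally show ?thesis using False by simp
    qed
  qed
  also have "\<dots> = ennreal t * (\<integral>\<^sup>+x. Y x \<partial>M) * 2 ^ card T"
    using T by (simp add: prod.distrib)
  finally show ?thesis .
qed

text \<open>On rejection at least three quarters of the machines lie outside \<open>A\<close>, and
  16^(3/4) = 8. The indicator of rejection is thus at most 16^count / 8^m, whose mean is at most 16
  * 2^m / 8^m.\<close>

lemma few_senders_unlikely:
  assumes T: "finite T" "T \<noteq> {}" and [measurable]: "A \<in> sets M" and A: "prob (space M - A) \<le> 1 / 16"
  shows "reject_prob T A \<le> ennreal (16 / 4 ^ card T)"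
proof -
  obtain i where i: "i \<in> T" using T by auto
  let ?B = "space M - A"
  have "reject_prob T A \<le> (\<integral>\<^sup>+\<omega>. ennreal (1 / 8 ^ card T) * (1 * ennreal (16 ^ card (senders T ?B \<omega>))) \<partial>PiM T (\<lambda>_. M))"
  proof (rule nn_integral_mono)
    fix \<omega> assume "\<omega> \<in> space (PiM T (\<lambda>_. M))"
    then have "senders T ?B \<omega> = T - senders T A \<omega>"
      by (auto simp: senders_def space_PiM)
    then have c: "card (senders T ?B \<omega>) = card T - card (senders T A \<omega>)"
      using T by (simp add: card_Diff_subset) (auto simp: senders_def intro!: card_Diff_subset)
    show "(if card T \<le> 4 * card (senders T A \<omega>) then 0 else 1) \<le>
       ennreal (1 / 8 ^ card T) * (1 * ennreal (16 ^ card (senders T ?B \<omega>)))"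
    proof (cases "card T \<le> 4 * card (senders T A \<omega>)")
      case False
      then have "3 * card T \<le> 4 * card (senders T ?B \<omega>)" unfolding c by linarith
      then have "(2 :: real) ^ (3 * card T) \<le> 2 ^ (4 * card (senders T ?B \<omega>))"
        by (intro power_increasing) auto
      then have "1 \<le> 1 / 8 ^ card T * (16 :: real) ^ card (senders T ?B \<omega>)"
        by (simp add: power_mult)
      then have "ennreal 1 \<le> ennreal (1 / 8 ^ card T * 16 ^ card (senders T ?B \<omega>))" by (rule ennreal_leI)
      then show ?thesis using False by (simp add: ennreal_mult [symmetric])
    qed simp
  qed
  also have "\<dots> = ennreal (1 / 8 ^ card T) * (\<integral>\<^sup>+\<omega>. 1 * ennreal (16 ^ card (senders T ?B \<omega>)) \<partial>PiM T (\<lambda>_. M))"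
    using T(1) by (subst nn_integral_cmult) (auto simp: power_card_senders [symmetric])
  also have "\<dots> \<le> ennreal (1 / 8 ^ card T) * (ennreal 16 * (\<integral>\<^sup>+x. 1 \<partial>M) * 2 ^ card T)"
    using A by (intro mult_left_mono nn_integral_PiM_tilted [OF T(1) i, of ?B "\<lambda>_. 1" 16]) auto
  also have "\<dots> = ennreal (1 / 8 ^ card T * (16 * 2 ^ card T))"
  proof -
    have "a * (ennreal 16 * 1 * 2 ^ card T) = ennreal (b * (16 * 2 ^ card T))"
      if "a = ennreal b" "b \<ge> 0" for a b
      using that by (simp add: ennreal_mult flip: ennreal_power)
    from this [OF refl, of "1 / 8 ^ card T"] show ?thesis by (simp add: emeasure_space_1)
  qed
  also have "1 / 8 ^ card T * (16 * 2 ^ card T) = (16 / 4 ^ card T :: real)"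
    using power_mult_distrib [of "2 :: real" 4 "card T"] by (simp add: field_simps)
  finally show ?thesis .
qed

text \<open>For a level that almost nobody sends, the noise of the senders matters only on an event
  of exponentially small probability. \<open>Y\<close> is not independent of that event, so it is
  integrated under the same tilt, now with t = 2^12, whose fourth root is 8.\<close>

lemma many_senders_noise:
  assumes T: "finite T" and [measurable]: "A \<in> sets M" "Y \<in> borel_measurable M"
    and A: "prob A \<le> 1 / 2 ^ 12"
  shows "(\<integral>\<^sup>+\<omega>. (if card T \<le> 4 * card (senders T A \<omega>) then \<Sum>i\<in>T. Y (\<omega> i) else 0) \<partial>PiM T (\<lambda>_. M))
    \<le> ennreal (card T * 2 ^ 12 / 4 ^ card T) * (\<integral>\<^sup>+x. Y x \<partial>M)"
proof -
  define t :: real where "t = 2 ^ 12"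
  have t: "1 \<le> t" "prob A \<le> 1 / t" using A by (auto simp: t_def)
  have "(\<integral>\<^sup>+\<omega>. (if card T \<le> 4 * card (senders T A \<omega>) then \<Sum>i\<in>T. Y (\<omega> i) else 0) \<partial>PiM T (\<lambda>_. M))
    \<le> (\<integral>\<^sup>+\<omega>. (\<Sum>i\<in>T. ennreal (1 / 8 ^ card T) * (Y (\<omega> i) * ennreal (t ^ card (senders T A \<omega>)))) \<partial>PiM T (\<lambda>_. M))"
  proof (rule nn_integral_mono)
    fix \<omega> :: "'b \<Rightarrow> 'a"
    show "(if card T \<le> 4 * card (senders T A \<omega>) then \<Sum>i\<in>T. Y (\<omega> i) else 0) \<le>
       (\<Sum>i\<in>T. ennreal (1 / 8 ^ card T) * (Y (\<omega> i) * ennreal (t ^ card (senders T A \<omega>))))"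
    proof (cases "card T \<le> 4 * card (senders T A \<omega>)")
      case True
      then have "(2 :: real) ^ (3 * card T) \<le> 2 ^ (12 * card (senders T A \<omega>))"
        by (intro power_increasing) auto
      then have "1 \<le> 1 / 8 ^ card T * t ^ card (senders T A \<omega>)"
        unfolding t_def by (simp only: power_mult) simp
      then have "ennreal 1 \<le> ennreal (1 / 8 ^ card T * t ^ card (senders T A \<omega>))" by (rule ennreal_leI)
      then have 1: "1 \<le> ennreal (1 / 8 ^ card T) * ennreal (t ^ card (senders T A \<omega>))"
        using t by (subst ennreal_mult [symmetric]) auto
      have "Y (\<omega> i) \<le> ennreal (1 / 8 ^ card T) * (Y (\<omega> i) * ennreal (t ^ card (senders T A \<omega>)))" for i
        using mult_left_mono [OF 1, of "Y (\<omega> i)"] by (simp add: mult_ac)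
      then show ?thesis using True by (auto intro!: sum_mono)
    qed simp
  qed
  also have "\<dots> = (\<Sum>i\<in>T. ennreal (1 / 8 ^ card T) *
      (\<integral>\<^sup>+\<omega>. Y (\<omega> i) * ennreal (t ^ card (senders T A \<omega>)) \<partial>PiM T (\<lambda>_. M)))"
    using T by (subst nn_integral_sum, simp_all add: power_card_senders [symmetric])
      (intro sum.cong refl nn_integral_cmult, measurable)
  also have "\<dots> \<le> (\<Sum>i\<in>T. ennreal (1 / 8 ^ card T) * (ennreal t * (\<integral>\<^sup>+x. Y x \<partial>M) * 2 ^ card T))"
    by (intro sum_mono mult_left_mono nn_integral_PiM_tilted T t) auto
  also have "\<dots> = ennreal (card T * (1 / 8 ^ card T * (t * 2 ^ card T))) * (\<integral>\<^sup>+x. Y x \<partial>M)"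
  proof -
    have "of_nat (card T) * (a * (ennreal t * Y * 2 ^ card T)) = ennreal (card T * (b * (t * 2 ^ card T))) * Y"
      if "a = ennreal b" "b \<ge> 0" for a b Y
      using that t by (simp add: ennreal_mult ennreal_of_nat_eq_real_of_nat mult_ac flip: ennreal_power)
    from this [OF refl, of "1 / 8 ^ card T"] show ?thesis by simp
  qed
  also have "card T * (1 / 8 ^ card T * (t * 2 ^ card T)) = card T * 2 ^ 12 / 4 ^ card T"
    unfolding t_def using power_mult_distrib [of "2 :: real" 4 "card T"] by (simp add: field_simps)
  finally show ?thesis .
qed

end

text \<open>The first form keeps individual squares and suits terms without cancellation; the second
  keeps the sum, in which independent noises cancel. \<open>m <= 4 * card S\<close> is the quota of
  the centre.\<close>

lemma mean_sq_le:
  fixes x :: "'b \<Rightarrow> real"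
  assumes "0 < m" "m \<le> 4 * card S"
  shows "((\<Sum>i\<in>S. x i) / card S)\<^sup>2 \<le> 4 / m * (\<Sum>i\<in>S. (x i)\<^sup>2)"
    and "((\<Sum>i\<in>S. x i) / card S)\<^sup>2 \<le> 16 / (real m)\<^sup>2 * (\<Sum>i\<in>S. x i)\<^sup>2"
proof -
  have s: "0 < real (card S)" "1 / real (card S) \<le> 4 / m" using assms by (auto simp: field_simps)
  have "((\<Sum>i\<in>S. x i) / card S)\<^sup>2 \<le> ((\<Sum>i\<in>S. (x i)\<^sup>2) * card S) / (real (card S))\<^sup>2"
    unfolding power_divide by (intro divide_right_mono sum_squared_le_sum_of_squares) auto
  also have "\<dots> = 1 / card S * (\<Sum>i\<in>S. (x i)\<^sup>2)"
    using s by (simp add: power2_eq_square)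
  also have "\<dots> \<le> 4 / m * (\<Sum>i\<in>S. (x i)\<^sup>2)"
    by (intro mult_right_mono s sum_nonneg) auto
  finally show "((\<Sum>i\<in>S. x i) / card S)\<^sup>2 \<le> 4 / m * (\<Sum>i\<in>S. (x i)\<^sup>2)" .
  have "((\<Sum>i\<in>S. x i) / card S)\<^sup>2 = (1 / card S)\<^sup>2 * (\<Sum>i\<in>S. x i)\<^sup>2"
    by (simp add: power_divide)
  also have "\<dots> \<le> (4 / m)\<^sup>2 * (\<Sum>i\<in>S. x i)\<^sup>2"
    by (intro mult_right_mono power_mono s) auto
  finally show "((\<Sum>i\<in>S. x i) / card S)\<^sup>2 \<le> 16 / (real m)\<^sup>2 * (\<Sum>i\<in>S. x i)\<^sup>2"
    by (simp add: power_divide)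
qed

section \<open>Risk of the sender average on one level\<close>

context prob_space
begin

text \<open>If the level is accepted, the error splits into quantization, deterministic grid bias
  and noise, at the price of a factor 3; the 12 is 3 times the 4 of the quota. Rejection costs the
  whole energy. The noise is left as an abstract majorant \<open>N\<close>, since frequently and
  rarely sent levels bound it in different ways.\<close>

lemma sender_mean_risk_aux:
  fixes \<theta> \<mu> :: "'i \<Rightarrow> real" and T :: "'b set" and N :: "('b \<Rightarrow> 'a) \<Rightarrow> ennreal"
  assumes T: "finite T" "T \<noteq> {}" and Z: "subgaussian M K Z"
    and [measurable]: "A \<in> sets M" "\<And>k. k \<in> K \<Longrightarrow> V k \<in> borel_measurable M"
    and e: "(\<integral>\<^sup>+x. ennreal (\<Sum>k\<in>K. (V k x - (\<mu> k + sg * Z k x))\<^sup>2) \<partial>M) \<le> ennreal e" "0 \<le> e"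
    and rho: "reject_prob T A \<le> ennreal \<rho>" "0 \<le> \<rho>"
    and N [measurable]: "N \<in> borel_measurable (PiM T (\<lambda>_. M))"
    and N_le: "\<And>\<omega>. card T \<le> 4 * card (senders T A \<omega>) \<Longrightarrow>
       ennreal (\<Sum>k\<in>K. ((\<Sum>i\<in>senders T A \<omega>. Z k (\<omega> i)) / card (senders T A \<omega>))\<^sup>2) \<le> N \<omega>"
    and nu: "(\<integral>\<^sup>+\<omega>. N \<omega> \<partial>PiM T (\<lambda>_. M)) \<le> ennreal \<nu>" "0 \<le> \<nu>"
  shows "(\<integral>\<^sup>+\<omega>. ennreal (\<Sum>k\<in>K. (sender_mean T A (V k) \<omega> - \<theta> k)\<^sup>2) \<partial>PiM T (\<lambda>_. M))
    \<le> ennreal (\<rho> * (\<Sum>k\<in>K. (\<theta> k)\<^sup>2) + 12 * e + 3 * (\<Sum>k\<in>K. (\<mu> k - \<theta> k)\<^sup>2) + 3 * sg\<^sup>2 * \<nu>)"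
proof -
  note [simp] = subgaussianD(1) [OF Z] T(1) and [measurable] = subgaussianD(2) [OF Z]
  define E where "E x = (\<Sum>k\<in>K. (V k x - (\<mu> k + sg * Z k x))\<^sup>2)" for x
  define Th where "Th = (\<Sum>k\<in>K. (\<theta> k)\<^sup>2)"
  define B where "B = (\<Sum>k\<in>K. (\<mu> k - \<theta> k)\<^sup>2)"
  have [measurable]: "E \<in> borel_measurable M" unfolding E_def by measurable
  have nn: "0 \<le> E x" "0 \<le> Th" "0 \<le> B" for x by (auto simp: E_def Th_def B_def sum_nonneg)
  have m: "0 < card T" using T by (simp add: card_gt_0_iff)
  interpret Q: prob_space "PiM T (\<lambda>_. M)" by (rule prob_space_PiM) (rule prob_space_axioms)
  have pt: "ennreal (\<Sum>k\<in>K. (sender_mean T A (V k) \<omega> - \<theta> k)\<^sup>2) \<le>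
      ennreal Th * (if card T \<le> 4 * card (senders T A \<omega>) then 0 else 1) +
      (ennreal (12 / card T) * (\<Sum>i\<in>T. ennreal (E (\<omega> i))) + (ennreal (3 * B) + ennreal (3 * sg\<^sup>2) * N \<omega>))" for \<omega>
  proof (cases "card T \<le> 4 * card (senders T A \<omega>)")
    case False
    then show ?thesis by (simp add: sender_mean_def Th_def add_increasing2)
  next
    case True
    define S where "S = senders T A \<omega>"
    have S: "0 < card S" "card T \<le> 4 * card S" "S \<subseteq> T"
      using True m unfolding S_def by (auto simp: senders_def)
    have dec: "sender_mean T A (V k) \<omega> - \<theta> k =
      (\<Sum>i\<in>S. V k (\<omega> i) - (\<mu> k + sg * Z k (\<omega> i))) / card S + (\<mu> k - \<theta> k) + sg * ((\<Sum>i\<in>S. Z k (\<omega> i)) / card S)" for k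
      using True S by (simp add: sender_mean_def S_def [symmetric] sum_subtractf sum.distrib
          sum_distrib_left [symmetric] field_simps)
    have "(\<Sum>k\<in>K. (sender_mean T A (V k) \<omega> - \<theta> k)\<^sup>2) \<le>
      (\<Sum>k\<in>K. 3 * (4 / card T * (\<Sum>i\<in>S. (V k (\<omega> i) - (\<mu> k + sg * Z k (\<omega> i)))\<^sup>2) + (\<mu> k - \<theta> k)\<^sup>2 +
         sg\<^sup>2 * ((\<Sum>i\<in>S. Z k (\<omega> i)) / card S)\<^sup>2))"
      unfolding dec power_mult_distrib [symmetric]
      by (intro sum_mono order.trans [OF three_sq_le] mult_left_mono add_mono order_refl
          mean_sq_le m S) auto
    also have "\<dots> = 12 / card T * (\<Sum>i\<in>S. E (\<omega> i)) + 3 * B + 3 * sg\<^sup>2 * (\<Sum>k\<in>K. ((\<Sum>i\<in>S. Z k (\<omega> i)) / card S)\<^sup>2)"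
      unfolding E_def B_def sum.swap [of _ K S]
      by (simp add: sum.distrib sum_distrib_left algebra_simps)
    also have "\<dots> \<le> 12 / card T * (\<Sum>i\<in>T. E (\<omega> i)) + 3 * B + 3 * sg\<^sup>2 * (\<Sum>k\<in>K. ((\<Sum>i\<in>S. Z k (\<omega> i)) / card S)\<^sup>2)"
      using S nn by (intro add_mono mult_left_mono sum_mono2) auto
    finally have "ennreal (\<Sum>k\<in>K. (sender_mean T A (V k) \<omega> - \<theta> k)\<^sup>2) \<le> ennreal \<dots>"
      by (rule ennreal_leI)
    also have "\<dots> = ennreal (12 / card T) * (\<Sum>i\<in>T. ennreal (E (\<omega> i))) + (ennreal (3 * B) +
        ennreal (3 * sg\<^sup>2) * ennreal (\<Sum>k\<in>K. ((\<Sum>i\<in>S. Z k (\<omega> i)) / card S)\<^sup>2))"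
    proof -
      have "ennreal (c * (\<Sum>i\<in>T. E (\<omega> i)) + b + d * x) =
          ennreal c * (\<Sum>i\<in>T. ennreal (E (\<omega> i))) + (ennreal b + ennreal d * ennreal x)"
        if "0 \<le> c" "0 \<le> b" "0 \<le> d" "0 \<le> x" for b c d x
        using nn that by (simp add: ennreal_plus ennreal_mult sum_nonneg sum_ennreal add.assoc)
      then show ?thesis using nn by (simp add: sum_nonneg del: times_divide_eq_left ennreal_plus)
    qed
    also have "\<dots> \<le> ennreal (12 / card T) * (\<Sum>i\<in>T. ennreal (E (\<omega> i))) + (ennreal (3 * B) +
        ennreal (3 * sg\<^sup>2) * N \<omega>)"
      using N_le [OF True] by (intro add_mono mult_left_mono order_refl) (auto simp: S_def)
    finally show ?thesis using True by simp
  qed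
  have "(\<integral>\<^sup>+\<omega>. ennreal (\<Sum>k\<in>K. (sender_mean T A (V k) \<omega> - \<theta> k)\<^sup>2) \<partial>PiM T (\<lambda>_. M)) \<le>
     (\<integral>\<^sup>+\<omega>. ennreal Th * (if card T \<le> 4 * card (senders T A \<omega>) then 0 else 1) +
      (ennreal (12 / card T) * (\<Sum>i\<in>T. ennreal (E (\<omega> i))) + (ennreal (3 * B) + ennreal (3 * sg\<^sup>2) * N \<omega>)) \<partial>PiM T (\<lambda>_. M))"
    by (intro nn_integral_mono pt)
  also have "\<dots> = ennreal Th * reject_prob T A +
      (ennreal (12 / card T) * (of_nat (card T) * (\<integral>\<^sup>+x. ennreal (E x) \<partial>M)) +
      (ennreal (3 * B) + ennreal (3 * sg\<^sup>2) * (\<integral>\<^sup>+\<omega>. N \<omega> \<partial>PiM T (\<lambda>_. M))))"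
    using nn by (simp add: nn_integral_add nn_integral_cmult Q.emeasure_space_1
        nn_integral_PiM_sum [where f = "\<lambda>x. ennreal (E x)"]
        del: sum_ennreal)
  also have "\<dots> \<le> ennreal Th * ennreal \<rho> + (ennreal (12 / card T) * (of_nat (card T) * ennreal e) +
      (ennreal (3 * B) + ennreal (3 * sg\<^sup>2) * ennreal \<nu>))"
    by (intro add_mono mult_left_mono order_refl rho nu e(1) [folded E_def]) auto
  also have "\<dots> = ennreal (\<rho> * Th + 12 * e + 3 * B + 3 * sg\<^sup>2 * \<nu>)"
    using m T(2) nn rho(2) nu(2) e(2)
    by (simp add: ennreal_of_nat_eq_real_of_nat ennreal_plus [symmetric] ennreal_mult [symmetric] field_simps
        del: ennreal_plus)
  finally show ?thesis unfolding Th_def B_def .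
qed

text \<open>\<open>card K / card T\<close> is the variance of an average over a fixed fraction of
  the machines. The summand 1 is the squared norm of the selection bias, which averaging over
  machines cannot reduce.\<close>

lemma sender_mean_risk:
  fixes \<theta> \<mu> :: "'i \<Rightarrow> real" and T :: "'b set"
  assumes T: "finite T" "T \<noteq> {}" and Z: "subgaussian M K Z"
    and [measurable]: "A \<in> sets M" "\<And>k. k \<in> K \<Longrightarrow> V k \<in> borel_measurable M"
    and e: "(\<integral>\<^sup>+x. ennreal (\<Sum>k\<in>K. (V k x - (\<mu> k + sg * Z k x))\<^sup>2) \<partial>M) \<le> ennreal e" "0 \<le> e"
    and rho: "reject_prob T A \<le> ennreal \<rho>" "0 \<le> \<rho>"
  shows "(\<integral>\<^sup>+\<omega>. ennreal (\<Sum>k\<in>K. (sender_mean T A (V k) \<omega> - \<theta> k)\<^sup>2) \<partial>PiM T (\<lambda>_. M))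
    \<le> ennreal (\<rho> * (\<Sum>k\<in>K. (\<theta> k)\<^sup>2) + 12 * e + 3 * (\<Sum>k\<in>K. (\<mu> k - \<theta> k)\<^sup>2) +
        3 * sg\<^sup>2 * (16 * (card K / card T + 1)))"
proof (rule sender_mean_risk_aux [OF T Z _ _ e rho])
  note [simp] = subgaussianD(1) [OF Z] T(1) and [measurable] = subgaussianD(2) [OF Z]
  note int = subgaussian_integrable_sq [OF Z]
  have m: "0 < card T" using T by (simp add: card_gt_0_iff)
  \<comment> \<open>Noise counted only when its machine sends. Its mean may differ from 0, because
    the decision to send depends on the same noise.\<close>
  define W where "W k x = Z k x * indicator A x" for k x
  have [measurable]: "k \<in> K \<Longrightarrow> W k \<in> borel_measurable M" for k unfolding W_def by measurable
  define N where "N \<omega> = ennreal (16 / (real (card T))\<^sup>2) * (\<Sum>k\<in>K. ennreal ((\<Sum>i\<in>T. W k (\<omega> i))\<^sup>2))" for \<omega>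
  show "N \<in> borel_measurable (PiM T (\<lambda>_. M))" unfolding N_def by measurable
  show "ennreal (\<Sum>k\<in>K. ((\<Sum>i\<in>senders T A \<omega>. Z k (\<omega> i)) / card (senders T A \<omega>))\<^sup>2) \<le> N \<omega>"
    if "card T \<le> 4 * card (senders T A \<omega>)" for \<omega>
  proof -
    have "(\<Sum>k\<in>K. ((\<Sum>i\<in>senders T A \<omega>. Z k (\<omega> i)) / card (senders T A \<omega>))\<^sup>2) \<le>
        (\<Sum>k\<in>K. 16 / (real (card T))\<^sup>2 * (\<Sum>i\<in>T. W k (\<omega> i))\<^sup>2)"
      unfolding W_def sum_senders [OF T(1), symmetric] by (intro sum_mono mean_sq_le m that)
    then show ?thesis
      unfolding N_def sum_distrib_left [symmetric]
      by (subst sum_ennreal, simp, subst ennreal_mult [symmetric]) (auto intro: sum_nonneg ennreal_leI)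
  qed
  have iW: "integrable M (\<lambda>x. (W k x)\<^sup>2)" if "k \<in> K" for k
    using int(1) [OF that] unfolding W_def power_mult_distrib
    by (rule Bochner_Integration.integrable_bound) (use that in \<open>auto simp: indicator_def\<close>)
  have "(\<Sum>k\<in>K. \<integral>\<^sup>+\<omega>. ennreal ((\<Sum>i\<in>T. W k (\<omega> i))\<^sup>2) \<partial>PiM T (\<lambda>_. M)) \<le>
     (\<Sum>k\<in>K. ennreal (card T * 1 + (card T)\<^sup>2 * (\<integral>x. W k x \<partial>M)\<^sup>2))"
  proof (rule sum_mono)
    fix k assume k: "k \<in> K"
    have "(\<integral>x. (W k x)\<^sup>2 \<partial>M) \<le> (\<integral>x. (Z k x)\<^sup>2 \<partial>M)"
      using int(1) [OF k] iW [OF k] by (intro integral_mono) (auto simp: W_def indicator_def)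
    also have "\<dots> \<le> 1"
      using int(3) [OF k] by (subst (asm) nn_integral_eq_integral [OF int(1) [OF k]]) auto
    finally have 1: "(\<integral>x. (W k x)\<^sup>2 \<partial>M) \<le> 1" .
    have "(\<integral>\<^sup>+\<omega>. ennreal ((\<Sum>i\<in>T. W k (\<omega> i))\<^sup>2) \<partial>PiM T (\<lambda>_. M)) \<le>
       ennreal (card T * (\<integral>x. (W k x)\<^sup>2 \<partial>M) + (card T)\<^sup>2 * (\<integral>x. W k x \<partial>M)\<^sup>2)"
      using k by (intro nn_integral_PiM_sum_sq T(1) iW) auto
    also have "\<dots> \<le> ennreal (card T * 1 + (card T)\<^sup>2 * (\<integral>x. W k x \<partial>M)\<^sup>2)"
      using 1 by (intro ennreal_leI add_mono order_refl) (auto simp: mult_left_le)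
    finally show "(\<integral>\<^sup>+\<omega>. ennreal ((\<Sum>i\<in>T. W k (\<omega> i))\<^sup>2) \<partial>PiM T (\<lambda>_. M)) \<le>
       ennreal (card T * 1 + (card T)\<^sup>2 * (\<integral>x. W k x \<partial>M)\<^sup>2)" .
  qed
  also have "\<dots> = ennreal (card T * card K + (card T)\<^sup>2 * (\<Sum>k\<in>K. (\<integral>x. W k x \<partial>M)\<^sup>2))"
    by (subst sum_ennreal) (auto simp: sum.distrib sum_distrib_left mult.commute)
  \<comment> \<open>Summed over k, the squared means of \<open>W\<close> form the squared norm of
    the selection bias, at most 1 whatever the dimension.\<close>
  also have "\<dots> \<le> ennreal (card T * card K + (card T)\<^sup>2 * 1)"
    using subgaussian_selection_bias [OF Z, of A]
    by (intro ennreal_leI add_mono order_refl) (auto simp: W_def mult_left_le)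
  finally have sum: "(\<Sum>k\<in>K. \<integral>\<^sup>+\<omega>. ennreal ((\<Sum>i\<in>T. W k (\<omega> i))\<^sup>2) \<partial>PiM T (\<lambda>_. M)) \<le> \<dots>" .
  have "(\<integral>\<^sup>+\<omega>. N \<omega> \<partial>PiM T (\<lambda>_. M)) = ennreal (16 / (real (card T))\<^sup>2) *
     (\<Sum>k\<in>K. \<integral>\<^sup>+\<omega>. ennreal ((\<Sum>i\<in>T. W k (\<omega> i))\<^sup>2) \<partial>PiM T (\<lambda>_. M))"
    unfolding N_def by (simp add: nn_integral_cmult nn_integral_sum del: sum_ennreal)
  also have "\<dots> \<le> ennreal (16 / (real (card T))\<^sup>2) * ennreal (card T * card K + (card T)\<^sup>2 * 1)"
    by (rule mult_left_mono [OF sum]) simp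
  also have "\<dots> = ennreal (16 / (real (card T))\<^sup>2 * (card T * card K + (card T)\<^sup>2 * 1))"
    by (subst ennreal_mult [symmetric]) auto
  also have "16 / (real (card T))\<^sup>2 * (card T * card K + (card T)\<^sup>2 * 1) = 16 * (card K / card T + 1)"
    using m T(2) by (simp add: field_simps power2_eq_square)
  finally show "(\<integral>\<^sup>+\<omega>. N \<omega> \<partial>PiM T (\<lambda>_. M)) \<le> ennreal (16 * (card K / card T + 1))" .
qed auto

text \<open>Rejection is the expected outcome here, so the full energy is paid with factor 1. In
  return the noise carries the factor 4^(-m), and no separate bias term appears. 2^14 is 4 * 2^12,
  with the 4 of the quota.\<close>

lemma sender_mean_risk_rare:
  fixes \<theta> \<mu> :: "'i \<Rightarrow> real" and T :: "'b set"
  assumes T: "finite T" "T \<noteq> {}" and Z: "subgaussian M K Z"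
    and [measurable]: "A \<in> sets M" "\<And>k. k \<in> K \<Longrightarrow> V k \<in> borel_measurable M"
    and e: "(\<integral>\<^sup>+x. ennreal (\<Sum>k\<in>K. (V k x - (\<mu> k + sg * Z k x))\<^sup>2) \<partial>M) \<le> ennreal e" "0 \<le> e"
    and A: "prob A \<le> 1 / 2 ^ 12"
  shows "(\<integral>\<^sup>+\<omega>. ennreal (\<Sum>k\<in>K. (sender_mean T A (V k) \<omega> - \<theta> k)\<^sup>2) \<partial>PiM T (\<lambda>_. M))
    \<le> ennreal (1 * (\<Sum>k\<in>K. (\<theta> k)\<^sup>2) + 12 * e + 3 * (\<Sum>k\<in>K. (\<mu> k - \<theta> k)\<^sup>2) +
        3 * sg\<^sup>2 * (2 ^ 14 * card K / 4 ^ card T))"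
proof (rule sender_mean_risk_aux [OF T Z _ _ e])
  note [simp] = subgaussianD(1) [OF Z] T(1) and [measurable] = subgaussianD(2) [OF Z]
  have m: "0 < card T" using T by (simp add: card_gt_0_iff)
  interpret Q: prob_space "PiM T (\<lambda>_. M)" by (rule prob_space_PiM) (rule prob_space_axioms)
  have "reject_prob T A \<le>
     (\<integral>\<^sup>+\<omega>. 1 \<partial>PiM T (\<lambda>_. M))" by (intro nn_integral_mono) auto
  then show "reject_prob T A \<le> ennreal 1"
    by (simp add: Q.emeasure_space_1)
  define Y where "Y x = ennreal (4 / card T) * ennreal (\<Sum>k\<in>K. (Z k x)\<^sup>2)" for x
  have [measurable]: "Y \<in> borel_measurable M" unfolding Y_def by measurable
  define N where "N \<omega> = (if card T \<le> 4 * card (senders T A \<omega>) then \<Sum>i\<in>T. Y (\<omega> i) else 0)" for \<omega>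
  show "N \<in> borel_measurable (PiM T (\<lambda>_. M))" unfolding N_def by measurable
  show "ennreal (\<Sum>k\<in>K. ((\<Sum>i\<in>senders T A \<omega>. Z k (\<omega> i)) / card (senders T A \<omega>))\<^sup>2) \<le> N \<omega>"
    if "card T \<le> 4 * card (senders T A \<omega>)" for \<omega>
  proof -
    have "(\<Sum>k\<in>K. ((\<Sum>i\<in>senders T A \<omega>. Z k (\<omega> i)) / card (senders T A \<omega>))\<^sup>2) \<le>
        (\<Sum>k\<in>K. 4 / card T * (\<Sum>i\<in>senders T A \<omega>. (Z k (\<omega> i))\<^sup>2))"
      by (intro sum_mono mean_sq_le m that)
    also have "\<dots> \<le> (\<Sum>k\<in>K. 4 / card T * (\<Sum>i\<in>T. (Z k (\<omega> i))\<^sup>2))"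
      by (intro sum_mono mult_left_mono sum_mono2) (auto simp: senders_def)
    also have "\<dots> = (\<Sum>i\<in>T. 4 / card T * (\<Sum>k\<in>K. (Z k (\<omega> i))\<^sup>2))"
      by (simp add: sum_distrib_left [symmetric] sum_divide_distrib [symmetric] sum.swap [of _ K T])
    finally have "ennreal (\<Sum>k\<in>K. ((\<Sum>i\<in>senders T A \<omega>. Z k (\<omega> i)) / card (senders T A \<omega>))\<^sup>2) \<le> ennreal \<dots>"
      by (rule ennreal_leI)
    also have "\<dots> = (\<Sum>i\<in>T. Y (\<omega> i))"
      unfolding Y_def
      by (subst sum_ennreal [symmetric], simp add: sum_nonneg, intro sum.cong refl ennreal_mult)
        (auto intro: sum_nonneg)
    finally show ?thesis using that by (simp add: N_def)
  qed
  have "(\<integral>\<^sup>+\<omega>. N \<omega> \<partial>PiM T (\<lambda>_. M)) \<le> ennreal (card T * 2 ^ 12 / 4 ^ card T) * (\<integral>\<^sup>+x. Y x \<partial>M)"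
    unfolding N_def by (rule many_senders_noise [OF T(1) _ _ A]) measurable
  also have "\<dots> = ennreal (card T * 2 ^ 12 / 4 ^ card T) *
     (ennreal (4 / card T) * (\<integral>\<^sup>+x. ennreal (\<Sum>k\<in>K. (Z k x)\<^sup>2) \<partial>M))"
    unfolding Y_def by (subst nn_integral_cmult) auto
  also have "\<dots> \<le> ennreal (card T * 2 ^ 12 / 4 ^ card T) * (ennreal (4 / card T) * of_nat (card K))"
    by (intro mult_left_mono subgaussian_nn_integral_sum_sq Z) auto
  also have "\<dots> = ennreal (2 ^ 14 * card K / 4 ^ card T)"
    unfolding ennreal_of_nat_eq_real_of_nat
    using m by (subst ennreal_mult [symmetric], simp, simp, subst ennreal_mult [symmetric]) auto
  finally show "(\<integral>\<^sup>+\<omega>. N \<omega> \<partial>PiM T (\<lambda>_. M)) \<le> ennreal (2 ^ 14 * card K / 4 ^ card T)" .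
qed auto

end

section \<open>Square integrable functions on the unit interval\<close>

abbreviation "leb01 \<equiv> lebesgue_on {0..1::real}"
abbreviation "L201 \<equiv> L2_space {0..1::real}"
abbreviation "ip \<equiv> L2_inner {0..1::real}"

lemma finite_measure_leb01: "finite_measure leb01"
  by (rule finite_measureI) (simp add: emeasure_restrict_space)

lemma L2_measurable [measurable_dest]: "f \<in> L2_space A \<Longrightarrow> f \<in> borel_measurable (lebesgue_on A)"
  and L2_integrable_sq: "f \<in> L2_space A \<Longrightarrow> integrable (lebesgue_on A) (\<lambda>x. (f x)\<^sup>2)"
  by (auto simp: L2_space_def)

lemma L2_integrable_mult:
  assumes f: "f \<in> L2_space A" and g: "g \<in> L2_space A"
  shows "integrable (lebesgue_on A) (\<lambda>x. f x * g x)"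
proof (rule Bochner_Integration.integrable_bound)
  note [measurable] = f g
  show "integrable (lebesgue_on A) (\<lambda>x. (f x)\<^sup>2 + (g x)\<^sup>2)"
    using f g by (intro Bochner_Integration.integrable_add L2_integrable_sq)
  show "(\<lambda>x. f x * g x) \<in> borel_measurable (lebesgue_on A)" by measurable
  have "\<bar>f x * g x\<bar> \<le> (f x)\<^sup>2 + (g x)\<^sup>2" for x
  proof -
    have "2 * (\<bar>f x\<bar> * \<bar>g x\<bar>) \<le> (f x)\<^sup>2 + (g x)\<^sup>2"
      using sum_squares_bound [of "\<bar>f x\<bar>" "\<bar>g x\<bar>"] by simp
    moreover have "0 \<le> \<bar>f x\<bar> * \<bar>g x\<bar>" by simp
    ultimately show ?thesis unfolding abs_mult by linarith
  qed
  then show "AE x in lebesgue_on A. norm (f x * g x) \<le> norm ((f x)\<^sup>2 + (g x)\<^sup>2)"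
    by (intro always_eventually) (simp add: )
qed

lemma L2_add: "f \<in> L2_space A \<Longrightarrow> g \<in> L2_space A \<Longrightarrow> (\<lambda>x. f x + g x) \<in> L2_space A"
  using L2_integrable_mult [of f A g] by (auto simp: L2_space_def power2_sum mult.assoc)

lemma L2_cmult: "f \<in> L2_space A \<Longrightarrow> (\<lambda>x. c * f x) \<in> L2_space A"
  by (auto simp: L2_space_def power_mult_distrib)

lemma L2_diff: "f \<in> L2_space A \<Longrightarrow> g \<in> L2_space A \<Longrightarrow> (\<lambda>x. f x - g x) \<in> L2_space A"
  using L2_add [of f A "\<lambda>x. (-1) * g x"] L2_cmult [of g A "-1"] by simp

lemma L2_zero: "(\<lambda>x. 0) \<in> L2_space A"
  by (auto simp: L2_space_def)

lemma L2_sum: "(\<And>k. k \<in> K \<Longrightarrow> f k \<in> L2_space A) \<Longrightarrow> (\<lambda>x. \<Sum>k\<in>K. f k x) \<in> L2_space A"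
  by (induction K rule: infinite_finite_induct) (auto intro: L2_add L2_zero)

lemma L2_inner_commute: "L2_inner A f g = L2_inner A g f"
  by (simp add: L2_inner_def mult.commute)

lemma L2_inner_sum_right:
  assumes "f \<in> L2_space A" "\<And>k. k \<in> K \<Longrightarrow> g k \<in> L2_space A"
  shows "L2_inner A f (\<lambda>x. \<Sum>k\<in>K. c k * g k x) = (\<Sum>k\<in>K. c k * L2_inner A f (g k))"
proof -
  have "L2_inner A f (\<lambda>x. \<Sum>k\<in>K. c k * g k x) = (\<integral>x. (\<Sum>k\<in>K. c k * (f x * g k x)) \<partial>lebesgue_on A)"
    by (simp add: L2_inner_def sum_distrib_left mult_ac)
  also have "\<dots> = (\<Sum>k\<in>K. c k * L2_inner A f (g k))"
    using L2_integrable_mult [OF assms(1) assms(2)]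
    by (subst Bochner_Integration.integral_sum) (auto simp: L2_inner_def)
  finally show ?thesis .
qed

lemma L2_inner_sum_left:
  assumes "f \<in> L2_space A" "\<And>k. k \<in> K \<Longrightarrow> g k \<in> L2_space A"
  shows "L2_inner A (\<lambda>x. \<Sum>k\<in>K. c k * g k x) f = (\<Sum>k\<in>K. c k * L2_inner A (g k) f)"
  using L2_inner_sum_right [OF assms] by (simp only: L2_inner_commute [of A _ f])

lemma L2_inner_self: "L2_inner A f f = (\<integral>x. (f x)\<^sup>2 \<partial>lebesgue_on A)"
  by (simp add: L2_inner_def power2_eq_square)

lemma L2_inner_self_nonneg: "0 \<le> L2_inner A f f"
  by (simp add: L2_inner_self)

lemma L2_inner_diff_self:
  assumes "f \<in> L2_space A" "g \<in> L2_space A"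
  shows "(\<integral>x. (f x - g x)\<^sup>2 \<partial>lebesgue_on A) = L2_inner A f f - 2 * L2_inner A f g + L2_inner A g g"
  using L2_integrable_sq [OF assms(1)] L2_integrable_sq [OF assms(2)] L2_integrable_mult [OF assms]
  by (simp add: power2_diff L2_inner_self mult.assoc) (simp add: L2_inner_def)

lemma L2_dist_sq_eq:
  assumes "f \<in> L2_space A" "g \<in> L2_space A"
  shows "L2_dist_sq A f g = ennreal (L2_inner A f f - 2 * L2_inner A f g + L2_inner A g g)"
  unfolding L2_dist_sq_def L2_inner_diff_self [OF assms, symmetric]
  using L2_integrable_sq [OF L2_diff [OF assms]] by (intro nn_integral_eq_integral) auto

text \<open>Serves both the L2 form and the L2 form minus its grid version. The latter vanishes on
  step functions, so c = 0 is a genuine case; there a suitable t makes the linear expression equal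
  to -1 unless b = 0.\<close>

lemma quadratic_discriminant_le:
  fixes a b c :: real
  assumes "\<And>t. 0 \<le> a - 2 * t * b + t\<^sup>2 * c" and "0 \<le> c"
  shows "b\<^sup>2 \<le> a * c"
proof (cases "c = 0")
  case True
  have "b = 0"
  proof (rule ccontr)
    assume "b \<noteq> 0"
    then show False using assms(1) [of "(a + 1) / (2 * b)"] True by simp
  qed
  then show ?thesis using True by simp
next
  case False
  then have "0 < c" using assms(2) by simp
  then show ?thesis using assms(1) [of "b / c"] by (simp add: power2_eq_square field_simps)
qed

lemma L2_Cauchy_Schwarz:
  assumes "f \<in> L2_space A" "g \<in> L2_space A"
  shows "(L2_inner A f g)\<^sup>2 \<le> L2_inner A f f * L2_inner A g g"
proof (rule quadratic_discriminant_le)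
  fix t
  have "L2_inner A f (\<lambda>x. t * g x) = t * L2_inner A f g"
    "L2_inner A (\<lambda>x. t * g x) (\<lambda>x. t * g x) = t\<^sup>2 * L2_inner A g g"
    by (simp_all add: L2_inner_def power2_eq_square mult_ac flip: integral_mult_right_zero)
  then have "L2_inner A f f - 2 * t * L2_inner A f g + t\<^sup>2 * L2_inner A g g =
      (\<integral>x. (f x - t * g x)\<^sup>2 \<partial>lebesgue_on A)"
    using L2_inner_diff_self [OF assms(1) L2_cmult [OF assms(2), of t]] by simp
  then show "0 \<le> L2_inner A f f - 2 * t * L2_inner A f g + t\<^sup>2 * L2_inner A g g" by simp
qed (rule L2_inner_self_nonneg)

section \<open>Approximation of square integrable functions by continuous ones\<close>

lemma L201_bounded:
  assumes "f \<in> borel_measurable leb01" "\<And>x. x \<in> {0..1} \<Longrightarrow> \<bar>f x\<bar> \<le> B"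
  shows "f \<in> L201"
proof -
  interpret finite_measure leb01 by (rule finite_measure_leb01)
  have "(f x)\<^sup>2 \<le> B\<^sup>2" if "x \<in> {0..1}" for x
    using assms(2) [OF that] power_mono [of "\<bar>f x\<bar>" B 2] by simp
  then have "integrable leb01 (\<lambda>x. (f x)\<^sup>2)"
    using assms(1) by (intro integrable_const_bound [where B = "B\<^sup>2"]) (auto intro!: AE_I2)
  then show ?thesis using assms(1) by (simp add: L2_space_def)
qed

lemma L201_integrable: "f \<in> L201 \<Longrightarrow> integrable leb01 f"
  using finite_measure.square_integrable_imp_integrable [OF finite_measure_leb01]
  by (auto simp: L2_space_def)

lemma measurable_leb01_continuous:
  assumes "continuous_on UNIV (g :: real \<Rightarrow> real)"
  shows "g \<in> borel_measurable leb01"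
  by (rule continuous_imp_measurable_on_sets_lebesgue) (auto intro: continuous_on_subset [OF assms])

text \<open>Measurability provides continuous functions converging almost everywhere, which alone
  gives no convergence in L2. Truncating f and clipping the approximants at the same height keeps
  them continuous and supplies a constant majorant on [0,1].\<close>

lemma L201_approx_continuous:
  assumes f: "f \<in> L201" and e: "0 < e"
  obtains g where "continuous_on UNIV g" "g \<in> L201" "(\<integral>x. (f x - g x)\<^sup>2 \<partial>leb01) \<le> e"
proof -
  interpret finite_measure leb01 by (rule finite_measure_leb01)
  note [measurable] = f
  define clip :: "real \<Rightarrow> real \<Rightarrow> real" where "clip B y = max (- B) (min B y)" for B y
  have clip_abs: "\<bar>clip B y\<bar> \<le> B" if "0 \<le> B" for B y using that by (auto simp: clip_def)
  have [measurable]: "clip B \<in> borel_measurable borel" for B unfolding clip_def by measurable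
  have "(\<lambda>n. \<integral>x. (f x - clip (real n) (f x))\<^sup>2 \<partial>leb01) \<longlonglongrightarrow> (\<integral>x. 0 \<partial>leb01)"
  proof (rule integral_dominated_convergence [where w = "\<lambda>x. (f x)\<^sup>2"])
    show "AE x in leb01. (\<lambda>n. (f x - clip (real n) (f x))\<^sup>2) \<longlonglongrightarrow> 0"
    proof (intro AE_I2 tendsto_eventually)
      fix x
      obtain n0 :: nat where "\<bar>f x\<bar> \<le> n0" using real_arch_simple by blast
      then show "\<forall>\<^sub>F n in sequentially. (f x - clip (real n) (f x))\<^sup>2 = 0"
        by (intro eventually_sequentiallyI [of n0]) (auto simp: clip_def)
    qed
    show "AE x in leb01. norm ((f x - clip (real n) (f x))\<^sup>2) \<le> (f x)\<^sup>2" for n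
    proof (intro AE_I2)
      fix x
      have "\<bar>f x - clip (real n) (f x)\<bar> \<le> \<bar>f x\<bar>" by (auto simp: clip_def)
      then show "norm ((f x - clip (real n) (f x))\<^sup>2) \<le> (f x)\<^sup>2"
        by (simp add: abs_le_square_iff)
    qed
  qed (use L2_integrable_sq [OF f] in auto)
  then have "\<forall>\<^sub>F n in sequentially. (\<integral>x. (f x - clip (real n) (f x))\<^sup>2 \<partial>leb01) < e / 4"
    using e by (intro order_tendstoD) auto
  then obtain n where n: "(\<integral>x. (f x - clip (real n) (f x))\<^sup>2 \<partial>leb01) < e / 4"
    by (auto simp: eventually_sequentially)
  define B where "B = real n"
  have B: "0 \<le> B" by (simp add: B_def)
  define u where "u x = (if x \<in> {0..1} then f x else 0)" for x
  have "u \<in> borel_measurable lebesgue"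
    unfolding u_def using f by (subst borel_measurable_if) (auto simp: L2_space_def)
  then have "u measurable_on {0..1}"
    by (rule lebesgue_measurable_imp_measurable_on_real) auto
  then obtain N h where N: "negligible N" and h: "\<And>n. continuous_on UNIV (h n)"
    and lim: "\<And>x. x \<notin> N \<Longrightarrow> (\<lambda>n. h n x) \<longlonglongrightarrow> (if x \<in> {0..1} then u x else 0)"
    unfolding measurable_on_def by blast
  have cont: "continuous_on UNIV (\<lambda>x. clip B (h n x))" for n
    unfolding clip_def by (intro continuous_intros h)
  have meas: "(\<lambda>x. clip B (h n x)) \<in> borel_measurable leb01" for n
    by (rule measurable_leb01_continuous [OF cont])
  have "N \<in> null_sets lebesgue" using N by (simp add: negligible_iff_null_sets)
  then have "AE x in lebesgue. x \<notin> N" by (rule AE_not_in)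
  then have AE: "AE x in leb01. x \<notin> N"
    by (simp add: AE_restrict_space_iff) (auto elim: AE_mp)
  have "(\<lambda>n. \<integral>x. (clip B (f x) - clip B (h n x))\<^sup>2 \<partial>leb01) \<longlonglongrightarrow> (\<integral>x. 0 \<partial>leb01)"
  proof (rule integral_dominated_convergence [where w = "\<lambda>x. (2 * B)\<^sup>2"])
    show "AE x in leb01. (\<lambda>n. (clip B (f x) - clip B (h n x))\<^sup>2) \<longlonglongrightarrow> 0"
      using AE AE_space
    proof eventually_elim
      fix x assume "x \<notin> N" "x \<in> space leb01"
      then have "(\<lambda>n. h n x) \<longlonglongrightarrow> f x" using lim [of x] by (simp add: u_def)
      then have "(\<lambda>n. (clip B (f x) - clip B (h n x))\<^sup>2) \<longlonglongrightarrow> (clip B (f x) - clip B (f x))\<^sup>2"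
        unfolding clip_def by (intro tendsto_intros)
      then show "(\<lambda>n. (clip B (f x) - clip B (h n x))\<^sup>2) \<longlonglongrightarrow> 0" by simp
    qed
    show "AE x in leb01. norm ((clip B (f x) - clip B (h n x))\<^sup>2) \<le> (2 * B)\<^sup>2" for n
    proof (intro AE_I2)
      fix x
      have "\<bar>clip B (f x) - clip B (h n x)\<bar> \<le> 2 * B"
        using clip_abs [OF B, of "f x"] clip_abs [OF B, of "h n x"] by linarith
      then have "\<bar>clip B (f x) - clip B (h n x)\<bar>\<^sup>2 \<le> (2 * B)\<^sup>2" by (intro power_mono) auto
      then show "norm ((clip B (f x) - clip B (h n x))\<^sup>2) \<le> (2 * B)\<^sup>2" by simp
    qed
    show "(\<lambda>x. (clip B (f x) - clip B (h n x))\<^sup>2) \<in> borel_measurable leb01" for n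
      using meas [of n] by measurable
  qed auto
  then have "\<forall>\<^sub>F n in sequentially. (\<integral>x. (clip B (f x) - clip B (h n x))\<^sup>2 \<partial>leb01) < e / 4"
    using e by (intro order_tendstoD) auto
  then obtain k where k: "(\<integral>x. (clip B (f x) - clip B (h k x))\<^sup>2 \<partial>leb01) < e / 4"
    by (auto simp: eventually_sequentially)
  define g where "g x = clip B (h k x)" for x
  have g: "g \<in> L201"
    unfolding g_def by (rule L201_bounded [OF meas clip_abs]) (rule B)
  have fB: "(\<lambda>x. clip B (f x)) \<in> L201"
    by (rule L201_bounded [OF _ clip_abs [OF B]]) measurable
  have i1: "integrable leb01 (\<lambda>x. (f x - clip B (f x))\<^sup>2)" and i2: "integrable leb01 (\<lambda>x. (clip B (f x) - g x)\<^sup>2)"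
    and i3: "integrable leb01 (\<lambda>x. (f x - g x)\<^sup>2)"
    by (intro L2_integrable_sq L2_diff f fB g)+
  have "(\<integral>x. (f x - g x)\<^sup>2 \<partial>leb01) \<le> (\<integral>x. 2 * (f x - clip B (f x))\<^sup>2 + 2 * (clip B (f x) - g x)\<^sup>2 \<partial>leb01)"
  proof (rule integral_mono)
    fix x
    have "0 \<le> ((f x - clip B (f x)) - (clip B (f x) - g x))\<^sup>2" by simp
    then show "(f x - g x)\<^sup>2 \<le> 2 * (f x - clip B (f x))\<^sup>2 + 2 * (clip B (f x) - g x)\<^sup>2"
      by (simp add: power2_eq_square algebra_simps)
  qed (use i1 i2 i3 in auto)
  also have "\<dots> \<le> e"
    using n k i1 i2 by (simp add: B_def [symmetric] g_def)
  finally show ?thesis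
    using that [of g] cont [of k] g by (simp add: g_def [abs_def])
qed

section \<open>Grid approximation and wavelet coefficients\<close>

text \<open>Open on the left, so that the cells partition (0,1] and match the increments between
  consecutive grid points; only the null set {0} is lost.\<close>

definition cell :: "nat \<Rightarrow> nat \<Rightarrow> real set" where
  "cell G l = {real l / real G<..real (Suc l) / real G}"

definition cell_int :: "nat \<Rightarrow> nat \<Rightarrow> (real \<Rightarrow> real) \<Rightarrow> real" where
  "cell_int G l f = (LINT x|leb01. f x * indicator (cell G l) x)"

text \<open>The L2 inner product of the projections onto functions constant on the cells: the
  projection of f has the value G * \<open>cell_int G l f\<close> on cell l, which has length
  1/G.\<close>

definition grid_inner :: "nat \<Rightarrow> (real \<Rightarrow> real) \<Rightarrow> (real \<Rightarrow> real) \<Rightarrow> real" where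
  "grid_inner G f g = G * (\<Sum>l<G. cell_int G l f * cell_int G l g)"

lemma indicator_cell_measurable [measurable]: "(\<lambda>x. indicator (cell G l) x :: real) \<in> borel_measurable leb01"
  unfolding cell_def by (intro measurable_restrict_space1 borel_measurable_indicator) auto

lemma grid_inner_nonneg: "0 \<le> grid_inner G f f"
  unfolding grid_inner_def power2_eq_square [symmetric] by (intro mult_nonneg_nonneg sum_nonneg) auto

lemma sum_indicator_cell:
  assumes "G > 0"
  shows "(\<Sum>l<G. indicator (cell G l) x) = (indicator {0<..1} x :: real)"
proof -
  have "(\<Sum>l<k. indicator (cell G l) x) = (indicator {0<..real k / real G} x :: real)" for k
  proof (induction k)
    case (Suc k)
    have "real k / real G \<le> real (Suc k) / real G" by (simp add: divide_right_mono)
    then show ?case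
      using Suc order.strict_trans1 [of 0 "real k / real G" x]
      by (auto simp: cell_def split: split_indicator)
  qed simp
  from this [of G] show ?thesis using assms by simp
qed

lemma L201_indicator_cell: "(\<lambda>x. indicator (cell G l) x) \<in> L201"
  by (rule L201_bounded [where B = 1]) (auto split: split_indicator)

lemma L201_mult_indicator_cell:
  assumes "f \<in> L201"
  shows "(\<lambda>x. f x * indicator (cell G l) x) \<in> L201"
proof -
  note [measurable] = assms
  have "integrable leb01 (\<lambda>x. (f x * indicator (cell G l) x)\<^sup>2)"
    by (rule Bochner_Integration.integrable_bound [OF L2_integrable_sq [OF assms]])
      (auto split: split_indicator)
  then show ?thesis by (simp add: L2_space_def)
qed

lemma integral_indicator_cell:
  assumes "l < G"
  shows "(LINT x|leb01. indicator (cell G l) x) = 1 / G"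
proof -
  have "real (Suc l) / real G \<le> 1" using assms by (simp add: field_simps)
  then have sub: "cell G l \<subseteq> {0..1}"
    unfolding cell_def using order.strict_trans1 [of 0 "real l / real G"] by fastforce
  have "(LINT x|leb01. indicator (cell G l) x) = measure leb01 (cell G l)"
    using sub by (simp add: Int_absorb2)
  also have "\<dots> = measure lebesgue (cell G l)"
    using sub by (simp add: measure_restrict_space cell_def)
  also have "\<dots> = 1 / G"
    using assms by (simp add: cell_def field_simps)
  finally show ?thesis .
qed

lemma cell_int_lincomb:
  assumes "f \<in> L201" "g \<in> L201"
  shows "cell_int G l (\<lambda>x. a * f x + b * g x) = a * cell_int G l f + b * cell_int G l g"
  using L201_integrable [OF L201_mult_indicator_cell [OF assms(1), of G l]]
    L201_integrable [OF L201_mult_indicator_cell [OF assms(2), of G l]]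
  by (simp add: cell_int_def distrib_right mult.assoc)

lemma cell_int_sum:
  assumes "\<And>k. k \<in> K \<Longrightarrow> f k \<in> L201"
  shows "cell_int G l (\<lambda>x. \<Sum>k\<in>K. c k * f k x) = (\<Sum>k\<in>K. c k * cell_int G l (f k))"
  using L201_integrable [OF L201_mult_indicator_cell [OF assms, of _ G l]]
  by (simp add: cell_int_def sum_distrib_right mult.assoc)

text \<open>Cauchy-Schwarz on a cell of length 1/G; summed over the cells it becomes the contraction
  property of the projection.\<close>

lemma cell_int_sq_le:
  assumes "f \<in> L201" "l < G"
  shows "G * (cell_int G l f)\<^sup>2 \<le> (LINT x|leb01. (f x)\<^sup>2 * indicator (cell G l) x)"
proof -
  have e: "f x * indicator (cell G l) x * indicator (cell G l) x = f x * indicator (cell G l) x"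
    "(indicator (cell G l) x)\<^sup>2 = (indicator (cell G l) x :: real)"
    "(f x * indicator (cell G l) x)\<^sup>2 = (f x)\<^sup>2 * indicator (cell G l) x" for x
    by (auto simp: indicator_def)
  have "(cell_int G l f)\<^sup>2 \<le> (LINT x|leb01. (f x)\<^sup>2 * indicator (cell G l) x) * (1 / G)"
    using L2_Cauchy_Schwarz [OF L201_mult_indicator_cell [OF assms(1), of G l] L201_indicator_cell [of G l]]
    unfolding L2_inner_self unfolding L2_inner_def e integral_indicator_cell [OF assms(2)] cell_int_def .
  then show ?thesis using assms(2) by (simp add: field_simps)
qed

lemma sum_integral_cell:
  assumes "f \<in> L201" "G > 0"
  shows "(\<Sum>l<G. LINT x|leb01. (f x)\<^sup>2 * indicator (cell G l) x) = ip f f"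
proof -
  note [measurable] = assms(1)
  have int: "integrable leb01 (\<lambda>x. (f x)\<^sup>2 * indicator (cell G l) x)" for l
    by (rule Bochner_Integration.integrable_bound [OF L2_integrable_sq [OF assms(1)]])
      (auto split: split_indicator)
  have "(\<Sum>l<G. LINT x|leb01. (f x)\<^sup>2 * indicator (cell G l) x) =
      (LINT x|leb01. (f x)\<^sup>2 * indicator {0<..1} x)"
    by (simp add: Bochner_Integration.integral_sum [OF int, symmetric] sum_distrib_left [symmetric]
        sum_indicator_cell [OF assms(2)])
  also have "\<dots> = (LINT x|leb01. (f x)\<^sup>2)"
  proof (rule integral_cong_AE)
    have "{0::real} \<in> null_sets lebesgue" by auto
    from AE_not_in [OF this] have "AE x in lebesgue. x \<noteq> (0::real)" by (simp only: singleton_iff)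
    then have "AE x in leb01. x \<noteq> 0"
      by (simp add: AE_restrict_space_iff) (auto elim: AE_mp)
    then show "AE x in leb01. (f x)\<^sup>2 * indicator {0<..1} x = (f x)\<^sup>2"
      using AE_space by eventually_elim (auto simp: indicator_def)
    have "(\<lambda>x. indicator {0<..1} x :: real) \<in> borel_measurable leb01"
      by (intro borel_measurable_indicator) (auto simp: sets_restrict_space_iff)
    then show "(\<lambda>x. (f x)\<^sup>2 * indicator {0<..1} x) \<in> borel_measurable leb01" by measurable
  qed measurable
  finally show ?thesis by (simp add: L2_inner_self)
qed

lemma grid_inner_self_le:
  assumes "f \<in> L201" "G > 0"
  shows "grid_inner G f f \<le> ip f f"
proof -
  have "grid_inner G f f = (\<Sum>l<G. G * (cell_int G l f)\<^sup>2)"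
    by (simp add: grid_inner_def sum_distrib_left power2_eq_square)
  also have "\<dots> \<le> (\<Sum>l<G. LINT x|leb01. (f x)\<^sup>2 * indicator (cell G l) x)"
    by (intro sum_mono cell_int_sq_le assms) auto
  finally show ?thesis by (simp add: sum_integral_cell [OF assms])
qed

lemma grid_inner_lincomb_self:
  assumes "f \<in> L201" "g \<in> L201"
  shows "grid_inner G (\<lambda>x. a * f x + b * g x) (\<lambda>x. a * f x + b * g x) =
    a\<^sup>2 * grid_inner G f f + 2 * a * b * grid_inner G f g + b\<^sup>2 * grid_inner G g g"
  unfolding grid_inner_def cell_int_lincomb [OF assms]
  by (simp add: algebra_simps sum.distrib sum_distrib_left power2_eq_square)

lemma L2_inner_lincomb_self:
  assumes "f \<in> L201" "g \<in> L201"
  shows "ip (\<lambda>x. a * f x + b * g x) (\<lambda>x. a * f x + b * g x) = a\<^sup>2 * ip f f + 2 * a * b * ip f g + b\<^sup>2 * ip g g"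
proof -
  have "ip (\<lambda>x. a * f x + b * g x) (\<lambda>x. a * f x + b * g x) =
     (LINT x|leb01. a\<^sup>2 * (f x * f x) + 2 * a * b * (f x * g x) + b\<^sup>2 * (g x * g x))"
    unfolding L2_inner_def by (rule Bochner_Integration.integral_cong) (auto simp: algebra_simps power2_eq_square)
  also have "\<dots> = a\<^sup>2 * ip f f + 2 * a * b * ip f g + b\<^sup>2 * ip g g"
    using L2_integrable_mult [OF assms] L2_integrable_mult [OF assms(1,1)] L2_integrable_mult [OF assms(2,2)]
    by (simp add: L2_inner_def)
  finally show ?thesis .
qed

text \<open>The bilinear form $\langle f,g\rangle$ minus its grid version is positive semidefinite, which
  gives a Cauchy--Schwarz inequality for the discretisation error.\<close>

lemma grid_inner_error:
  assumes f: "f \<in> L201" and g: "g \<in> L201" and G: "G > 0"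
  shows "(grid_inner G f g - ip f g)\<^sup>2 \<le> ip f f * (ip g g - grid_inner G g g)"
proof -
  have "(ip f g - grid_inner G f g)\<^sup>2 \<le> (ip f f - grid_inner G f f) * (ip g g - grid_inner G g g)"
  proof (rule quadratic_discriminant_le)
    fix t
    have "grid_inner G (\<lambda>x. 1 * f x + (- t) * g x) (\<lambda>x. 1 * f x + (- t) * g x)
      \<le> ip (\<lambda>x. 1 * f x + (- t) * g x) (\<lambda>x. 1 * f x + (- t) * g x)"
      by (intro grid_inner_self_le L2_add L2_cmult f g G)
    then show "0 \<le> ip f f - grid_inner G f f - 2 * t * (ip f g - grid_inner G f g) + t\<^sup>2 * (ip g g - grid_inner G g g)"
      unfolding L2_inner_lincomb_self [OF f g] grid_inner_lincomb_self [OF f g]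
      by (simp add: algebra_simps)
  qed (use grid_inner_self_le [OF g G] in simp)
  also have "\<dots> \<le> ip f f * (ip g g - grid_inner G g g)"
    using grid_inner_self_le [OF g G]
    by (intro mult_right_mono) (auto simp: grid_inner_nonneg)
  finally show ?thesis by (simp add: power2_commute)
qed

lemma grid_inner_continuous:
  assumes g: "continuous_on UNIV g" and gL: "g \<in> L201" and e: "e > 0"
  shows "\<exists>G0. \<forall>G\<ge>G0. 0 < G \<longrightarrow> ip g g - grid_inner G g g \<le> e"
proof -
  note [measurable] = gL
  define d where "d = sqrt e"
  have d: "0 < d" "d\<^sup>2 = e" using e by (auto simp: d_def)
  have "uniformly_continuous_on {0..1} g"
    by (intro compact_uniformly_continuous continuous_on_subset [OF g]) auto
  then obtain r where r: "r > 0" and gr: "\<And>x y. x \<in> {0..1} \<Longrightarrow> y \<in> {0..1} \<Longrightarrow> dist x y < r \<Longrightarrow> dist (g x) (g y) < d"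
    unfolding uniformly_continuous_on_def using d by (metis)
  obtain G0 :: nat where G0: "1 / r < G0" using reals_Archimedean2 by blast
  have "ip g g - grid_inner G g g \<le> e" if "G0 \<le> G" "0 < G" for G
  proof -
    have rG: "1 / G < r"
    proof -
      have "1 / r < G" using G0 that by simp
      then show ?thesis using r that by (simp add: field_simps)
    qed
    have "(LINT x|leb01. (g x)\<^sup>2 * indicator (cell G l) x) - G * (cell_int G l g)\<^sup>2 \<le> e / G"
      if l: "l < G" for l
    proof -
      \<comment> \<open>The local error is the squared distance of g to its cell mean, and no
        constant is closer than the mean. Any constant therefore gives an upper bound; the value at
        the right end point is within d of g on the whole cell.\<close>
      define c where "c = g (real (Suc l) / G)"
      have i1: "integrable leb01 (\<lambda>x. (g x)\<^sup>2 * indicator (cell G l) x)"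
        by (rule Bochner_Integration.integrable_bound [OF L2_integrable_sq [OF gL]])
          (auto split: split_indicator)
      note i2 = L201_integrable [OF L201_mult_indicator_cell [OF gL, of G l]]
      note i3 = L201_integrable [OF L201_indicator_cell [of G l]]
      have "(LINT x|leb01. (g x)\<^sup>2 * indicator (cell G l) x - 2 * c * (g x * indicator (cell G l) x) +
          c\<^sup>2 * indicator (cell G l) x) \<le> (LINT x|leb01. e * indicator (cell G l) x)"
      proof (rule integral_mono)
        fix x assume x: "x \<in> space leb01"
        show "(g x)\<^sup>2 * indicator (cell G l) x - 2 * c * (g x * indicator (cell G l) x) +
          c\<^sup>2 * indicator (cell G l) x \<le> e * indicator (cell G l) x"
        proof (cases "x \<in> cell G l")
          case True
          have "real (Suc l) / G \<in> {0..1}" using l by (auto simp: field_simps)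
          moreover have "dist x (real (Suc l) / G) < r"
            using True rG by (auto simp: cell_def dist_real_def add_divide_distrib)
          ultimately have "dist (g x) c < d" using gr x by (simp add: c_def)
          then have "\<bar>g x - c\<bar>\<^sup>2 \<le> d\<^sup>2" by (intro power_mono) (auto simp: dist_real_def)
          then show ?thesis using True by (simp add: d power2_diff algebra_simps)
        qed simp
      qed (use i1 i2 i3 in auto)
      then have "(LINT x|leb01. (g x)\<^sup>2 * indicator (cell G l) x) - 2 * c * cell_int G l g + c\<^sup>2 / G \<le> e / G"
        using i1 i2 i3 integral_indicator_cell [OF l] by (simp add: cell_int_def)
      moreover have "G * (cell_int G l g - c / G)\<^sup>2 =
          G * (cell_int G l g)\<^sup>2 - 2 * c * cell_int G l g + c\<^sup>2 / G"
        using l by (simp add: power2_eq_square field_simps)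
      moreover have "0 \<le> G * (cell_int G l g - c / G)\<^sup>2" by simp
      ultimately show ?thesis by linarith
    qed
    then have "(\<Sum>l<G. (LINT x|leb01. (g x)\<^sup>2 * indicator (cell G l) x) - G * (cell_int G l g)\<^sup>2) \<le> (\<Sum>l<G. e / G)"
      by (intro sum_mono) auto
    moreover have "grid_inner G g g = (\<Sum>l<G. G * (cell_int G l g)\<^sup>2)"
      by (simp add: grid_inner_def sum_distrib_left power2_eq_square)
    ultimately show ?thesis
      using that by (simp add: sum_subtractf sum_integral_cell [OF gL])
  qed
  then show ?thesis by blast
qed

lemma grid_inner_approx:
  assumes f: "f \<in> L201" and e: "e > 0"
  shows "\<exists>G0. \<forall>G\<ge>G0. 0 < G \<longrightarrow> ip f f - grid_inner G f f \<le> e"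
proof -
  obtain g where g: "continuous_on UNIV g" "g \<in> L201" "(\<integral>x. (f x - g x)\<^sup>2 \<partial>leb01) \<le> e / 4"
    using L201_approx_continuous [OF f, of "e / 4"] e by auto
  obtain G0 where G0: "\<And>G. G \<ge> G0 \<Longrightarrow> 0 < G \<Longrightarrow> ip g g - grid_inner G g g \<le> e / 4"
    using grid_inner_continuous [OF g(1,2), of "e / 4"] e by auto
  have "ip f f - grid_inner G f f \<le> e" if "G \<ge> G0" "0 < G" for G
  proof -
    \<comment> \<open>Let Q(h) be the squared L2 norm of h minus its squared grid norm. The
      parallelogram identity Q(f) + Q(f - 2g) = 2 Q(f - g) + 2 Q(g) and Q(f - 2g) >= 0 bound Q(f) by
      two terms of size e/2.\<close>
    have "grid_inner G (\<lambda>x. 1 * f x + (- 2) * g x) (\<lambda>x. 1 * f x + (- 2) * g x)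
      \<le> ip (\<lambda>x. 1 * f x + (- 2) * g x) (\<lambda>x. 1 * f x + (- 2) * g x)"
      by (intro grid_inner_self_le L2_add L2_cmult f g that)
    moreover have "ip f f - 2 * ip f g + ip g g \<le> e / 4"
      using g(3) by (simp add: L2_inner_diff_self [OF f g(2)])
    moreover have "0 \<le> grid_inner G (\<lambda>x. 1 * f x + (- 1) * g x) (\<lambda>x. 1 * f x + (- 1) * g x)"
      by (rule grid_inner_nonneg)
    ultimately show ?thesis
      using G0 [OF that] unfolding L2_inner_lincomb_self [OF f g(2)] grid_inner_lincomb_self [OF f g(2)]
      by (simp add: algebra_simps)
  qed
  then show ?thesis by blast
qed

lemma grid_inner_approx_finite:
  assumes "finite K" "\<And>k. k \<in> K \<Longrightarrow> f k \<in> L201" "e > 0"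
  shows "\<exists>G>0. \<forall>k\<in>K. ip (f k) (f k) - grid_inner G (f k) (f k) \<le> e"
proof -
  obtain G0 where G0: "\<And>k G. k \<in> K \<Longrightarrow> G0 k \<le> G \<Longrightarrow> 0 < G \<Longrightarrow> ip (f k) (f k) - grid_inner G (f k) (f k) \<le> e"
    using grid_inner_approx [OF assms(2,3)] by metis
  have "G0 k \<le> Suc (\<Sum>k\<in>K. G0 k)" if "k \<in> K" for k
    using member_le_sum [of k K G0] assms(1) that by auto
  then show ?thesis using G0 by (intro exI [of _ "Suc (\<Sum>k\<in>K. G0 k)"]) auto
qed

section \<open>Wavelet coefficients, Parseval and Besov tails\<close>

lemma sum_gp_offset_less:
  fixes q :: real
  assumes "J \<le> K" "q \<noteq> 1"
  shows "(\<Sum>j\<in>{J..<K}. q ^ j) = (q ^ J - q ^ K) / (1 - q)"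
proof -
  have "(1 - q) * (\<Sum>j\<in>{J..<K}. q ^ j) = q ^ J - q ^ K"
    using assms(1)
  proof (induction K rule: dec_induct)
    case (step n)
    then show ?case by (simp add: distrib_left) (simp add: algebra_simps)
  qed simp
  then show ?thesis using assms(2) by (simp add: field_simps)
qed

definition labels :: "nat \<Rightarrow> (nat \<times> nat) set" where
  "labels J = Sigma {..<J} level"

definition wavelet_coef :: "(nat \<Rightarrow> nat \<Rightarrow> real \<Rightarrow> real) \<Rightarrow> (real \<Rightarrow> real) \<Rightarrow> nat \<times> nat \<Rightarrow> real" where
  "wavelet_coef \<psi> f a = ip f (\<psi> (fst a) (snd a))"

lemma finite_level [simp]: "finite (level j)" by (simp add: level_def)

lemma card_level: "card (level j) = (if j = 0 then 2 else 2 ^ j)" by (simp add: level_def)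

lemma finite_labels [simp]: "finite (labels J)" by (simp add: labels_def)

text \<open>The extra label on level 0 makes the counts 2, 2, 4, 8, ... add up to exactly 2^J for J
  > 0.\<close>

lemma card_labels: "card (labels J) \<le> 2 ^ J"
proof -
  have "(\<Sum>j<J. card (level j)) = (if J = 0 then 0 else 2 ^ J)"
    by (induction J) (auto simp: card_level)
  then show ?thesis by (simp add: labels_def)
qed

context
  fixes \<psi> :: "nat \<Rightarrow> nat \<Rightarrow> real \<Rightarrow> real"
  assumes \<psi>: "orthonormal_basis01 \<psi>"
begin

lemma basis_L2: "a \<in> labels J \<Longrightarrow> \<psi> (fst a) (snd a) \<in> L201"
  using \<psi> by (auto simp: orthonormal_basis01_def labels_def)

lemma basis_orthonormal:
  "a \<in> labels J \<Longrightarrow> b \<in> labels J \<Longrightarrow> ip (\<psi> (fst a) (snd a)) (\<psi> (fst b) (snd b)) = (if a = b then 1 else 0)"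
  using \<psi> unfolding orthonormal_basis01_def by (cases a; cases b) (simp add: labels_def)

lemma basis_lincomb_L2: "(\<lambda>x. \<Sum>a\<in>labels J. c a * \<psi> (fst a) (snd a) x) \<in> L201"
  by (intro L2_sum L2_cmult basis_L2)

lemma basis_lincomb_self:
  "ip (\<lambda>x. \<Sum>a\<in>labels J. c a * \<psi> (fst a) (snd a) x) (\<lambda>x. \<Sum>a\<in>labels J. c a * \<psi> (fst a) (snd a) x) =
    (\<Sum>a\<in>labels J. (c a)\<^sup>2)"
proof -
  have "ip (\<lambda>x. \<Sum>a\<in>labels J. c a * \<psi> (fst a) (snd a) x) (\<lambda>x. \<Sum>a\<in>labels J. c a * \<psi> (fst a) (snd a) x) =
     (\<Sum>b\<in>labels J. c b * (\<Sum>a\<in>labels J. c a * ip (\<psi> (fst a) (snd a)) (\<psi> (fst b) (snd b))))"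
    by (subst L2_inner_sum_right [OF basis_lincomb_L2 basis_L2], assumption,
        intro sum.cong refl arg_cong2 [where f = "(*)"], rule L2_inner_sum_left)
      (auto intro: basis_L2)
  also have "\<dots> = (\<Sum>b\<in>labels J. c b * (\<Sum>a\<in>labels J. if a = b then c a else 0))"
    by (intro sum.cong refl arg_cong2 [where f = "(*)"]) (simp add: basis_orthonormal)
  finally show ?thesis by (simp add: power2_eq_square)
qed

lemma basis_lincomb_inner:
  assumes f: "f \<in> L201"
  shows "ip (\<lambda>x. \<Sum>a\<in>labels J. c a * \<psi> (fst a) (snd a) x) f = (\<Sum>a\<in>labels J. c a * wavelet_coef \<psi> f a)"
  by (subst L2_inner_sum_left [OF f basis_L2]) (simp_all add: wavelet_coef_def L2_inner_commute [of _ f])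

text \<open>Pythagoras: the coefficient errors below J, plus the energy of f beyond these levels,
  which no choice of c affects.\<close>

lemma L2_dist_sq_basis:
  assumes f: "f \<in> L201"
  shows "L2_dist_sq {0..1} (\<lambda>x. \<Sum>a\<in>labels J. c a * \<psi> (fst a) (snd a) x) f =
    ennreal ((\<Sum>a\<in>labels J. (c a - wavelet_coef \<psi> f a)\<^sup>2) + (ip f f - (\<Sum>a\<in>labels J. (wavelet_coef \<psi> f a)\<^sup>2)))"
  unfolding L2_dist_sq_eq [OF basis_lincomb_L2 f] basis_lincomb_self basis_lincomb_inner [OF f]
  by (simp add: power2_diff sum.distrib sum_subtractf sum_distrib_left algebra_simps)

lemma bessel:
  assumes f: "f \<in> L201"
  shows "(\<Sum>a\<in>labels J. (wavelet_coef \<psi> f a)\<^sup>2) \<le> ip f f"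
proof -
  have "0 \<le> (\<integral>x. ((\<Sum>a\<in>labels J. wavelet_coef \<psi> f a * \<psi> (fst a) (snd a) x) - f x)\<^sup>2 \<partial>leb01)" by simp
  also have "\<dots> = ip f f - (\<Sum>a\<in>labels J. (wavelet_coef \<psi> f a)\<^sup>2)"
    unfolding L2_inner_diff_self [OF basis_lincomb_L2 f] basis_lincomb_self basis_lincomb_inner [OF f]
    by (simp add: power2_eq_square)
  finally show ?thesis by simp
qed

lemma parseval:
  assumes f: "f \<in> L201"
  shows "(\<lambda>J. \<Sum>a\<in>labels J. (wavelet_coef \<psi> f a)\<^sup>2) \<longlonglongrightarrow> ip f f"
proof -
  have eq: "L2_dist_sq {0..1} f (\<lambda>x. \<Sum>j<J. \<Sum>k\<in>level j. ip f (\<psi> j k) * \<psi> j k x) =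
      ennreal (ip f f - (\<Sum>a\<in>labels J. (wavelet_coef \<psi> f a)\<^sup>2))" for J
  proof -
    have "L2_dist_sq {0..1} f (\<lambda>x. \<Sum>j<J. \<Sum>k\<in>level j. ip f (\<psi> j k) * \<psi> j k x) =
      L2_dist_sq {0..1} (\<lambda>x. \<Sum>a\<in>labels J. wavelet_coef \<psi> f a * \<psi> (fst a) (snd a) x) f"
      unfolding L2_dist_sq_def labels_def
      by (simp add: sum.Sigma wavelet_coef_def split_beta power2_commute)
    then show ?thesis by (simp add: L2_dist_sq_basis [OF f])
  qed
  have "(\<lambda>J. ennreal (ip f f - (\<Sum>a\<in>labels J. (wavelet_coef \<psi> f a)\<^sup>2))) \<longlonglongrightarrow> ennreal 0"
    using \<psi> f unfolding orthonormal_basis01_def by (auto simp: eq)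
  then have "(\<lambda>J. ip f f - (\<Sum>a\<in>labels J. (wavelet_coef \<psi> f a)\<^sup>2)) \<longlonglongrightarrow> 0"
    using bessel [OF f] by (subst (asm) tendsto_ennreal_iff) auto
  from tendsto_diff [OF tendsto_const [of "ip f f"] this] show ?thesis by simp
qed

lemma besov_level_energy:
  assumes "f \<in> besov_ball \<psi> s L"
  shows "(\<Sum>k\<in>level j. (wavelet_coef \<psi> f (j, k))\<^sup>2) \<le> L\<^sup>2 * (2 powr (- 2 * s)) ^ j"
proof -
  have "ennreal (2 powr (2 * real j * s) * (\<Sum>k\<in>level j. (ip f (\<psi> j k))\<^sup>2)) \<le> besov_norm_sq \<psi> s f"
    unfolding besov_norm_sq_def by (rule SUP_upper) simp
  also have "\<dots> < ennreal (L\<^sup>2)" using assms by (simp add: besov_ball_def)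
  finally have "2 powr (2 * real j * s) * (\<Sum>k\<in>level j. (wavelet_coef \<psi> f (j, k))\<^sup>2) \<le> L\<^sup>2"
    by (simp add: ennreal_less_iff sum_nonneg wavelet_coef_def)
  moreover have "2 powr (2 * real j * s) * (2 powr (- 2 * s)) ^ j = 1"
    by (simp add: powr_realpow [symmetric] powr_powr powr_add [symmetric] mult_ac)
  moreover have "e \<le> B * r" if "a * e \<le> B" "a * r = 1" "0 \<le> r" for a e B r :: real
  proof -
    have "e * (a * r) \<le> B * r"
      using mult_right_mono [OF that(1,3)] by (simp only: mult_ac)
    then show ?thesis by (simp add: that(2))
  qed
  ultimately show ?thesis by simp
qed

text \<open>A geometric series with ratio 2^(-2s), summed over finite ranges of levels and passed to
  the limit by Parseval.\<close>

lemma besov_tail: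
  assumes f: "f \<in> besov_ball \<psi> s L" and s: "0 < s"
  shows "ip f f - (\<Sum>a\<in>labels J. (wavelet_coef \<psi> f a)\<^sup>2) \<le> L\<^sup>2 / (1 - 2 powr (- 2 * s)) * (2 powr (- 2 * s)) ^ J"
proof -
  define q where "q = 2 powr (- 2 * s)"
  have q: "0 < q" "q < 1" using s by (auto simp: q_def powr_less_one)
  have fL: "f \<in> L201" using f by (simp add: besov_ball_def)
  define E where "E j = (\<Sum>k\<in>level j. (wavelet_coef \<psi> f (j, k))\<^sup>2)" for j
  have lab: "(\<Sum>a\<in>labels K. (wavelet_coef \<psi> f a)\<^sup>2) = (\<Sum>j<K. E j)" for K
    by (simp add: labels_def E_def sum.Sigma)
  have "(\<Sum>j<K. E j) \<le> (\<Sum>j<J. E j) + L\<^sup>2 / (1 - q) * q ^ J" if "J \<le> K" for K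
  proof -
    have "(\<Sum>j\<in>{J..<K}. E j) \<le> (\<Sum>j\<in>{J..<K}. L\<^sup>2 * q ^ j)"
      unfolding E_def q_def by (intro sum_mono besov_level_energy f)
    also have "\<dots> = L\<^sup>2 * ((q ^ J - q ^ K) / (1 - q))"
      using sum_gp_offset_less [OF that, of q] q by (simp add: sum_distrib_left [symmetric])
    also have "\<dots> \<le> L\<^sup>2 * (q ^ J / (1 - q))"
      using q by (intro mult_left_mono divide_right_mono) auto
    finally have "(\<Sum>j\<in>{J..<K}. E j) \<le> L\<^sup>2 / (1 - q) * q ^ J" by simp
    moreover have "(\<Sum>j<K. E j) = (\<Sum>j<J. E j) + (\<Sum>j\<in>{J..<K}. E j)"
      using that by (simp add: lessThan_atLeast0 sum.atLeastLessThan_concat)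
    ultimately show ?thesis by simp
  qed
  then have "ip f f \<le> (\<Sum>j<J. E j) + L\<^sup>2 / (1 - q) * q ^ J"
    using parseval [OF fL] unfolding lab by (intro LIMSEQ_le_const2) auto
  then show ?thesis unfolding lab q_def by simp
qed

end

section \<open>The observed path of one machine\<close>

definition grid_increment :: "nat \<Rightarrow> nat \<Rightarrow> (real \<Rightarrow> real) \<Rightarrow> real" where
  "grid_increment G l x = x (real (Suc l) / real G) - x (real l / real G)"

text \<open>\<open>G * cell_int G l g\<close> is the mean of g over the cell, so this is the
  integral, against the path, of the projection of g onto step functions.\<close>

definition grid_stat :: "nat \<Rightarrow> (real \<Rightarrow> real) \<Rightarrow> (real \<Rightarrow> real) \<Rightarrow> real" where
  "grid_stat G g x = (\<Sum>l<G. G * cell_int G l g * grid_increment G l x)"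

lemma wiener_lawD:
  assumes "wiener_law P"
  shows "prob_space P" and "sets P = sets path_space"
    and "\<And>s t. 0 \<le> s \<Longrightarrow> s < t \<Longrightarrow> t \<le> 1 \<Longrightarrow>
        distributed P lborel (\<lambda>w. w t - w s) (normal_density 0 (sqrt (t - s)))"
    and "\<And>(ts :: nat \<Rightarrow> real) r. (\<And>k. k \<le> r \<Longrightarrow> ts k \<in> {0..1}) \<Longrightarrow> (\<And>k. k < r \<Longrightarrow> ts k \<le> ts (Suc k)) \<Longrightarrow>
        prob_space.indep_vars P (\<lambda>_. borel) (\<lambda>k w. w (ts (Suc k)) - w (ts k)) {..<r}"
  using assms by (auto simp: wiener_law_def)

lemma path_component_measurable:
  "t \<in> {0..1} \<Longrightarrow> (\<lambda>x. x t) \<in> borel_measurable path_space"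
  unfolding path_space_def by (intro measurable_restrict_space1) measurable

lemma grid_increment_measurable:
  assumes "l < G"
  shows "grid_increment G l \<in> borel_measurable path_space"
proof -
  have "real (Suc l) / G \<le> 1" "real l / G \<le> 1" using assms by (auto simp: divide_le_eq)
  then have mem: "real (Suc l) / G \<in> {0..1}" "real l / G \<in> {0..1}"
    unfolding atLeastAtMost_iff by (metis divide_nonneg_nonneg of_nat_0_le_iff)+
  have "(\<lambda>x. x (real (Suc l) / G) - x (real l / G)) \<in> borel_measurable path_space"
    by (intro borel_measurable_diff path_component_measurable mem)
  then show ?thesis by (simp add: grid_increment_def [abs_def])
qed

lemma grid_stat_measurable [measurable]: "grid_stat G g \<in> borel_measurable path_space"
  unfolding grid_stat_def [abs_def]
  by (intro borel_measurable_sum borel_measurable_times borel_measurable_const grid_increment_measurable) auto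

section \<open>Moments of Wiener increments on a grid\<close>

context
  fixes P :: "(real \<Rightarrow> real) measure" and G :: nat
  assumes P: "wiener_law P" and G: "G > 0"
begin

interpretation prob_space P by (rule wiener_lawD(1) [OF P])

lemma wiener_increment_distributed:
  assumes "l < G"
  shows "distributed P lborel (grid_increment G l) (normal_density 0 (sqrt (1 / G)))"
proof -
  have *: "real (Suc l) / G \<le> 1" "real l / G < real (Suc l) / G" "real (Suc l) / G - real l / G = 1 / G"
    using assms by (auto simp: field_simps)
  have "distributed P lborel (\<lambda>w. w (real (Suc l) / G) - w (real l / G)) (normal_density 0 (sqrt (real (Suc l) / G - real l / G)))"
    using * by (intro wiener_lawD(3) [OF P]) auto
  then show ?thesis unfolding * by (simp add: grid_increment_def [abs_def])
qed

lemma wiener_increment_measurable: "l < G \<Longrightarrow> grid_increment G l \<in> borel_measurable P"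
  using wiener_increment_distributed [of l] by (auto simp: distributed_def)

lemma wiener_increments_indep: "indep_vars (\<lambda>_. borel) (grid_increment G) {..<G}"
  unfolding grid_increment_def [abs_def]
  by (rule wiener_lawD(4) [OF P, of G "\<lambda>k. real k / G"]) (use G in \<open>auto simp: divide_right_mono\<close>)

lemma wiener_increment_moments:
  assumes "l < G"
  shows "integrable P (\<lambda>w. (grid_increment G l w)\<^sup>2)" "expectation (\<lambda>w. (grid_increment G l w)\<^sup>2) = 1 / G"
    "integrable P (grid_increment G l)" "expectation (grid_increment G l) = 0"
proof -
  note D = wiener_increment_distributed [OF assms]
  note [measurable] = wiener_increment_measurable [OF assms]
  have pos: "0 < sqrt (1 / G)" using G by simp
  have "integrable lborel (\<lambda>x. normal_density 0 (sqrt (1 / G)) x * x ^ 2)"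
    using integrable_normal_moment [OF pos, of 0 2] by simp
  then show 1: "integrable P (\<lambda>w. (grid_increment G l w)\<^sup>2)"
    using D by (subst (asm) distributed_integrable [OF D]) auto
  show "integrable P (grid_increment G l)"
    by (rule square_integrable_imp_integrable) (use 1 in auto)
  show E: "expectation (grid_increment G l) = 0"
    by (rule normal_distributed_expectation [OF pos D])
  have "variance (grid_increment G l) = 1 / G"
    using normal_distributed_variance [OF pos D] by simp
  then show "expectation (\<lambda>w. (grid_increment G l w)\<^sup>2) = 1 / G" by (simp add: E)
qed

lemma wiener_increments_mgf:
  "(\<integral>\<^sup>+w. ennreal (exp (\<Sum>l<G. b l * grid_increment G l w)) \<partial>P) = ennreal (exp ((\<Sum>l<G. (b l)\<^sup>2 / G) / 2))"
proof -
  have pos: "0 < sqrt (1 / G)" using G by simp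
  have "(\<integral>\<^sup>+w. ennreal (exp (\<Sum>l<G. b l * grid_increment G l w)) \<partial>P) =
      (\<integral>\<^sup>+w. (\<Prod>l<G. ennreal (exp (b l * grid_increment G l w))) \<partial>P)"
    by (subst prod_ennreal) (auto simp: exp_sum)
  also have "\<dots> = (\<Prod>l<G. \<integral>\<^sup>+w. ennreal (exp (b l * grid_increment G l w)) \<partial>P)"
    by (intro indep_vars_nn_integral indep_vars_compose2 [OF wiener_increments_indep]) auto
  also have "\<dots> = (\<Prod>l<G. ennreal (exp ((b l)\<^sup>2 / G / 2)))"
  proof (rule prod.cong [OF refl])
    fix l assume "l \<in> {..<G}"
    then have l: "l < G" by simp
    show "(\<integral>\<^sup>+w. ennreal (exp (b l * grid_increment G l w)) \<partial>P) = ennreal (exp ((b l)\<^sup>2 / G / 2))"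
      using nn_integral_normal_exp [OF pos, of "b l"]
      by (subst distributed_nn_integral [OF wiener_increment_distributed [OF l], symmetric]) auto
  qed
  also have "\<dots> = ennreal (exp ((\<Sum>l<G. (b l)\<^sup>2 / G) / 2))"
    by (subst prod_ennreal) (auto simp: exp_sum sum_divide_distrib)
  finally show ?thesis .
qed

lemma wiener_increments_sq:
  "integrable P (\<lambda>w. (\<Sum>l<G. b l * grid_increment G l w)\<^sup>2)"
  "expectation (\<lambda>w. (\<Sum>l<G. b l * grid_increment G l w)\<^sup>2) = (\<Sum>l<G. (b l)\<^sup>2 / G)"
proof -
  let ?D = "grid_increment G"
  have *: "integrable P (\<lambda>w. ?D i w * ?D j w) \<and> expectation (\<lambda>w. ?D i w * ?D j w) = (if i = j then 1 / G else 0)"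
    if ij: "i < G" "j < G" for i j
  proof (cases "i = j")
    case True
    then show ?thesis using wiener_increment_moments [OF ij(1)] by (simp add: power2_eq_square)
  next
    case False
    \<comment> \<open>Padding with the constant 1 turns the product of two increments into a product
      over all indices, to which independence applies. The factor with index i has mean 0.\<close>
    define X where "X k w = (if k = i \<or> k = j then ?D k w else 1)" for k w
    have "indep_vars (\<lambda>_. borel) (\<lambda>k w. (\<lambda>x. if k = i \<or> k = j then x else 1) (?D k w)) {..<G}"
      by (rule indep_vars_compose2 [OF wiener_increments_indep]) (auto intro: measurable_If)
    then have ind: "indep_vars (\<lambda>_. borel) X {..<G}" by (simp add: X_def [abs_def])
    have int: "integrable P (X k)" if "k < G" for k
      using wiener_increment_moments [OF that] by (cases "k = i \<or> k = j") (simp_all add: X_def [abs_def])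
    have eq: "(\<Prod>k<G. X k w) = ?D i w * ?D j w" for w
    proof -
      have "(\<Prod>k<G. X k w) = (\<Prod>k<G. (if k = i then ?D i w else 1) * (if k = j then ?D j w else 1))"
        using False by (intro prod.cong) (auto simp: X_def)
      then show ?thesis using ij by (simp add: prod.distrib)
    qed
    have 0: "(\<Prod>k<G. expectation (X k)) = 0"
      using ij wiener_increment_moments(4) [OF ij(1)] by (intro prod_zero) (auto simp: X_def [abs_def] intro!: bexI [of _ i])
    have "integrable P (\<lambda>w. \<Prod>k<G. X k w)"
      by (rule indep_vars_integrable [OF _ ind]) (auto intro: int)
    moreover have "expectation (\<lambda>w. \<Prod>k<G. X k w) = 0"
      by (subst indep_vars_lebesgue_integral [OF _ ind]) (auto intro: int simp: 0)
    ultimately show ?thesis using False by (simp add: eq)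
  qed
  have sq: "(\<Sum>l<G. b l * ?D l w)\<^sup>2 = (\<Sum>i<G. \<Sum>j<G. (b i * b j) * (?D i w * ?D j w))" for w
    by (simp add: power2_eq_square sum_product mult_ac)
  show "integrable P (\<lambda>w. (\<Sum>l<G. b l * ?D l w)\<^sup>2)"
    unfolding sq using * by (intro Bochner_Integration.integrable_sum integrable_mult_right) auto
  have "expectation (\<lambda>w. (\<Sum>l<G. b l * ?D l w)\<^sup>2) =
     (\<Sum>i<G. \<Sum>j<G. (b i * b j) * expectation (\<lambda>w. ?D i w * ?D j w))"
  proof -
    have "expectation (\<lambda>w. \<Sum>j<G. (b i * b j) * (?D i w * ?D j w)) =
       (\<Sum>j<G. (b i * b j) * expectation (\<lambda>w. ?D i w * ?D j w))" if "i < G" for i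
      using * [OF that] by (subst Bochner_Integration.integral_sum) auto
    moreover have "expectation (\<lambda>w. \<Sum>i<G. \<Sum>j<G. (b i * b j) * (?D i w * ?D j w)) =
       (\<Sum>i<G. expectation (\<lambda>w. \<Sum>j<G. (b i * b j) * (?D i w * ?D j w)))"
      by (rule Bochner_Integration.integral_sum)
        (intro Bochner_Integration.integrable_sum integrable_mult_right, use * in auto)
    ultimately show ?thesis unfolding sq by simp
  qed
  also have "\<dots> = (\<Sum>i<G. \<Sum>j<G. if i = j then (b i)\<^sup>2 / G else 0)"
    using * by (intro sum.cong refl) (auto simp: power2_eq_square)
  finally show "expectation (\<lambda>w. (\<Sum>l<G. b l * ?D l w)\<^sup>2) = (\<Sum>l<G. (b l)\<^sup>2 / G)" by simp
qed

end

section \<open>Observed paths and the law of one machine\<close>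

lemma lebesgue_on_initial:
  assumes f: "f \<in> L201" and t: "0 \<le> t" "t \<le> 1"
  shows "(LINT x|lebesgue_on {0..t}. f x) = (LINT x|leb01. f x * indicator {0..t} x)"
    and "integrable leb01 (\<lambda>x. f x * indicator {0..t} x)"
proof -
  note [measurable] = f
  have [measurable]: "(\<lambda>x. indicator {0..t} x :: real) \<in> borel_measurable leb01"
    by (intro measurable_restrict_space1 borel_measurable_indicator) auto
  show "integrable leb01 (\<lambda>x. f x * indicator {0..t} x)"
    by (rule Bochner_Integration.integrable_bound [OF L201_integrable [OF f]]) (auto split: split_indicator)
  have "indicator {0..t} x *\<^sub>R f x = indicator {0..1} x *\<^sub>R (f x * indicator {0..t} x)" for x
    using t by (auto simp: indicator_def)
  then have "(LINT x|lebesgue. indicator {0..t} x *\<^sub>R f x) =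
      (LINT x|lebesgue. indicator {0..1} x *\<^sub>R (f x * indicator {0..t} x))"
    by presburger
  then show "(LINT x|lebesgue_on {0..t}. f x) = (LINT x|leb01. f x * indicator {0..t} x)"
    by (simp add: integral_restrict_space del: real_scaleR_def)
qed

lemma cell_int_eq_diff:
  assumes f: "f \<in> L201" and l: "l < G"
  shows "cell_int G l f = (LINT x|lebesgue_on {0..real (Suc l) / G}. f x) - (LINT x|lebesgue_on {0..real l / G}. f x)"
proof -
  have *: "0 \<le> real l / G" "real l / G \<le> real (Suc l) / G" "real (Suc l) / G \<le> 1" "real l / G \<le> 1" "0 \<le> real (Suc l) / G"
    using l by (auto simp: field_simps)
  have "cell_int G l f = (LINT x|leb01. f x * indicator {0..real (Suc l) / G} x - f x * indicator {0..real l / G} x)"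
    unfolding cell_int_def
    by (rule Bochner_Integration.integral_cong) (use * in \<open>auto simp: cell_def indicator_def\<close>)
  then show ?thesis
    using lebesgue_on_initial [OF f *(5,3)] lebesgue_on_initial [OF f *(1,4)] by simp
qed

lemma grid_stat_observed_path:
  assumes f: "f \<in> L201"
  shows "grid_stat G g (observed_path m n f w) =
    grid_inner G g f + sqrt (real m / real n) * (\<Sum>l<G. G * cell_int G l g * grid_increment G l w)"
proof -
  have "grid_increment G l (observed_path m n f w) = cell_int G l f + sqrt (real m / real n) * grid_increment G l w"
    if l: "l < G" for l
  proof -
    have "real (Suc l) / G \<in> {0..1}" "real l / G \<in> {0..1}"
      using l less_le_trans [of 0 "real (Suc l)" "real G"] by (auto simp: field_simps)
    then show ?thesis
      unfolding cell_int_eq_diff [OF f l] by (simp add: grid_increment_def observed_path_def algebra_simps del: of_nat_Suc)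
  qed
  then show ?thesis
    by (simp add: grid_stat_def grid_inner_def sum_distrib_left algebra_simps sum.distrib)
qed

lemma observed_path_measurable:
  assumes P: "wiener_law P" and f: "f \<in> L201"
  shows "observed_path m n f \<in> measurable P path_space"
proof -
  have sets: "sets P = sets path_space" by (rule wiener_lawD(2) [OF P])
  have sp: "space path_space = {w \<in> {0..1} \<rightarrow>\<^sub>E UNIV. continuous_on {0..1} w}"
    by (auto simp: path_space_def space_restrict_space space_PiM)
  \<comment> \<open>Continuity of the drift is taken from the gauge integral, which agrees with the
    Lebesgue integral on every [0,t].\<close>
  have "continuous_on {0..1} (\<lambda>t. integral {0..t} f)"
    using L201_integrable [OF f] by (intro indefinite_integral_continuous_1 integrable_on_lebesgue_on) auto
  moreover have "integral {0..t} f = (LINT x|lebesgue_on {0..t}. f x)" if "t \<in> {0..1}" for t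
  proof -
    have "integrable (lebesgue_on {0..t}) f"
      by (rule integrable_subinterval [OF L201_integrable [OF f]]) (use that in auto)
    then show ?thesis by (simp add: lebesgue_integral_eq_integral)
  qed
  ultimately have F: "continuous_on {0..1} (\<lambda>t. LINT x|lebesgue_on {0..t}. f x)"
    by (rule continuous_on_eq)
  have "observed_path m n f \<in> measurable path_space path_space"
  proof -
    have "observed_path m n f \<in> measurable path_space
       (restrict_space (\<Pi>\<^sub>M t\<in>{0..1::real}. (borel :: real measure)) {w. continuous_on {0..1} w})"
    proof (rule measurable_restrict_space2)
      show "observed_path m n f \<in> space path_space \<rightarrow> {w. continuous_on {0..1} w}"
      proof safe
        fix w assume "w \<in> space path_space"
        then have w: "continuous_on {0..1} w" by (simp add: sp)
        have "continuous_on {0..1} (\<lambda>t. (LINT x|lebesgue_on {0..t}. f x) + sqrt (real m / real n) * w t)"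
          by (intro continuous_intros F w)
        then show "continuous_on {0..1} (observed_path m n f w)"
          by (rule continuous_on_eq) (simp add: observed_path_def)
      qed
      show "observed_path m n f \<in> measurable path_space (\<Pi>\<^sub>M t\<in>{0..1}. borel)"
        unfolding observed_path_def [abs_def]
        by (rule measurable_restrict) (intro borel_measurable_add borel_measurable_times borel_measurable_const path_component_measurable)
    qed
    then show ?thesis by (simp add: path_space_def)
  qed
  then show ?thesis using sets by (simp cong: measurable_cong_sets)
qed

lemma machine_law_prob_space:
  assumes "wiener_law P" "f \<in> L201" "prob_space (seed D i)"
  shows "prob_space (machine_law P m n f D i)"
proof -
  interpret W: prob_space P by (rule wiener_lawD(1) [OF assms(1)])
  interpret A: prob_space "distr P path_space (observed_path m n f)"
    by (rule W.prob_space_distr [OF observed_path_measurable [OF assms(1,2)]])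
  interpret B: prob_space "seed D i" by fact
  interpret pair_prob_space "distr P path_space (observed_path m n f)" "seed D i" ..
  show ?thesis unfolding machine_law_def by (rule prob_space_axioms)
qed

lemma nn_integral_machine_law:
  assumes "wiener_law P" "f \<in> L201" "prob_space (seed D i)"
    and F: "F \<in> borel_measurable path_space"
  shows "(\<integral>\<^sup>+z. F (fst z) \<partial>machine_law P m n f D i) = (\<integral>\<^sup>+w. F (observed_path m n f w) \<partial>P)"
proof -
  note [measurable] = observed_path_measurable [OF assms(1,2), of m n] F
  interpret B: prob_space "seed D i" by fact
  have "(\<integral>\<^sup>+z. F (fst z) \<partial>machine_law P m n f D i) =
     (\<integral>\<^sup>+x. \<integral>\<^sup>+u. F x \<partial>seed D i \<partial>distr P path_space (observed_path m n f))"
    unfolding machine_law_def by (subst B.nn_integral_fst [symmetric]) auto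
  also have "\<dots> = (\<integral>\<^sup>+w. F (observed_path m n f w) \<partial>P)"
    by (simp add: B.emeasure_space_1 nn_integral_distr)
  finally show ?thesis .
qed

locale white_noise_machine =
  fixes P :: "(real \<Rightarrow> real) measure" and \<psi> :: "nat \<Rightarrow> nat \<Rightarrow> real \<Rightarrow> real"
    and G m n :: nat and f :: "real \<Rightarrow> real" and D :: distributed_procedure and i :: nat
  assumes P: "wiener_law P" and \<psi>: "orthonormal_basis01 \<psi>" and G: "G > 0" and mn: "m > 0" "n > 0"
    and f: "f \<in> L201" and seed: "prob_space (seed D i)" "sets (seed D i) = sets borel"
begin

abbreviation "M \<equiv> machine_law P m n f D i"

text \<open>\<open>machine_law\<close> lives on the observed path and the seed; the Wiener path is
  not a coordinate of its sample space. The noise is therefore recovered from the statistic by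
  removing the drift part and rescaling.\<close>

definition noise :: "nat \<times> nat \<Rightarrow> (real \<Rightarrow> real) \<times> real \<Rightarrow> real" where
  "noise a z = (grid_stat G (\<psi> (fst a) (snd a)) (fst z) - grid_inner G (\<psi> (fst a) (snd a)) f) / sqrt (real m / real n)"

lemma stat_eq: "grid_stat G (\<psi> (fst a) (snd a)) (fst z) =
    grid_inner G (\<psi> (fst a) (snd a)) f + sqrt (real m / real n) * noise a z"
  using mn by (simp add: noise_def)

lemma sets_M: "sets M = sets (path_space \<Otimes>\<^sub>M borel)"
  unfolding machine_law_def by (rule sets_pair_measure_cong) (auto simp: seed)

lemma measurable_fst_M: "g \<in> borel_measurable path_space \<Longrightarrow> (\<lambda>z. g (fst z)) \<in> borel_measurable M"
  for g :: "_ \<Rightarrow> 'c::topological_space"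
  unfolding measurable_cong_sets [OF sets_M refl] by (rule measurable_compose [OF measurable_fst])

lemma noise_measurable: "noise a \<in> borel_measurable M"
  unfolding noise_def [abs_def]
  by (intro borel_measurable_divide borel_measurable_diff borel_measurable_const measurable_fst_M grid_stat_measurable)

lemma noise_path:
  "(grid_stat G g (observed_path m n f w) - grid_inner G g f) / sqrt (real m / real n) =
    (\<Sum>l<G. G * cell_int G l g * grid_increment G l w)"
  using mn by (simp add: grid_stat_observed_path [OF f])

text \<open>Regrouping a linear combination of noises by increments reduces its moments to those of
  one weighted sum of independent increments.\<close>

lemma nn_integral_noise:
  assumes "F \<in> borel_measurable borel"
  shows "(\<integral>\<^sup>+z. F (\<Sum>a\<in>K. c a * noise a z) \<partial>M) =
    (\<integral>\<^sup>+w. F (\<Sum>l<G. (\<Sum>a\<in>K. c a * (G * cell_int G l (\<psi> (fst a) (snd a)))) * grid_increment G l w) \<partial>P)"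
proof -
  note [measurable] = assms
  let ?F = "\<lambda>x. F (\<Sum>a\<in>K. c a * ((grid_stat G (\<psi> (fst a) (snd a)) x - grid_inner G (\<psi> (fst a) (snd a)) f) / sqrt (real m / real n)))"
  have "(\<integral>\<^sup>+z. F (\<Sum>a\<in>K. c a * noise a z) \<partial>M) = (\<integral>\<^sup>+z. ?F (fst z) \<partial>M)"
    by (simp add: noise_def)
  also have "\<dots> = (\<integral>\<^sup>+w. ?F (observed_path m n f w) \<partial>P)"
    by (rule nn_integral_machine_law [OF P f seed(1)]) measurable
  also have "\<dots> = (\<integral>\<^sup>+w. F (\<Sum>l<G. (\<Sum>a\<in>K. c a * (G * cell_int G l (\<psi> (fst a) (snd a)))) * grid_increment G l w) \<partial>P)"
    unfolding noise_path
    by (simp add: sum_distrib_left sum_distrib_right mult.assoc) (subst sum.swap, simp)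
  finally show ?thesis .
qed

text \<open>The weight of increment l is G times the cell integral of h, the combination of basis
  functions with coefficients c. The variance is then the squared grid norm of h, which contraction
  and orthonormality bound by the sum of the squares of c.\<close>

lemma sum_sq_coeff:
  assumes "K = labels J"
  shows "(\<Sum>l<G. (\<Sum>a\<in>K. c a * (G * cell_int G l (\<psi> (fst a) (snd a))))\<^sup>2 / G) \<le> (\<Sum>a\<in>K. (c a)\<^sup>2)"
proof -
  let ?h = "\<lambda>x. \<Sum>a\<in>labels J. c a * \<psi> (fst a) (snd a) x"
  have "(\<Sum>a\<in>K. c a * (G * cell_int G l (\<psi> (fst a) (snd a)))) = G * cell_int G l ?h" for l
    by (simp add: cell_int_sum basis_L2 [OF \<psi>] assms sum_distrib_left mult_ac)
  then have "(\<Sum>l<G. (\<Sum>a\<in>K. c a * (G * cell_int G l (\<psi> (fst a) (snd a))))\<^sup>2 / G) = grid_inner G ?h ?h"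
    using G by (simp add: grid_inner_def sum_distrib_left power2_eq_square mult_ac)
  also have "\<dots> \<le> ip ?h ?h" by (rule grid_inner_self_le [OF basis_lincomb_L2 [OF \<psi>] G])
  finally show ?thesis by (simp add: basis_lincomb_self [OF \<psi>] assms)
qed

lemma subgaussian_noise: "subgaussian M (labels J) noise"
  unfolding subgaussian_def
proof (intro conjI allI ballI)
  fix c :: "nat \<times> nat \<Rightarrow> real"
  note * = sum_sq_coeff [OF refl, of c J]
  interpret P: prob_space P by (rule wiener_lawD(1) [OF P])
  show "(\<integral>\<^sup>+z. ennreal (exp (\<Sum>a\<in>labels J. c a * noise a z)) \<partial>M) \<le> ennreal (exp ((\<Sum>a\<in>labels J. (c a)\<^sup>2) / 2))"
    using *
    by (subst nn_integral_noise [where F = "\<lambda>x. ennreal (exp x)"], measurable)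
      (simp add: wiener_increments_mgf [OF P G] ennreal_leI)
  show "(\<integral>\<^sup>+z. ennreal ((\<Sum>a\<in>labels J. c a * noise a z)\<^sup>2) \<partial>M) \<le> ennreal (\<Sum>a\<in>labels J. (c a)\<^sup>2)"
    using *
    by (subst nn_integral_noise [where F = "\<lambda>x. ennreal (x\<^sup>2)"], measurable,
        subst nn_integral_eq_integral [OF wiener_increments_sq(1) [OF P G]])
      (auto simp: wiener_increments_sq(2) [OF P G] ennreal_leI)
qed (auto intro: noise_measurable)

text \<open>An exact value, because the lower tail needs variances close to 1, not merely at most
  1.\<close>

lemma noise_variance: "(\<integral>z. (noise a z)\<^sup>2 \<partial>M) = grid_inner G (\<psi> (fst a) (snd a)) (\<psi> (fst a) (snd a))"
proof -
  have "(\<integral>\<^sup>+z. ennreal ((noise a z)\<^sup>2) \<partial>M) = (\<integral>\<^sup>+z. ennreal ((\<Sum>a\<in>{a}. 1 * noise a z)\<^sup>2) \<partial>M)" by simp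
  also have "\<dots> = ennreal (\<Sum>l<G. (G * cell_int G l (\<psi> (fst a) (snd a)))\<^sup>2 / G)"
    by (subst nn_integral_noise [where F = "\<lambda>x. ennreal (x\<^sup>2)"], measurable,
        subst nn_integral_eq_integral [OF wiener_increments_sq(1) [OF P G]])
      (auto simp: wiener_increments_sq(2) [OF P G])
  also have "(\<Sum>l<G. (G * cell_int G l (\<psi> (fst a) (snd a)))\<^sup>2 / G) = grid_inner G (\<psi> (fst a) (snd a)) (\<psi> (fst a) (snd a))"
    using G by (simp add: grid_inner_def sum_distrib_left power2_eq_square mult_ac)
  finally show ?thesis
    using noise_measurable [of a]
    by (intro integral_eq_nn_integral [THEN trans]) (auto simp: grid_inner_nonneg)
qed

end

section \<open>Coding and quantization\<close>

text \<open>The possible contents of a message: a set of levels and one value for each coefficient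
  on them. The extensional function space keeps this set finite for finite \<open>W\<close>.\<close>

definition payloads :: "nat \<Rightarrow> real set \<Rightarrow> (nat set \<times> (nat \<times> nat \<Rightarrow> real)) set" where
  "payloads J W = Sigma (Pow {..<J}) (\<lambda>S. Sigma S level \<rightarrow>\<^sub>E W)"

text \<open>J header bits mark the chosen levels. Once these are known, the body has a fixed length,
  b bits per coefficient, and counting provides an injection into strings of that length.\<close>

lemma exists_level_code:
  assumes W: "finite W" "card W \<le> 2 ^ b"
  shows "\<exists>enc :: nat set \<times> (nat \<times> nat \<Rightarrow> real) \<Rightarrow> bool list. inj_on enc (payloads J W) \<and>
    (\<forall>S v. (S, v) \<in> payloads J W \<longrightarrow> length (enc (S, v)) = J + b * (\<Sum>j\<in>S. card (level j)))"
proof -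
  have "\<exists>body :: (nat \<times> nat \<Rightarrow> real) \<Rightarrow> bool list. inj_on body (Sigma S level \<rightarrow>\<^sub>E W) \<and>
      body ` (Sigma S level \<rightarrow>\<^sub>E W) \<subseteq> {xs. length xs = b * (\<Sum>j\<in>S. card (level j))}" if S: "S \<subseteq> {..<J}" for S
  proof -
    have fS: "finite S" using S finite_subset by blast
    have "card (Sigma S level \<rightarrow>\<^sub>E W) = card W ^ (\<Sum>j\<in>S. card (level j))"
      using fS by (simp add: card_PiE)
    also have "\<dots> \<le> (2 ^ b) ^ (\<Sum>j\<in>S. card (level j))" by (rule power_mono) (use W in auto)
    also have "\<dots> = card {xs :: bool list. length xs = b * (\<Sum>j\<in>S. card (level j))}"
      using card_lists_length_eq [of "UNIV :: bool set" "b * (\<Sum>j\<in>S. card (level j))"]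
      by (simp add: power_mult)
    finally show ?thesis
      using fS W finite_lists_length_eq [of "UNIV :: bool set" "b * (\<Sum>j\<in>S. card (level j))"]
      by (subst inj_on_iff_card_le) (auto intro!: finite_PiE)
  qed
  then obtain body :: "nat set \<Rightarrow> (nat \<times> nat \<Rightarrow> real) \<Rightarrow> bool list"
    where body: "\<And>S. S \<subseteq> {..<J} \<Longrightarrow> inj_on (body S) (Sigma S level \<rightarrow>\<^sub>E W)"
      "\<And>S. S \<subseteq> {..<J} \<Longrightarrow> body S ` (Sigma S level \<rightarrow>\<^sub>E W) \<subseteq> {xs. length xs = b * (\<Sum>j\<in>S. card (level j))}"
    by metis
  define enc where "enc = (\<lambda>(S, v). map (\<lambda>j. j \<in> S) [0..<J] @ body S v)"
  have "inj_on enc (payloads J W)"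
  proof (rule inj_onI, clarify)
    fix S v S' v'
    assume *: "(S, v) \<in> payloads J W" "(S', v') \<in> payloads J W" "enc (S, v) = enc (S', v')"
    have "\<forall>j<J. j \<in> S \<longleftrightarrow> j \<in> S'"
      using *(3) by (auto simp: enc_def)
    then have S: "S = S'" using *(1,2) by (auto simp: payloads_def)
    then have "body S v = body S v'" using *(3) by (simp add: enc_def)
    then have "v = v'" using body(1) [of S] *(1,2) S by (auto simp: payloads_def dest: inj_onD)
    then show "S = S' \<and> v = v'" using S by simp
  qed
  moreover have "length (enc (S, v)) = J + b * (\<Sum>j\<in>S. card (level j))" if "(S, v) \<in> payloads J W" for S v
    using body(2) [of S] that by (auto simp: payloads_def enc_def image_subset_iff)
  ultimately show ?thesis by blast
qed

text \<open>n is both range and resolution: step 1/n on [-n, n], hence at most 2*n^2 + 1 values.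
  Overflow is sent to 0.\<close>

definition quantize :: "nat \<Rightarrow> real \<Rightarrow> real" where
  "quantize n x = (if \<bar>x\<bar> \<le> real n then of_int \<lfloor>real n * x\<rfloor> / real n else 0)"

definition quantized_values :: "nat \<Rightarrow> real set" where
  "quantized_values n = (\<lambda>i :: int. of_int i / real n) ` {- (int n)\<^sup>2..(int n)\<^sup>2}"

lemma quantize_in: "quantize n x \<in> quantized_values n"
proof (cases "\<bar>x\<bar> \<le> real n")
  case True
  have "real n * \<bar>x\<bar> \<le> real n * real n" using True by (intro mult_left_mono) auto
  then have "\<bar>real n * x\<bar> \<le> of_int ((int n)\<^sup>2)" by (simp add: abs_mult power2_eq_square)
  then have "\<lfloor>real n * x\<rfloor> \<in> {- (int n)\<^sup>2..(int n)\<^sup>2}"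
    by (simp add: le_floor_iff floor_le_iff abs_le_iff)
  then show ?thesis using True by (auto simp: quantize_def quantized_values_def)
next
  case False
  then show ?thesis unfolding quantize_def quantized_values_def
    by (intro image_eqI [of _ _ 0]) auto
qed

lemma quantized_values_finite [simp]: "finite (quantized_values n)"
  by (simp add: quantized_values_def)

lemma card_quantized_values: "card (quantized_values n) \<le> 2 * n\<^sup>2 + 1"
proof -
  have "card (quantized_values n) \<le> card {- (int n)\<^sup>2..(int n)\<^sup>2}"
    unfolding quantized_values_def by (rule card_image_le) simp
  also have "\<dots> = nat (2 * (int n)\<^sup>2 + 1)" by simp
  also have "\<dots> = 2 * n\<^sup>2 + 1" by (simp add: nat_eq_iff)
  finally show ?thesis .
qed

lemma quantize_measurable [measurable]: "quantize n \<in> borel_measurable borel"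
  unfolding quantize_def by measurable

text \<open>Within the range the rounding error is at most $1/n$; outside, $x^2 \le x^4/n^2$.\<close>

lemma quantize_error:
  assumes "n > 0"
  shows "(quantize n x - x)\<^sup>2 \<le> (1 + x ^ 4) / (real n)\<^sup>2"
proof (cases "\<bar>x\<bar> \<le> real n")
  case True
  have "\<bar>of_int \<lfloor>real n * x\<rfloor> - real n * x\<bar> \<le> 1" by linarith
  then have "\<bar>of_int \<lfloor>real n * x\<rfloor> - real n * x\<bar>\<^sup>2 \<le> 1\<^sup>2" by (intro power_mono) auto
  moreover have "quantize n x - x = (of_int \<lfloor>real n * x\<rfloor> - real n * x) / real n"
    using True assms by (simp add: quantize_def field_simps)
  ultimately have "(quantize n x - x)\<^sup>2 \<le> 1 / (real n)\<^sup>2"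
    using assms unfolding power2_abs by (simp only: power_divide) (simp add: divide_right_mono)
  also have "\<dots> \<le> (1 + x ^ 4) / (real n)\<^sup>2" by (intro divide_right_mono) auto
  finally show ?thesis .
next
  case False
  then have "(real n)\<^sup>2 \<le> x\<^sup>2" using power_mono [of "real n" "\<bar>x\<bar>" 2] by simp
  then have "(real n)\<^sup>2 * x\<^sup>2 \<le> x\<^sup>2 * x\<^sup>2" by (intro mult_right_mono) auto
  also have "x\<^sup>2 * x\<^sup>2 = x ^ 4" by (simp flip: power_add)
  finally have "x\<^sup>2 \<le> x ^ 4 / (real n)\<^sup>2" using assms by (simp add: field_simps)
  also have "\<dots> \<le> (1 + x ^ 4) / (real n)\<^sup>2" by (intro divide_right_mono) auto
  finally show ?thesis using False by (simp add: quantize_def)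
qed

section \<open>The distributed protocol\<close>

definition level_labels :: "nat \<Rightarrow> (nat \<times> nat) set" where
  "level_labels j = Pair j ` level j"

lemma sum_level_labels: "(\<Sum>a\<in>level_labels j. g a) = (\<Sum>k\<in>level j. g (j, k))"
  by (simp add: level_labels_def sum.reindex inj_on_def)

lemma card_level_labels: "card (level_labels j) = card (level j)"
  by (simp add: level_labels_def card_image inj_on_def)

lemma finite_level_labels [simp]: "finite (level_labels j)"
  by (simp add: level_labels_def)

lemma level_labels_subset: "j < J \<Longrightarrow> level_labels j \<subseteq> labels J"
  by (auto simp: level_labels_def labels_def)

lemma fst_level_labels: "a \<in> level_labels j \<Longrightarrow> fst a = j"
  by (auto simp: level_labels_def)

lemma sum_labels: "(\<Sum>a\<in>labels J. g a) = (\<Sum>j<J. \<Sum>a\<in>level_labels j. g a)"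
  by (simp add: sum_level_labels labels_def sum.Sigma)

lemma card_level_le: "card (level j) \<le> 2 * 2 ^ j"
  by (auto simp: card_level)

lemma card_level_labels_le: "real (card (level_labels j)) \<le> 2 * 2 ^ j"
  using of_nat_mono [OF card_level_le [of j], where 'a = real] by (simp add: card_level_labels)

lemma sq_le_two_sq: "x\<^sup>2 \<le> 2 * y\<^sup>2 + 2 * (x - y)\<^sup>2" for x y :: real
  using zero_le_power2 [of "x - 2 * y"] by (simp add: power2_eq_square algebra_simps)

lemma grid_inner_commute: "grid_inner G f g = grid_inner G g f"
  by (simp add: grid_inner_def mult.commute)

text \<open>The setting at one fixed n. \<open>m_J2\<close> lifts the test margin above the local
  noise on all tested levels. \<open>grid\<close> is the accuracy that, multiplied by an energy of
  at most n and summed over at most 2^J1 labels, leaves 1/n^2. \<open>n_m\<close> is m >= 5 log n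
  and makes 4^(-m) at most n^(-2).\<close>

locale protocol =
  fixes P :: "(real \<Rightarrow> real) measure" and \<psi> :: "nat \<Rightarrow> nat \<Rightarrow> real \<Rightarrow> real"
    and n m J1 J2 G b :: nat and \<tau> :: real and enc :: "nat set \<times> (nat \<times> nat \<Rightarrow> real) \<Rightarrow> bool list"
  assumes P: "wiener_law P" and \<psi>: "orthonormal_basis01 \<psi>"
    and n: "2 \<le> n" and m: "0 < m" "m \<le> n" and m_J2: "(real m)\<^sup>2 \<le> 8 * 2 ^ J2" and J: "J2 \<le> J1"
    and G: "0 < G"
    and grid: "\<And>a. a \<in> labels J1 \<Longrightarrow>
      1 - grid_inner G (\<psi> (fst a) (snd a)) (\<psi> (fst a) (snd a)) \<le> 1 / (real n ^ 3 * 2 ^ J1)"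
    and n_m: "real n ^ 5 \<le> 2 ^ m"
    and \<tau>: "1024 \<le> \<tau>"
    and enc_inj: "inj_on enc (payloads J1 (quantized_values n))"
    and enc_length: "\<And>S v. (S, v) \<in> payloads J1 (quantized_values n) \<Longrightarrow>
      length (enc (S, v)) = J1 + b * (\<Sum>j\<in>S. card (level j))"
begin

text \<open>The empirical energy of level \<open>j\<close> has noise part $\frac{m}{n}$ times the number of its
  coefficients; the margin $\tau 2^j / n$ is the estimation error that all machines together can
  achieve on that level.\<close>

definition active :: "nat \<Rightarrow> (real \<Rightarrow> real) \<Rightarrow> bool" where
  "active j x \<longleftrightarrow> j < J2 \<or>
     real m / real n * card (level j) + \<tau> * 2 ^ j / n < (\<Sum>k\<in>level j. (grid_stat G (\<psi> j k) x)\<^sup>2)"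

definition sent :: "(real \<Rightarrow> real) \<Rightarrow> nat set" where
  "sent x = {j. j < J1 \<and> active j x}"

definition payload :: "(real \<Rightarrow> real) \<Rightarrow> nat set \<times> (nat \<times> nat \<Rightarrow> real)" where
  "payload x = (sent x, \<lambda>a\<in>Sigma (sent x) level. quantize n (grid_stat G (\<psi> (fst a) (snd a)) x))"

text \<open>\<open>inv_into\<close> is arbitrary on strings that are not code words; no machine ever
  sends one.\<close>

definition decoded :: "(nat \<Rightarrow> bool list) \<Rightarrow> nat \<times> nat \<Rightarrow> real" where
  "decoded y a =
     (let d = \<lambda>i. inv_into (payloads J1 (quantized_values n)) enc (y i);
          S = {i \<in> {1..m}. fst a \<in> fst (d i)}
      in if m \<le> 4 * card S then (\<Sum>i\<in>S. snd (d i) a) / card S else 0)"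

text \<open>The protocol is deterministic: the seed is a point mass and the encoder ignores it. All
  machines use the same encoder.\<close>

definition procedure :: distributed_procedure where
  "procedure = \<lparr>seed = \<lambda>_. return borel 0, encode = \<lambda>i x u. enc (payload x),
     decode = \<lambda>y t. \<Sum>a\<in>labels J1. decoded y a * \<psi> (fst a) (snd a) t\<rparr>"

lemma sent_subset: "sent x \<subseteq> {..<J1}" "finite (sent x)"
  by (auto simp: sent_def)

lemma payload_in: "payload x \<in> payloads J1 (quantized_values n)"
  using sent_subset(1) [of x] by (auto simp: payload_def payloads_def quantize_in)

lemma decode_payload: "inv_into (payloads J1 (quantized_values n)) enc (enc (payload x)) = payload x"
  by (rule inv_into_f_f [OF enc_inj payload_in])

lemma length_message: "length (message procedure i (x, u)) = J1 + b * (\<Sum>j\<in>sent x. card (level j))"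
  using enc_length payload_in [of x] by (simp add: message_def procedure_def payload_def)

lemma length_message_le: "length (message procedure i (x, u)) \<le> J1 + b * 2 ^ J1"
proof -
  have "(\<Sum>j\<in>sent x. card (level j)) \<le> (\<Sum>j<J1. card (level j))"
    by (rule sum_mono2) (use sent_subset in auto)
  also have "\<dots> \<le> 2 ^ J1" using card_labels [of J1] by (simp add: labels_def)
  finally show ?thesis by (simp add: length_message)
qed

lemma active_measurable [measurable]: "Measurable.pred path_space (active j)"
  unfolding active_def [abs_def] by measurable

text \<open>Only finitely many payloads occur, and each is characterized by finitely many threshold
  and rounding conditions on grid statistics.\<close>

lemma encode_measurable: "(\<lambda>x. enc (payload x)) \<in> measurable path_space (count_space UNIV)"
proof (subst measurable_count_space_eq_countable, simp, intro conjI ballI)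
  show "(\<lambda>x. enc (payload x)) \<in> space path_space \<rightarrow> UNIV" by simp
next
  fix y :: "bool list"
  let ?D = "{d \<in> payloads J1 (quantized_values n). enc d = y}"
  have fin: "finite (payloads J1 (quantized_values n))"
    unfolding payloads_def
    by (intro finite_SigmaI finite_PiE) (auto intro: finite_subset [of _ "{..<J1}"])
  have "(\<lambda>x. enc (payload x)) -` {y} \<inter> space path_space = (\<Union>d\<in>?D. {x \<in> space path_space. payload x = d})"
    using payload_in by auto
  also have "\<dots> \<in> sets path_space"
  proof (rule sets.finite_UN)
    show "finite ?D" using fin by simp
    fix d assume "d \<in> ?D"
    then obtain S v where d: "d = (S, v)" "S \<subseteq> {..<J1}" "v \<in> Sigma S level \<rightarrow>\<^sub>E quantized_values n"
      by (auto simp: payloads_def)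
    have fS: "finite S" using d(2) finite_subset by blast
    have "payload x = d \<longleftrightarrow> (\<forall>j\<in>{..<J1}. active j x \<longleftrightarrow> j \<in> S) \<and>
      (\<forall>a\<in>Sigma S level. quantize n (grid_stat G (\<psi> (fst a) (snd a)) x) = v a)" for x
    proof -
      have "sent x = S \<longleftrightarrow> (\<forall>j\<in>{..<J1}. active j x \<longleftrightarrow> j \<in> S)"
        using d(2) by (auto simp: sent_def)
      moreover have "(\<lambda>a\<in>Sigma S level. quantize n (grid_stat G (\<psi> (fst a) (snd a)) x)) = v \<longleftrightarrow>
         (\<forall>a\<in>Sigma S level. quantize n (grid_stat G (\<psi> (fst a) (snd a)) x) = v a)"
        using d(3) by (auto simp: restrict_def PiE_def extensional_def fun_eq_iff)
      ultimately show ?thesis by (auto simp: payload_def d(1))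
    qed
    moreover have "finite (Sigma S level)" using fS by auto
    then have "{x \<in> space path_space. (\<forall>j\<in>{..<J1}. active j x \<longleftrightarrow> j \<in> S) \<and>
      (\<forall>a\<in>Sigma S level. quantize n (grid_stat G (\<psi> (fst a) (snd a)) x) = v a)} \<in> sets path_space"
      by measurable
    ultimately show "{x \<in> space path_space. payload x = d} \<in> sets path_space" by simp
  qed
  finally show "(\<lambda>x. enc (payload x)) -` {y} \<inter> space path_space \<in> sets path_space" .
qed

lemma procedure_estimator: "distributed_estimator m procedure"
  unfolding distributed_estimator_def
proof safe
  fix i
  show "prob_space (seed procedure i)" "a \<in> sets (seed procedure i) \<Longrightarrow> a \<in> sets borel"
    "a \<in> sets borel \<Longrightarrow> a \<in> sets (seed procedure i)" for a
    by (auto simp: procedure_def intro!: prob_space_return)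
  show "(\<lambda>(x, u). encode procedure i x u) \<in> path_space \<Otimes>\<^sub>M borel \<rightarrow>\<^sub>M count_space UNIV"
    using measurable_compose [OF measurable_fst encode_measurable, of "borel :: real measure"]
    by (simp add: procedure_def split_beta)
next
  fix y
  show "decode procedure y \<in> L201"
    using basis_lincomb_L2 [OF \<psi>] by (simp add: procedure_def)
qed

end

section \<open>A fixed signal: coefficient errors and the two error probabilities of the
  test\<close>

lemma power4_sum_le: "(x + y) ^ 4 \<le> 8 * (x ^ 4 + y ^ 4)" for x y :: real
proof -
  have sq: "(u + v)\<^sup>2 \<le> 2 * (u\<^sup>2 + v\<^sup>2)" for u v :: real
    using zero_le_power2 [of "u - v"] by (simp add: power2_eq_square algebra_simps)
  have "((x + y)\<^sup>2)\<^sup>2 \<le> (2 * (x\<^sup>2 + y\<^sup>2))\<^sup>2" by (intro power_mono sq) simp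
  also have "\<dots> = 4 * (x\<^sup>2 + y\<^sup>2)\<^sup>2" by (simp only: power_mult_distrib) simp
  also have "\<dots> \<le> 4 * (2 * ((x\<^sup>2)\<^sup>2 + (y\<^sup>2)\<^sup>2))"
    by (intro mult_left_mono sq) simp
  finally show ?thesis by (simp flip: power_mult)
qed

text \<open>\<open>F\<close> is a bound on the energy of f that is later uniform over both Besov
  balls, so constants built from it do not depend on f; \<open>F <= n\<close> allows cruder
  estimates in terms of n.\<close>

locale protocol_signal = protocol +
  fixes f :: "real \<Rightarrow> real" and F :: real
  assumes f: "f \<in> L201" and F: "ip f f \<le> F" "F \<le> real n"

text \<open>Index 0 stands for any machine: all seeds agree, so the law of a machine does not depend
  on its index.\<close>

sublocale protocol_signal \<subseteq> white_noise_machine P \<psi> G m n f procedure 0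
  by (rule white_noise_machine.intro)
    (use n in \<open>simp_all add: P \<psi> G m f procedure_def prob_space_return\<close>)

context protocol_signal
begin

sublocale prob_space M
  by (rule machine_law_prob_space [OF P f seed(1)])

abbreviation "\<theta> \<equiv> wavelet_coef \<psi> f"

abbreviation energy :: "nat \<Rightarrow> real" where
  "energy j \<equiv> \<Sum>a\<in>level_labels j. (\<theta> a)\<^sup>2"

definition \<mu> :: "nat \<times> nat \<Rightarrow> real" where
  "\<mu> a = grid_inner G (\<psi> (fst a) (snd a)) f"

definition \<sigma> :: real where
  "\<sigma> = sqrt (real m / real n)"

definition V :: "nat \<times> nat \<Rightarrow> (real \<Rightarrow> real) \<times> real \<Rightarrow> real" where
  "V a z = quantize n (grid_stat G (\<psi> (fst a) (snd a)) (fst z))"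

definition A :: "nat \<Rightarrow> ((real \<Rightarrow> real) \<times> real) set" where
  "A j = {z \<in> space M. active j (fst z)}"

lemma sigma: "0 < \<sigma>" "\<sigma>\<^sup>2 = real m / real n" "\<sigma>\<^sup>2 \<le> 1"
  using m n by (auto simp: \<sigma>_def)

lemma stat: "grid_stat G (\<psi> (fst a) (snd a)) (fst z) = \<mu> a + \<sigma> * noise a z"
  by (simp add: stat_eq \<mu>_def \<sigma>_def)

lemma A_measurable [measurable]: "A j \<in> sets M"
proof -
  have "Measurable.pred (path_space \<Otimes>\<^sub>M borel) (\<lambda>z :: (real \<Rightarrow> real) \<times> real. active j (fst z))"
    by measurable
  then have "Measurable.pred M (\<lambda>z. active j (fst z))"
    unfolding measurable_cong_sets [OF sets_M refl] .
  then show ?thesis unfolding A_def by measurable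
qed

lemma V_measurable [measurable]: "V a \<in> borel_measurable M"
proof -
  have "(\<lambda>x. quantize n (grid_stat G (\<psi> (fst a) (snd a)) x)) \<in> borel_measurable path_space" by measurable
  from measurable_fst_M [OF this] show ?thesis by (simp add: V_def [abs_def])
qed

lemma level_subgaussian: "j < J1 \<Longrightarrow> subgaussian M (level_labels j) noise"
  by (rule subgaussian_subset [OF subgaussian_noise level_labels_subset])

lemma coef_sq_le: "a \<in> labels J1 \<Longrightarrow> (\<theta> a)\<^sup>2 \<le> F"
  using bessel [OF \<psi> f, of J1] F(1) member_le_sum [of a "labels J1" "\<lambda>a. (\<theta> a)\<^sup>2"] by auto

lemma grid_coef_error:
  assumes "a \<in> labels J1"
  shows "(\<mu> a - \<theta> a)\<^sup>2 \<le> 1 / (real n ^ 2 * 2 ^ J1)"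
proof -
  have "(\<mu> a - \<theta> a)\<^sup>2 \<le> ip f f * (ip (\<psi> (fst a) (snd a)) (\<psi> (fst a) (snd a)) -
      grid_inner G (\<psi> (fst a) (snd a)) (\<psi> (fst a) (snd a)))"
    using grid_inner_error [OF f basis_L2 [OF \<psi> assms] G]
    by (simp add: \<mu>_def wavelet_coef_def grid_inner_commute [of G f])
  also have "\<dots> \<le> real n * (1 / (real n ^ 3 * 2 ^ J1))"
    using grid [OF assms] F grid_inner_self_le [OF basis_L2 [OF \<psi> assms] G] basis_orthonormal [OF \<psi> assms assms]
    by (intro mult_mono) auto
  also have "\<dots> = 1 / (real n ^ 2 * 2 ^ J1)" using n by (simp add: power3_eq_cube power2_eq_square)
  finally show ?thesis .
qed

lemma card_level_labels_le_J1:
  assumes "j < J1"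
  shows "real (card (level_labels j)) \<le> 2 ^ J1"
proof -
  have "card (level_labels j) \<le> 2 ^ J1"
    using card_mono [OF _ level_labels_subset [OF assms]] card_labels [of J1] by simp
  from of_nat_mono [OF this, where 'a = real] show ?thesis by simp
qed

lemma inverse_n_sq_le: "1 / (real n)\<^sup>2 \<le> 2 ^ j / n"
proof -
  have "1 / (real n)\<^sup>2 \<le> 1 / n" using n by (intro divide_left_mono) (auto simp: power2_eq_square)
  also have "\<dots> \<le> 2 ^ j / n" by (intro divide_right_mono) auto
  finally show ?thesis .
qed

lemma grid_coef_error_level:
  assumes "j < J1"
  shows "(\<Sum>a\<in>level_labels j. (\<mu> a - \<theta> a)\<^sup>2) \<le> 1 / (real n)\<^sup>2"
proof -
  have "(\<Sum>a\<in>level_labels j. (\<mu> a - \<theta> a)\<^sup>2) \<le> (\<Sum>a\<in>level_labels j. 1 / (real n ^ 2 * 2 ^ J1))"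
    using level_labels_subset [OF assms] by (intro sum_mono grid_coef_error) auto
  also have "\<dots> = real (card (level_labels j)) / (real n ^ 2 * 2 ^ J1)" by simp
  also have "\<dots> \<le> 2 ^ J1 / (real n ^ 2 * 2 ^ J1)"
    by (intro divide_right_mono card_level_labels_le_J1 assms) simp
  also have "\<dots> = 1 / (real n)\<^sup>2" by simp
  finally show ?thesis .
qed

text \<open>The quantization bound asks for the fourth moment of the statistic. Its mean has square
  at most 2*F + 2 and the fourth moment of the noise is at most 96; the sum is 1 + 8 * (2*F + 2)^2 +
  8 * 96, and 769 = 1 + 8 * 96.\<close>

lemma quantization_error:
  assumes j: "j < J1"
  shows "(\<integral>\<^sup>+z. ennreal (\<Sum>a\<in>level_labels j. (V a z - (\<mu> a + \<sigma> * noise a z))\<^sup>2) \<partial>M) \<le>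
    ennreal (card (level j) * ((769 + 8 * (2 * F + 2)\<^sup>2) / (real n)\<^sup>2))"
proof -
  note Z = level_subgaussian [OF j]
  note [measurable] = subgaussianD(2) [OF Z]
  let ?c = "1 + 8 * (2 * F + 2)\<^sup>2"
  have pt: "(V a z - (\<mu> a + \<sigma> * noise a z))\<^sup>2 \<le> ?c / (real n)\<^sup>2 + 8 / (real n)\<^sup>2 * (noise a z) ^ 4"
    if a: "a \<in> level_labels j" for a z
  proof -
    have a': "a \<in> labels J1" using a level_labels_subset [OF j] by auto
    have "1 * 1 \<le> real n ^ 2 * 2 ^ J1" using n by (intro mult_mono) (auto simp: one_le_power)
    then have "1 / (real n ^ 2 * 2 ^ J1) \<le> 1" by (simp add: divide_le_eq_1)
    then have 1: "(\<mu> a - \<theta> a)\<^sup>2 \<le> 1" using grid_coef_error [OF a'] by linarith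
    have "(\<mu> a)\<^sup>2 \<le> 2 * F + 2" using sq_le_two_sq [of "\<mu> a" "\<theta> a"] 1 coef_sq_le [OF a'] by linarith
    then have "((\<mu> a)\<^sup>2)\<^sup>2 \<le> (2 * F + 2)\<^sup>2" by (rule power_mono) simp
    then have mu4: "(\<mu> a) ^ 4 \<le> (2 * F + 2)\<^sup>2" by (simp flip: power_mult)
    have "(\<sigma>\<^sup>2)\<^sup>2 \<le> 1\<^sup>2" using sigma(3) by (intro power_mono) auto
    then have "\<sigma> ^ 4 \<le> 1" by (simp flip: power_mult)
    then have "(\<sigma> * noise a z) ^ 4 \<le> (noise a z) ^ 4"
      unfolding power_mult_distrib using mult_right_mono [of "\<sigma> ^ 4" 1 "(noise a z) ^ 4"] by simp
    then have "8 * ((\<mu> a) ^ 4 + (\<sigma> * noise a z) ^ 4) \<le> 8 * ((2 * F + 2)\<^sup>2 + (noise a z) ^ 4)"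
      by (intro mult_left_mono add_mono mu4) auto
    then have "(\<mu> a + \<sigma> * noise a z) ^ 4 \<le> 8 * (2 * F + 2)\<^sup>2 + 8 * (noise a z) ^ 4"
      using order.trans [OF power4_sum_le [of "\<mu> a" "\<sigma> * noise a z"]] by (simp only: distrib_left)
    then have "(1 + (\<mu> a + \<sigma> * noise a z) ^ 4) / (real n)\<^sup>2 \<le> (?c + 8 * (noise a z) ^ 4) / (real n)\<^sup>2"
      by (intro divide_right_mono) auto
    moreover have "(V a z - (\<mu> a + \<sigma> * noise a z))\<^sup>2 \<le> (1 + (\<mu> a + \<sigma> * noise a z) ^ 4) / (real n)\<^sup>2"
      unfolding V_def stat [symmetric] using n by (intro quantize_error) auto
    ultimately show ?thesis by (simp add: add_divide_distrib)
  qed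
  have "(\<integral>\<^sup>+z. ennreal (\<Sum>a\<in>level_labels j. (V a z - (\<mu> a + \<sigma> * noise a z))\<^sup>2) \<partial>M) =
     (\<Sum>a\<in>level_labels j. \<integral>\<^sup>+z. ennreal ((V a z - (\<mu> a + \<sigma> * noise a z))\<^sup>2) \<partial>M)"
    by (subst sum_ennreal [symmetric], simp, subst nn_integral_sum) auto
  also have "\<dots> \<le> (\<Sum>a\<in>level_labels j. ennreal ((769 + 8 * (2 * F + 2)\<^sup>2) / (real n)\<^sup>2))"
  proof (rule sum_mono)
    fix a assume a: "a \<in> level_labels j"
    note [measurable] = subgaussianD(2) [OF Z a]
    have "(\<integral>\<^sup>+z. ennreal ((V a z - (\<mu> a + \<sigma> * noise a z))\<^sup>2) \<partial>M) \<le>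
       (\<integral>\<^sup>+z. ennreal (?c / (real n)\<^sup>2) + ennreal (8 / (real n)\<^sup>2) * ennreal ((noise a z) ^ 4) \<partial>M)"
    proof (rule nn_integral_mono)
      fix z
      have "ennreal ((V a z - (\<mu> a + \<sigma> * noise a z))\<^sup>2) \<le> ennreal (?c / (real n)\<^sup>2 + 8 / (real n)\<^sup>2 * (noise a z) ^ 4)"
        by (rule ennreal_leI [OF pt [OF a]])
      also have "\<dots> = ennreal (?c / (real n)\<^sup>2) + ennreal (8 / (real n)\<^sup>2) * ennreal ((noise a z) ^ 4)"
        by (subst ennreal_plus, simp, simp, subst ennreal_mult) auto
      finally show "ennreal ((V a z - (\<mu> a + \<sigma> * noise a z))\<^sup>2) \<le> \<dots>" .
    qed
    also have "\<dots> = ennreal (?c / (real n)\<^sup>2) + ennreal (8 / (real n)\<^sup>2) * (\<integral>\<^sup>+z. ennreal ((noise a z) ^ 4) \<partial>M)"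
      by (subst nn_integral_add, simp, measurable, subst nn_integral_cmult) (auto simp: emeasure_space_1)
    also have "\<dots> \<le> ennreal (?c / (real n)\<^sup>2) + ennreal (8 / (real n)\<^sup>2) * ennreal 96"
      using subgaussian_fourth_moment [OF Z a] by (intro add_left_mono mult_left_mono) auto
    also have "\<dots> = ennreal (?c / (real n)\<^sup>2 + 8 / (real n)\<^sup>2 * 96)"
      by (subst ennreal_mult [symmetric], simp, simp, subst ennreal_plus [symmetric]) auto
    also have "?c / (real n)\<^sup>2 + 8 / (real n)\<^sup>2 * 96 = (769 + 8 * (2 * F + 2)\<^sup>2) / (real n)\<^sup>2"
      by (simp add: add_divide_distrib [symmetric])
    finally show "(\<integral>\<^sup>+z. ennreal ((V a z - (\<mu> a + \<sigma> * noise a z))\<^sup>2) \<partial>M) \<le> \<dots>" .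
  qed
  also have "\<dots> = ennreal (card (level j) * ((769 + 8 * (2 * F + 2)\<^sup>2) / (real n)\<^sup>2))"
    by (simp only: sum_constant card_level_labels) (subst ennreal_mult, auto simp: ennreal_of_nat_eq_real_of_nat)
  finally show ?thesis .
qed

lemma A_eq_always: "j < J2 \<Longrightarrow> A j = space M"
  by (auto simp: A_def active_def)

text \<open>Division by \<sigma>^2 = m/n normalizes the noise to variance proxy one, and the margin
  \<tau> * 2^j / n becomes \<tau> * 2^j / m.\<close>

lemma A_eq_energy:
  assumes "J2 \<le> j"
  shows "A j = {z \<in> space M. real (card (level_labels j)) + \<tau> * 2 ^ j / m <
     (\<Sum>a\<in>level_labels j. (\<mu> a / \<sigma> + noise a z)\<^sup>2)}"
proof -
  have pos: "0 < real m / real n" using m n by simp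
  have "(\<Sum>k\<in>level j. (grid_stat G (\<psi> j k) (fst z))\<^sup>2) = real m / real n * (\<Sum>a\<in>level_labels j. (\<mu> a / \<sigma> + noise a z)\<^sup>2)" for z
  proof -
    have "(grid_stat G (\<psi> j k) (fst z))\<^sup>2 = real m / real n * (\<mu> (j, k) / \<sigma> + noise (j, k) z)\<^sup>2" for k
    proof -
      have "grid_stat G (\<psi> j k) (fst z) = \<sigma> * (\<mu> (j, k) / \<sigma> + noise (j, k) z)"
        using stat [of "(j, k)" z] sigma(1) by (simp add: distrib_left)
      then show ?thesis by (simp add: power_mult_distrib sigma)
    qed
    then show ?thesis by (simp add: sum_level_labels sum_distrib_left)
  qed
  moreover have "real m / real n * card (level j) + \<tau> * 2 ^ j / n = real m / real n * (real (card (level_labels j)) + \<tau> * 2 ^ j / m)"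
    using m n by (simp add: card_level_labels field_simps)
  ultimately have "active j (fst z) \<longleftrightarrow> real (card (level_labels j)) + \<tau> * 2 ^ j / m <
     (\<Sum>a\<in>level_labels j. (\<mu> a / \<sigma> + noise a z)\<^sup>2)" for z
    using assms pos unfolding active_def by (simp only: mult_less_cancel_left_pos) auto
  then show ?thesis by (simp add: A_def)
qed

lemma sum_scaled_coef: "(\<Sum>a\<in>K. (\<mu> a / \<sigma>)\<^sup>2) = (\<Sum>a\<in>K. (\<mu> a)\<^sup>2) * real n / real m"
  using m n by (simp add: power_divide sigma sum_divide_distrib [symmetric] sum_distrib_right)

text \<open>The exponential bound with l of order 2^(-j/2) leaves exp (-y) with y = \<tau> * 2^(j/2)
  / (8*m), and m^2 <= 8 * 2^J2 makes y^2 at least of order 2^(j - J2). Bounding exp (-y) by a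
  multiple of y^(-4) already gives 4^(-(j - J2)), enough against the 2^j coefficients of the
  level.\<close>

lemma active_unlikely:
  assumes j: "J2 \<le> j" "j < J1" and c: "8 * c + 8 \<le> \<tau>"
    and E: "energy j \<le> c * 2 ^ j / n"
  shows "prob (A j) \<le> 1 / 2 ^ 12 * (1 / 4) ^ (j - J2)"
proof -
  define r :: real where "r = sqrt (2 ^ j)"
  have r: "r\<^sup>2 = 2 ^ j" "1 \<le> r" by (auto simp: r_def)
  define t where "t = \<tau> * 2 ^ j / m"
  define l where "l = 1 / (4 * r)"
  have l: "0 \<le> l" "l \<le> 1 / 4" using r by (auto simp: l_def field_simps)
  have t0: "0 \<le> t" using \<tau> by (simp add: t_def)
  have K: "real (card (level_labels j)) \<le> 2 * r\<^sup>2" by (simp add: r card_level_labels_le)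
  have "(\<Sum>a\<in>level_labels j. (\<mu> a)\<^sup>2) \<le> (\<Sum>a\<in>level_labels j. 2 * (\<theta> a)\<^sup>2 + 2 * (\<mu> a - \<theta> a)\<^sup>2)"
    by (intro sum_mono sq_le_two_sq)
  also have "\<dots> \<le> 2 * (c * 2 ^ j / n) + 2 * (1 / (real n)\<^sup>2)"
    using E grid_coef_error_level [OF j(2)] by (simp add: sum.distrib sum_distrib_left [symmetric])
  also note inverse_n_sq_le [of j]
  finally have mu: "(\<Sum>a\<in>level_labels j. (\<mu> a)\<^sup>2) \<le> (2 * c + 2) * 2 ^ j / n"
    by (simp add: distrib_right add_divide_distrib)
  have "(\<Sum>a\<in>level_labels j. (\<mu> a / \<sigma>)\<^sup>2) \<le> (2 * c + 2) * 2 ^ j / n * real n / m"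
    unfolding sum_scaled_coef by (intro divide_right_mono mult_right_mono mu) auto
  also have "\<dots> = (2 * c + 2) * 2 ^ j / m" using n by simp
  also have "\<dots> \<le> \<tau> / 4 * 2 ^ j / m" using c by (intro divide_right_mono mult_right_mono) auto
  also have "\<dots> = t / 4" by (simp add: t_def)
  finally have a: "(\<Sum>a\<in>level_labels j. (\<mu> a / \<sigma>)\<^sup>2) \<le> t / 4" .
  \<comment> \<open>The signal consumes at most half of the exponent l * t; y is the half that
    remains.\<close>
  define y where "y = l * t / 2"
  have y0: "0 \<le> y" using l t0 by (simp add: y_def)
  have "prob (A j) \<le> exp (4 * l\<^sup>2 * card (level_labels j) + 2 * l * (\<Sum>a\<in>level_labels j. (\<mu> a / \<sigma>)\<^sup>2) - l * t)"
    unfolding A_eq_energy [OF j(1)] t_def [symmetric]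
    by (rule subgaussian_upper_tail [OF level_subgaussian [OF j(2)] l])
  also have "\<dots> \<le> exp (1 / 2 + - y)"
  proof -
    have "4 * l\<^sup>2 * card (level_labels j) \<le> 4 * l\<^sup>2 * (2 * r\<^sup>2)" by (intro mult_left_mono K) auto
    also have "\<dots> = 1 / 2" using r by (simp add: l_def power_divide power_mult_distrib)
    finally have "4 * l\<^sup>2 * card (level_labels j) \<le> 1 / 2" .
    moreover have "2 * l * (\<Sum>a\<in>level_labels j. (\<mu> a / \<sigma>)\<^sup>2) \<le> 2 * l * (t / 4)"
      using l by (intro mult_left_mono a) auto
    ultimately show ?thesis by (simp add: y_def)
  qed
  also have "\<dots> \<le> 2 * exp (- y)"
    unfolding exp_add by (intro mult_right_mono exp_half_le2) auto
  also have "\<dots> \<le> 48 / y ^ 4"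
  proof -
    have m0: "0 < real m" using m by simp
    have "0 < y" using m0 r \<tau> by (simp add: y_def l_def t_def)
    moreover have "y ^ 4 \<le> 24 * exp y" using power_le_fact_exp [OF y0, of 4] by (simp add: fact_numeral)
    ultimately show ?thesis by (simp add: exp_minus field_simps)
  qed
  \<comment> \<open>Here \<tau> >= 1024 enters: y^4 is at least 2^18 * 4^(j - J2), and 48 / 2^18 <=
    2^(-12), the smallness that \<open>many_senders_noise\<close> demands.\<close>
  also have "\<dots> \<le> 48 / (2 ^ 18 * 4 ^ (j - J2))"
  proof -
    have m0: "0 < real m" using m by simp
    have yeq: "y = \<tau> * r / (8 * m)"
      using r by (simp add: y_def l_def t_def r(1) [symmetric] power2_eq_square)
    have "2 ^ j = (2 :: real) ^ (j - J2) * 2 ^ J2" using j by (simp flip: power_add)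
    then have "(real m)\<^sup>2 * 2 ^ (j - J2) \<le> 8 * 2 ^ j"
      using mult_right_mono [OF m_J2, of "2 ^ (j - J2)"] by (simp add: mult_ac)
    then have 1: "2 ^ (j - J2) / 8 \<le> r\<^sup>2 / (real m)\<^sup>2" using m0 unfolding r by (simp add: field_simps)
    have "1024\<^sup>2 \<le> \<tau>\<^sup>2" using \<tau> by (intro power_mono) auto
    then have "1024\<^sup>2 / 64 * (2 ^ (j - J2) / 8) \<le> \<tau>\<^sup>2 / 64 * (r\<^sup>2 / (real m)\<^sup>2)"
      by (intro mult_mono 1 divide_right_mono) auto
    also have "\<dots> = y\<^sup>2" using m0 unfolding yeq by (simp add: power_divide power_mult_distrib)
    finally have "512 * 2 ^ (j - J2) \<le> y\<^sup>2"
      by (rule order.trans [rotated]) simp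
    then have "(512 * 2 ^ (j - J2))\<^sup>2 \<le> (y\<^sup>2)\<^sup>2" by (intro power_mono) auto
    moreover have "(512 * 2 ^ (j - J2))\<^sup>2 = (2 ^ 18 * 4 ^ (j - J2) :: real)"
    proof -
      have "(2 ^ k)\<^sup>2 = (4 ^ k :: real)" for k by (induction k) (auto simp: power2_eq_square)
      then show ?thesis by (simp add: power_mult_distrib)
    qed
    ultimately have "2 ^ 18 * 4 ^ (j - J2) \<le> y ^ 4" by (simp flip: power_mult)
    moreover have pos: "0 < (2 ^ 18 * 4 ^ (j - J2) :: real)" by simp
    ultimately have "0 < y ^ 4" by linarith
    with pos \<open>2 ^ 18 * 4 ^ (j - J2) \<le> y ^ 4\<close> show ?thesis
      by (intro divide_left_mono mult_pos_pos) auto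
  qed
  also have "\<dots> \<le> 1 / 2 ^ 12 * (1 / 4) ^ (j - J2)"
    by (simp add: power_divide field_simps)
  finally show ?thesis .
qed

text \<open>After normalization the signal energy is at least 4*t, so the lower tail gives 13*m /
  (\<tau> * 2^(j/2)) <= 39 / \<tau>, using m <= 3 * 2^(j/2) on tested levels. The value 1/16 is what
  \<open>few_senders_unlikely\<close> amplifies.\<close>

lemma active_likely:
  assumes j: "J2 \<le> j" "j < J1" and E: "(8 * \<tau> + 4) * 2 ^ j / n \<le> energy j"
  shows "prob (space M - A j) \<le> 1 / 16"
proof -
  define r :: real where "r = sqrt (2 ^ j)"
  have r: "r\<^sup>2 = 2 ^ j" "1 \<le> r" by (auto simp: r_def)
  have m0: "0 < real m" using m by simp
  define t where "t = \<tau> * 2 ^ j / m"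
  have t0: "0 < t" using \<tau> m0 by (simp add: t_def)
  have K: "real (card (level_labels j)) \<le> 2 * r\<^sup>2" by (simp add: r card_level_labels_le)
  have "energy j \<le> (\<Sum>a\<in>level_labels j. 2 * (\<mu> a)\<^sup>2 + 2 * (\<mu> a - \<theta> a)\<^sup>2)"
    using sq_le_two_sq [of "\<theta> _" "\<mu> _"] by (intro sum_mono) (simp add: power2_commute)
  also have "\<dots> \<le> 2 * (\<Sum>a\<in>level_labels j. (\<mu> a)\<^sup>2) + 2 * (1 / (real n)\<^sup>2)"
    using grid_coef_error_level [OF j(2)] by (simp add: sum.distrib sum_distrib_left [symmetric])
  finally have "(8 * \<tau> + 4) * (2 ^ j / n) \<le> 2 * (\<Sum>a\<in>level_labels j. (\<mu> a)\<^sup>2) + 2 * (2 ^ j / n)"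
    using E inverse_n_sq_le [of j] by (simp only: times_divide_eq_right)
  moreover have "4 * (\<tau> * u) \<le> S" if "0 \<le> u" "(8 * \<tau> + 4) * u \<le> 2 * S + 2 * u" for u S
    using that by (simp add: distrib_right)
  ultimately have "4 * (\<tau> * (2 ^ j / n)) \<le> (\<Sum>a\<in>level_labels j. (\<mu> a)\<^sup>2)"
    by (meson divide_nonneg_nonneg of_nat_0_le_iff zero_le_numeral zero_le_power)
  then have "4 * \<tau> * 2 ^ j / n \<le> (\<Sum>a\<in>level_labels j. (\<mu> a)\<^sup>2)"
    by (simp only: times_divide_eq_right mult.assoc)
  then have "4 * \<tau> * 2 ^ j / n * real n / m \<le> (\<Sum>a\<in>level_labels j. (\<mu> a / \<sigma>)\<^sup>2)"
    unfolding sum_scaled_coef by (intro divide_right_mono mult_right_mono) auto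
  then have a: "4 * t \<le> (\<Sum>a\<in>level_labels j. (\<mu> a / \<sigma>)\<^sup>2)" using n by (simp add: t_def)
  \<comment> \<open>Each variance falls short of 1 by at most the grid accuracy, and a level has at
    most 2^J1 labels, so the total loss is at most 1.\<close>
  have var: "real (card (level_labels j)) - 1 \<le> (\<Sum>a\<in>level_labels j. \<integral>z. (noise a z)\<^sup>2 \<partial>M)"
  proof -
    have "(\<Sum>a\<in>level_labels j. 1 - (\<integral>z. (noise a z)\<^sup>2 \<partial>M)) \<le> (\<Sum>a\<in>level_labels j. 1 / (real n ^ 3 * 2 ^ J1))"
      using level_labels_subset [OF j(2)] by (intro sum_mono) (auto simp: noise_variance intro!: grid)
    also have "\<dots> = real (card (level_labels j)) / (real n ^ 3 * 2 ^ J1)" by simp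
    also have "\<dots> \<le> 2 ^ J1 / (1 * 2 ^ J1)"
      using n by (intro frac_le mult_right_mono card_level_labels_le_J1 j) (auto simp: one_le_power)
    finally show ?thesis by (simp add: sum_subtractf)
  qed
  have "space M - A j = {z \<in> space M. (\<Sum>a\<in>level_labels j. (\<mu> a / \<sigma> + noise a z)\<^sup>2) \<le> real (card (level_labels j)) + t}"
    unfolding A_eq_energy [OF j(1)] t_def by auto
  then have "prob (space M - A j) \<le> 13 * r / t"
    using subgaussian_lower_tail [OF level_subgaussian [OF j(2)] r(2) K var t0 a] by simp
  also have "13 * r / t = 13 * m / (\<tau> * r)"
    using r m0 by (simp add: t_def r(1) [symmetric] power2_eq_square)
  also have "\<dots> \<le> 13 * (3 * r) / (\<tau> * r)"
  proof -
    have "(2 :: real) ^ J2 \<le> 2 ^ j" using j by (intro power_increasing) auto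
    moreover have "0 \<le> (2 :: real) ^ j" by simp
    ultimately have "(real m)\<^sup>2 \<le> 9 * r\<^sup>2" using m_J2 unfolding r by linarith
    also have "\<dots> = (3 * r)\<^sup>2" by (simp add: power_mult_distrib)
    finally have "real m \<le> 3 * r" by (rule power2_le_imp_le) (use r in simp)
    then show ?thesis using r \<tau> by (intro divide_right_mono) auto
  qed
  also have "\<dots> = 39 / \<tau>" using r by simp
  also have "\<dots> \<le> 1 / 16" using \<tau> by (simp add: field_simps)
  finally show ?thesis .
qed

end

section \<open>Risk and message length, level by level\<close>

context protocol_signal
begin

definition level_risk :: "nat \<Rightarrow> ennreal" where
  "level_risk j = (\<integral>\<^sup>+\<omega>. ennreal (\<Sum>a\<in>level_labels j. (sender_mean {1..m} (A j) (V a) \<omega> - \<theta> a)\<^sup>2) \<partial>PiM {1..m} (\<lambda>_. M))"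

lemma joint_law_eq: "joint_law P m n f procedure = PiM {1..m} (\<lambda>_. M)"
  by (simp add: joint_law_def machine_law_def procedure_def)

text \<open>Decoding inverts the code on every message, and on the sample space a machine lists a
  level exactly when its data lie in the event \<open>A\<close> of that level. The risk analysis can
  thus forget about strings.\<close>

lemma estimate_eq:
  assumes "\<omega> \<in> space (PiM {1..m} (\<lambda>_. M))"
  shows "estimate m procedure \<omega> = (\<lambda>t. \<Sum>a\<in>labels J1. sender_mean {1..m} (A (fst a)) (V a) \<omega> * \<psi> (fst a) (snd a) t)"
proof -
  let ?y = "\<lambda>i\<in>{1..m}. message procedure i (\<omega> i)"
  have "decoded ?y a = sender_mean {1..m} (A (fst a)) (V a) \<omega>" if a: "a \<in> labels J1" for a
  proof -
    have a': "fst a < J1" "snd a \<in> level (fst a)" using a by (auto simp: labels_def)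
    define d where "d i = inv_into (payloads J1 (quantized_values n)) enc (?y i)" for i
    have d: "d i = payload (fst (\<omega> i))" if "i \<in> {1..m}" for i
      using that by (simp add: d_def message_def procedure_def split_beta decode_payload)
    have act: "fst a \<in> fst (d i) \<longleftrightarrow> \<omega> i \<in> A (fst a)" if "i \<in> {1..m}" for i
    proof -
      have "\<omega> i \<in> space M" using assms that by (auto simp: space_PiM PiE_def)
      then show ?thesis using a'(1) by (simp add: d [OF that] payload_def sent_def A_def)
    qed
    have S: "{i \<in> {1..m}. fst a \<in> fst (d i)} = senders {1..m} (A (fst a)) \<omega>"
      unfolding senders_def using act by blast
    have "snd (d i) a = V a (\<omega> i)" if "i \<in> senders {1..m} (A (fst a)) \<omega>" for i
    proof -
      have i: "i \<in> {1..m}" "\<omega> i \<in> A (fst a)" using that by (auto simp: senders_def)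
      then have "a \<in> Sigma (sent (fst (\<omega> i))) level"
        using a' by (cases a) (auto simp: sent_def A_def)
      then show ?thesis by (simp add: d [OF i(1)] payload_def V_def)
    qed
    then show ?thesis
      unfolding decoded_def Let_def d_def [symmetric] S sender_mean_def by simp
  qed
  then show ?thesis by (simp add: estimate_def procedure_def)
qed

lemma sender_mean_measurable:
  "(\<lambda>\<omega>. sender_mean {1..m} (A j) (V a) \<omega>) \<in> borel_measurable (PiM {1..m} (\<lambda>_. M))"
  unfolding sender_mean_def sum_senders [OF finite_atLeastAtMost] card_senders [OF finite_atLeastAtMost]
  by measurable

lemma risk_eq:
  "risk P m n f procedure =
    (\<Sum>j<J1. level_risk j) + ennreal (ip f f - (\<Sum>a\<in>labels J1. (\<theta> a)\<^sup>2))"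
proof -
  interpret Q: prob_space "PiM {1..m} (\<lambda>_. M)" by (rule prob_space_PiM) (rule prob_space_axioms)
  let ?e = "\<lambda>j \<omega>. ennreal (\<Sum>a\<in>level_labels j. (sender_mean {1..m} (A j) (V a) \<omega> - \<theta> a)\<^sup>2)"
  let ?t = "ip f f - (\<Sum>a\<in>labels J1. (\<theta> a)\<^sup>2)"
  note [measurable] = sender_mean_measurable
  have tail: "0 \<le> ?t" using bessel [OF \<psi> f] by simp
  have "risk P m n f procedure = (\<integral>\<^sup>+\<omega>. (\<Sum>j<J1. ?e j \<omega>) + ennreal ?t \<partial>PiM {1..m} (\<lambda>_. M))"
    unfolding risk_def joint_law_eq
  proof (rule nn_integral_cong)
    fix \<omega> assume \<omega>: "\<omega> \<in> space (PiM {1..m} (\<lambda>_. M))"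
    have "(\<Sum>a\<in>labels J1. (sender_mean {1..m} (A (fst a)) (V a) \<omega> - \<theta> a)\<^sup>2) =
       (\<Sum>j<J1. \<Sum>a\<in>level_labels j. (sender_mean {1..m} (A j) (V a) \<omega> - \<theta> a)\<^sup>2)"
      unfolding sum_labels by (intro sum.cong refl) (auto simp: fst_level_labels)
    then show "L2_dist_sq {0..1} (estimate m procedure \<omega>) f = (\<Sum>j<J1. ?e j \<omega>) + ennreal ?t"
      unfolding estimate_eq [OF \<omega>] L2_dist_sq_basis [OF \<psi> f]
      using tail by (subst ennreal_plus) (auto intro!: sum_nonneg simp: sum_ennreal sum_nonneg)
  qed
  also have "\<dots> = (\<Sum>j<J1. level_risk j) + ennreal ?t"
  proof -
    have meas: "?e j \<in> borel_measurable (PiM {1..m} (\<lambda>_. M))" for j by measurable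
    have const: "(\<integral>\<^sup>+\<omega>. ennreal ?t \<partial>PiM {1..m} (\<lambda>_. M)) = ennreal ?t"
      using Q.emeasure_space_1 by simp
    have "(\<integral>\<^sup>+\<omega>. (\<Sum>j<J1. ?e j \<omega>) + ennreal ?t \<partial>PiM {1..m} (\<lambda>_. M)) =
       (\<integral>\<^sup>+\<omega>. (\<Sum>j<J1. ?e j \<omega>) \<partial>PiM {1..m} (\<lambda>_. M)) + (\<integral>\<^sup>+\<omega>. ennreal ?t \<partial>PiM {1..m} (\<lambda>_. M))"
      by (rule nn_integral_add) (intro borel_measurable_sum meas, simp)
    also have "(\<integral>\<^sup>+\<omega>. (\<Sum>j<J1. ?e j \<omega>) \<partial>PiM {1..m} (\<lambda>_. M)) = (\<Sum>j<J1. level_risk j)"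
      unfolding level_risk_def by (rule nn_integral_sum) (rule meas)
    finally show ?thesis unfolding const .
  qed
  finally show ?thesis .
qed

text \<open>n^2 times the bound per coefficient in \<open>quantization_error\<close>.\<close>

definition Cq :: real where "Cq = 769 + 8 * (2 * F + 2)\<^sup>2"

lemma Cq_nonneg: "0 \<le> Cq" by (simp add: Cq_def)

text \<open>In the last term 2^j / n is the variance of the average and m / n the squared selection
  bias; quantization and grid error are absorbed.\<close>

lemma level_risk_le:
  assumes j: "j < J1"
    and rho: "reject_prob {1..m} (A j) \<le> ennreal \<rho>" "0 \<le> \<rho>"
  shows "level_risk j \<le> ennreal (\<rho> * energy j + (24 * Cq + 99) * (2 ^ j + m) / n)"
proof -
  let ?K = "card (level_labels j)"
  note K = card_level_labels_le [of j]
  have "level_risk j \<le> ennreal (\<rho> * energy j + 12 * (?K * (Cq / (real n)\<^sup>2)) +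
      3 * (\<Sum>a\<in>level_labels j. (\<mu> a - \<theta> a)\<^sup>2) + 3 * \<sigma>\<^sup>2 * (16 * (?K / card {1..m} + 1)))"
    unfolding level_risk_def
    by (rule sender_mean_risk [OF _ _ level_subgaussian [OF j] A_measurable V_measurable _ _ rho])
      (use m quantization_error [OF j] Cq_nonneg in \<open>auto simp: Cq_def card_level_labels\<close>)
  also have "\<dots> \<le> ennreal (\<rho> * energy j + (24 * Cq + 99) * (2 ^ j + m) / n)"
  proof (rule ennreal_leI)
    have n0: "0 < real n" and m0: "0 < real m" using n m by auto
    have n2: "c / (real n)\<^sup>2 \<le> c / n" if "0 \<le> c" for c
      using n that by (intro divide_left_mono) (auto simp: power2_eq_square)
    have "12 * (?K * (Cq / (real n)\<^sup>2)) \<le> 12 * (2 * 2 ^ j * (Cq / n))"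
      by (intro mult_left_mono mult_mono K n2 Cq_nonneg divide_nonneg_nonneg) auto
    also have "\<dots> = 24 * Cq * 2 ^ j / n" by simp
    also have "\<dots> \<le> 24 * Cq * (2 ^ j + m) / n"
      using Cq_nonneg by (intro divide_right_mono mult_left_mono) auto
    finally have 1: "12 * (?K * (Cq / (real n)\<^sup>2)) \<le> 24 * Cq * (2 ^ j + m) / n" .
    have "(\<Sum>a\<in>level_labels j. (\<mu> a - \<theta> a)\<^sup>2) \<le> 1 / n"
      using grid_coef_error_level [OF j] n2 [of 1] by simp
    also have "\<dots> \<le> (2 ^ j + m) / n" using m0 by (intro divide_right_mono) (auto intro: add_increasing2)
    finally have 2: "3 * (\<Sum>a\<in>level_labels j. (\<mu> a - \<theta> a)\<^sup>2) \<le> 3 * ((2 ^ j + m) / n)"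
      by (rule mult_left_mono) simp
    have "3 * \<sigma>\<^sup>2 * (16 * (?K / card {1..m} + 1)) = 48 * (?K + m) / n"
      using m0 n0 by (simp add: sigma field_simps)
    also have "\<dots> \<le> 48 * (2 * 2 ^ j + 2 * m) / n"
      using K by (intro divide_right_mono mult_left_mono add_mono) auto
    finally have 3: "3 * \<sigma>\<^sup>2 * (16 * (?K / card {1..m} + 1)) \<le> 96 * ((2 ^ j + m) / n)" by simp
    have "24 * Cq * (2 ^ j + m) / n + 3 * ((2 ^ j + m) / n) + 96 * ((2 ^ j + m) / n) = (24 * Cq + 99) * (2 ^ j + m) / n"
      by (simp add: distrib_right add_divide_distrib [symmetric])
    then show "\<rho> * energy j + 12 * (?K * (Cq / (real n)\<^sup>2)) +
      3 * (\<Sum>a\<in>level_labels j. (\<mu> a - \<theta> a)\<^sup>2) + 3 * \<sigma>\<^sup>2 * (16 * (?K / card {1..m} + 1))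
      \<le> \<rho> * energy j + (24 * Cq + 99) * (2 ^ j + m) / n"
      using 1 2 3 by linarith
  qed
  finally show ?thesis .
qed

lemma reject_prob_always:
  assumes j: "j < J2"
  shows "reject_prob {1..m} (A j) = 0"
proof -
  have "reject_prob {1..m} (A j) = (\<integral>\<^sup>+\<omega>. 0 \<partial>PiM {1..m} (\<lambda>_. M))"
  proof (rule nn_integral_cong)
    fix \<omega> assume "\<omega> \<in> space (PiM {1..m} (\<lambda>_. M))"
    then have "senders {1..m} (A j) \<omega> = {1..m}"
      using A_eq_always [OF j] by (auto simp: senders_def space_PiM PiE_def)
    then show "(if card {1..m} \<le> 4 * card (senders {1..m} (A j) \<omega>) then 0 else 1 :: ennreal) = 0" by simp
  qed
  then show ?thesis by simp
qed

lemma level_risk_always: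
  assumes j: "j < J2"
  shows "level_risk j \<le> ennreal ((24 * Cq + 99) * (2 ^ j + m) / n)"
  using level_risk_le [of j 0] reject_prob_always [OF j] j J by simp

lemma n_sq_le_4m: "(real n)\<^sup>2 \<le> 4 ^ m"
proof -
  have "(real n)\<^sup>2 \<le> real n ^ 5" using n by (intro power_increasing) auto
  also have "\<dots> \<le> 2 ^ m" by (rule n_m)
  also have "\<dots> \<le> 4 ^ m" by (rule power_mono) auto
  finally show ?thesis .
qed

text \<open>If the energy is below (8*\<tau> + 4) * 2^j / n, even certain rejection is affordable.
  Otherwise rejection has probability at most 16 / 4^m, and 4^m >= n^2 with energy at most n leaves
  16 / n. No smoothness of f is used.\<close>

lemma level_risk_any:
  assumes j: "j < J1"
  shows "level_risk j \<le> ennreal ((8 * \<tau> + 24 * Cq + 119) * (2 ^ j + m) / n)"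
proof -
  interpret Q: prob_space "PiM {1..m} (\<lambda>_. M)" by (rule prob_space_PiM) (rule prob_space_axioms)
  define E where "E = energy j"
  have E0: "0 \<le> E" by (simp add: E_def sum_nonneg)
  have "\<exists>\<rho>\<ge>0. reject_prob {1..m} (A j) \<le> ennreal \<rho> \<and>
      \<rho> * E \<le> (8 * \<tau> + 20) * 2 ^ j / n"
  proof (cases "E < (8 * \<tau> + 4) * 2 ^ j / n")
    case True
    then have "E \<le> (8 * \<tau> + 4) * 2 ^ j / n" by simp
    also have "(8 * \<tau> + 4) * 2 ^ j / n \<le> (8 * \<tau> + 20) * 2 ^ j / n" by (intro divide_right_mono mult_right_mono) auto
    finally have "1 * E \<le> (8 * \<tau> + 20) * 2 ^ j / n" by simp
    moreover have "reject_prob {1..m} (A j) \<le> (\<integral>\<^sup>+\<omega>. 1 \<partial>PiM {1..m} (\<lambda>_. M))"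
      by (intro nn_integral_mono) auto
    moreover have "(\<integral>\<^sup>+\<omega>. 1 \<partial>PiM {1..m} (\<lambda>_. M)) = 1" using Q.emeasure_space_1 by simp
    ultimately show ?thesis by (intro exI [of _ 1]) auto
  next
    case False
    have "prob (space M - A j) \<le> 1 / 16"
    proof (cases "j < J2")
      case True
      then show ?thesis by (simp add: A_eq_always)
    next
      case tested: False
      show ?thesis by (rule active_likely) (use j tested False in \<open>auto simp: E_def\<close>)
    qed
    then have *: "reject_prob {1..m} (A j)
       \<le> ennreal (16 / 4 ^ card {1..m})"
      using m by (intro few_senders_unlikely) auto
    have "E \<le> (\<Sum>a\<in>labels J1. (\<theta> a)\<^sup>2)"
      unfolding E_def using level_labels_subset [OF j] by (intro sum_mono2) auto
    also have "\<dots> \<le> n" using bessel [OF \<psi> f, of J1] F by linarith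
    finally have "16 / 4 ^ m * E \<le> 16 / (real n)\<^sup>2 * n"
      using n E0 n_sq_le_4m by (intro mult_mono divide_left_mono) auto
    also have "\<dots> = 16 / n" by (simp add: power2_eq_square)
    also have "\<dots> \<le> (8 * \<tau> + 20) * 2 ^ j / n"
    proof (rule divide_right_mono)
      have "16 * 1 \<le> (8 * \<tau> + 20) * 2 ^ j" using \<tau> by (intro mult_mono) auto
      then show "16 \<le> (8 * \<tau> + 20) * 2 ^ j" by simp
    qed simp
    finally show ?thesis using * by (intro exI [of _ "16 / 4 ^ m"]) auto
  qed
  then obtain \<rho> where \<rho>: "0 \<le> \<rho>"
    "reject_prob {1..m} (A j) \<le> ennreal \<rho>"
    "\<rho> * E \<le> (8 * \<tau> + 20) * 2 ^ j / n" by blast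
  have "\<rho> * E \<le> (8 * \<tau> + 20) * (2 ^ j + m) / n"
    using \<rho>(3) by (rule order.trans) (use \<tau> in \<open>intro divide_right_mono mult_left_mono, auto\<close>)
  then have "\<rho> * E + (24 * Cq + 99) * (2 ^ j + m) / n \<le> (8 * \<tau> + 20) * (2 ^ j + m) / n + (24 * Cq + 99) * (2 ^ j + m) / n"
    by simp
  also have "\<dots> = (8 * \<tau> + 24 * Cq + 119) * (2 ^ j + m) / n"
    by (simp add: add_divide_distrib [symmetric] distrib_right [symmetric])
  finally show ?thesis
    using level_risk_le [OF j \<rho>(2,1)] by (fold E_def) (meson ennreal_leI order_trans)
qed

text \<open>The centre outputs 0 with overwhelming probability and pays the energy; everything else
  is of order 2^j / n^2. The general bound of order 2^j / n would add up to 2^J1 / n, too much for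
  the smoother class.\<close>

lemma level_risk_rare:
  assumes j: "J2 \<le> j" "j < J1" and c: "8 * c + 8 \<le> \<tau>"
    and E: "energy j \<le> c * 2 ^ j / n"
  shows "level_risk j \<le> ennreal (energy j + (24 * Cq + 6 * 2 ^ 14 + 3) * 2 ^ j / (real n)\<^sup>2)"
proof -
  let ?K = "card (level_labels j)"
  note K = card_level_labels_le [of j]
  have "prob (A j) \<le> 1 / 2 ^ 12 * (1 / 4) ^ (j - J2)" by (rule active_unlikely [OF j c E])
  also have "\<dots> \<le> 1 / 2 ^ 12 * 1" by (intro mult_left_mono power_le_one) auto
  finally have p: "prob (A j) \<le> 1 / 2 ^ 12" by simp
  have "level_risk j \<le> ennreal (1 * energy j + 12 * (?K * (Cq / (real n)\<^sup>2)) +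
      3 * (\<Sum>a\<in>level_labels j. (\<mu> a - \<theta> a)\<^sup>2) + 3 * \<sigma>\<^sup>2 * (2 ^ 14 * ?K / 4 ^ card {1..m}))"
    unfolding level_risk_def
    by (rule sender_mean_risk_rare [OF _ _ level_subgaussian [OF j(2)] A_measurable V_measurable _ _ p])
      (use m quantization_error [OF j(2)] Cq_nonneg in \<open>auto simp: Cq_def card_level_labels\<close>)
  also have "\<dots> \<le> ennreal (energy j + (24 * Cq + 6 * 2 ^ 14 + 3) * 2 ^ j / (real n)\<^sup>2)"
  proof (rule ennreal_leI)
    have "12 * (?K * (Cq / (real n)\<^sup>2)) \<le> 12 * (2 * 2 ^ j * (Cq / (real n)\<^sup>2))"
      by (intro mult_left_mono mult_right_mono K divide_nonneg_nonneg Cq_nonneg) auto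
    then have 1: "12 * (?K * (Cq / (real n)\<^sup>2)) \<le> 24 * Cq * (2 ^ j / (real n)\<^sup>2)"
      by (simp add: mult_ac)
    have "1 / (real n)\<^sup>2 \<le> 2 ^ j / (real n)\<^sup>2" by (intro divide_right_mono) auto
    then have 2: "3 * (\<Sum>a\<in>level_labels j. (\<mu> a - \<theta> a)\<^sup>2) \<le> 3 * (2 ^ j / (real n)\<^sup>2)"
      using grid_coef_error_level [OF j(2)] by linarith
    have "3 * \<sigma>\<^sup>2 * (2 ^ 14 * ?K / 4 ^ card {1..m}) \<le> 3 * 1 * (2 ^ 14 * (2 * 2 ^ j) / (real n)\<^sup>2)"
      using n n_sq_le_4m K sigma(3) by (intro mult_mono frac_le) auto
    then have 3: "3 * \<sigma>\<^sup>2 * (2 ^ 14 * ?K / 4 ^ card {1..m}) \<le> 6 * 2 ^ 14 * (2 ^ j / (real n)\<^sup>2)" by simp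
    have "(24 * Cq + 6 * 2 ^ 14 + 3) * 2 ^ j / (real n)\<^sup>2 =
      24 * Cq * (2 ^ j / (real n)\<^sup>2) + 6 * 2 ^ 14 * (2 ^ j / (real n)\<^sup>2) + 3 * (2 ^ j / (real n)\<^sup>2)"
      by (simp add: distrib_right add_divide_distrib)
    then show "1 * energy j + 12 * (?K * (Cq / (real n)\<^sup>2)) +
      3 * (\<Sum>a\<in>level_labels j. (\<mu> a - \<theta> a)\<^sup>2) + 3 * \<sigma>\<^sup>2 * (2 ^ 14 * ?K / 4 ^ card {1..m})
      \<le> energy j + (24 * Cq + 6 * 2 ^ 14 + 3) * 2 ^ j / (real n)\<^sup>2"
      using 1 2 3 by linarith
  qed
  finally show ?thesis .
qed

lemma sum_pow2_le: "(\<Sum>j<J. 2 ^ j) \<le> (2 ^ J :: real)"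
  by (induction J) auto

lemma sum_level_bound:
  fixes C :: real
  assumes C: "0 \<le> C"
  shows "(\<Sum>j<k. ennreal (C * (2 ^ j + m) / n)) \<le> ennreal (C * (2 ^ k + real k * m) / n)"
proof -
  have "(\<Sum>j<k. ennreal (C * (2 ^ j + m) / n)) = ennreal (\<Sum>j<k. C * (2 ^ j + m) / n)"
    using C by (intro sum_ennreal) auto
  also have "(\<Sum>j<k. C * (2 ^ j + m) / n) = C * ((\<Sum>j<k. 2 ^ j) + real k * m) / n"
    by (simp add: sum_divide_distrib [symmetric] sum_distrib_left [symmetric] sum.distrib)
  also have "ennreal \<dots> \<le> ennreal (C * (2 ^ k + real k * m) / n)"
    using C by (intro ennreal_leI divide_right_mono mult_left_mono add_mono sum_pow2_le) auto
  finally show ?thesis .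
qed

lemma risk_rough:
  "risk P m n f procedure \<le> ennreal ((8 * \<tau> + 24 * Cq + 119) * (2 ^ J1 + real J1 * m) / n +
     (ip f f - (\<Sum>a\<in>labels J1. (\<theta> a)\<^sup>2)))"
proof -
  let ?C = "8 * \<tau> + 24 * Cq + 119"
  have C: "0 \<le> ?C" using \<tau> Cq_nonneg by simp
  have tail: "0 \<le> ip f f - (\<Sum>a\<in>labels J1. (\<theta> a)\<^sup>2)" using bessel [OF \<psi> f] by simp
  have "(\<Sum>j<J1. level_risk j) \<le> (\<Sum>j<J1. ennreal (?C * (2 ^ j + m) / n))"
    by (intro sum_mono level_risk_any) auto
  also have "\<dots> \<le> ennreal (?C * (2 ^ J1 + real J1 * m) / n)" by (rule sum_level_bound [OF C])
  finally have "risk P m n f procedure \<le> ennreal (?C * (2 ^ J1 + real J1 * m) / n) + ennreal (ip f f - (\<Sum>a\<in>labels J1. (\<theta> a)\<^sup>2))"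
    unfolding risk_eq by (rule add_right_mono)
  also have "\<dots> = ennreal (?C * (2 ^ J1 + real J1 * m) / n + (ip f f - (\<Sum>a\<in>labels J1. (\<theta> a)\<^sup>2)))"
    using C tail by (intro ennreal_plus [symmetric]) auto
  finally show ?thesis .
qed

text \<open>The energies of the levels between J2 and J1 join the truncation energy beyond J1, so
  the bias is that of an estimator cut off at J2. The terms 2^j / n^2 sum to a multiple of 1/n
  because 2^J1 <= n.\<close>

lemma risk_smooth:
  assumes c: "8 * c + 8 \<le> \<tau>"
    and E: "\<And>j. J2 \<le> j \<Longrightarrow> j < J1 \<Longrightarrow> energy j \<le> c * 2 ^ j / n"
    and J1n: "2 ^ J1 \<le> real n"
  shows "risk P m n f procedure \<le> ennreal ((48 * Cq + 6 * 2 ^ 14 + 102) * (2 ^ J2 + real J2 * m) / n +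
     (ip f f - (\<Sum>a\<in>labels J2. (\<theta> a)\<^sup>2)))"
proof -
  let ?C = "24 * Cq + 99" and ?D = "24 * Cq + 6 * 2 ^ 14 + 3"
  let ?E = "\<lambda>j. \<Sum>a\<in>level_labels j. (\<theta> a)\<^sup>2"
  have n0: "0 < real n" using n by simp
  have C: "0 \<le> ?C" "0 \<le> ?D" using Cq_nonneg by auto
  have split: "(\<Sum>j<J1. g j) = (\<Sum>j<J2. g j) + (\<Sum>j\<in>{J2..<J1}. g j)" for g :: "nat \<Rightarrow> 'z::comm_monoid_add"
    using J by (simp add: lessThan_atLeast0 sum.atLeastLessThan_concat)
  have tail: "0 \<le> ip f f - (\<Sum>a\<in>labels J1. (\<theta> a)\<^sup>2)" using bessel [OF \<psi> f] by simp
  have "(\<Sum>j<J2. level_risk j) \<le> (\<Sum>j<J2. ennreal (?C * (2 ^ j + m) / n))"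
    by (intro sum_mono level_risk_always) auto
  also have "\<dots> \<le> ennreal (?C * (2 ^ J2 + real J2 * m) / n)" by (rule sum_level_bound [OF C(1)])
  finally have 1: "(\<Sum>j<J2. level_risk j) \<le> ennreal (?C * (2 ^ J2 + real J2 * m) / n)" .
  have "(\<Sum>j\<in>{J2..<J1}. level_risk j) \<le> (\<Sum>j\<in>{J2..<J1}. ennreal (?E j + ?D * 2 ^ j / (real n)\<^sup>2))"
    by (rule sum_mono, rule level_risk_rare [OF _ _ c]) (auto intro: E)
  also have "\<dots> = ennreal (\<Sum>j\<in>{J2..<J1}. ?E j + ?D * 2 ^ j / (real n)\<^sup>2)"
    using C Cq_nonneg by (intro sum_ennreal add_nonneg_nonneg sum_nonneg divide_nonneg_nonneg mult_nonneg_nonneg) auto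
  also have "\<dots> \<le> ennreal ((\<Sum>j\<in>{J2..<J1}. ?E j) + ?D / n)"
  proof (rule ennreal_leI)
    have "(\<Sum>j\<in>{J2..<J1}. (2 :: real) ^ j) \<le> (\<Sum>j<J1. 2 ^ j)" by (intro sum_mono2) auto
    also have "\<dots> \<le> n" using sum_pow2_le [of J1] J1n by linarith
    finally have "?D * (\<Sum>j\<in>{J2..<J1}. 2 ^ j) / (real n)\<^sup>2 \<le> ?D * n / (real n)\<^sup>2"
      using C by (intro divide_right_mono mult_left_mono) auto
    also have "\<dots> = ?D / n" using n0 by (simp add: power2_eq_square)
    finally show "(\<Sum>j\<in>{J2..<J1}. ?E j + ?D * 2 ^ j / (real n)\<^sup>2) \<le> (\<Sum>j\<in>{J2..<J1}. ?E j) + ?D / n"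
      by (simp add: sum.distrib sum_divide_distrib [symmetric] sum_distrib_left [symmetric])
  qed
  finally have 2: "(\<Sum>j\<in>{J2..<J1}. level_risk j) \<le> ennreal ((\<Sum>j\<in>{J2..<J1}. ?E j) + ?D / n)" .
  have "risk P m n f procedure \<le> ennreal (?C * (2 ^ J2 + real J2 * m) / n) +
      ennreal ((\<Sum>j\<in>{J2..<J1}. ?E j) + ?D / n) + ennreal (ip f f - (\<Sum>a\<in>labels J1. (\<theta> a)\<^sup>2))"
    unfolding risk_eq split by (intro add_mono 1 2 order_refl)
  also have "\<dots> = ennreal (?C * (2 ^ J2 + real J2 * m) / n + ((\<Sum>j\<in>{J2..<J1}. ?E j) + ?D / n) +
      (ip f f - (\<Sum>a\<in>labels J1. (\<theta> a)\<^sup>2)))"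
  proof -
    have "0 \<le> ?C * (2 ^ J2 + real J2 * m) / n" "0 \<le> (\<Sum>j\<in>{J2..<J1}. ?E j) + ?D / n"
      using C Cq_nonneg by (auto intro!: add_nonneg_nonneg sum_nonneg divide_nonneg_nonneg)
    then show ?thesis using tail by (simp only: ennreal_plus add_nonneg_nonneg)
  qed
  also have "\<dots> \<le> ennreal ((48 * Cq + 6 * 2 ^ 14 + 102) * (2 ^ J2 + real J2 * m) / n +
     (ip f f - (\<Sum>a\<in>labels J2. (\<theta> a)\<^sup>2)))"
  proof (rule ennreal_leI)
    have "?D * 1 / n \<le> ?D * (2 ^ J2 + real J2 * m) / n"
      using C Cq_nonneg by (intro divide_right_mono mult_left_mono add_increasing2) auto
    then have "?C * (2 ^ J2 + real J2 * m) / n + ?D / n \<le>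
       ?C * (2 ^ J2 + real J2 * m) / n + ?D * (2 ^ J2 + real J2 * m) / n" by simp
    also have "\<dots> = (48 * Cq + 6 * 2 ^ 14 + 102) * (2 ^ J2 + real J2 * m) / n"
      by (simp add: add_divide_distrib [symmetric] distrib_right [symmetric])
    finally show "?C * (2 ^ J2 + real J2 * m) / n + ((\<Sum>j\<in>{J2..<J1}. ?E j) + ?D / n) +
      (ip f f - (\<Sum>a\<in>labels J1. (\<theta> a)\<^sup>2)) \<le>
      (48 * Cq + 6 * 2 ^ 14 + 102) * (2 ^ J2 + real J2 * m) / n + (ip f f - (\<Sum>a\<in>labels J2. (\<theta> a)\<^sup>2))"
      unfolding sum_labels split by linarith
  qed
  finally show ?thesis .
qed

text \<open>The header costs J1 bits. Levels below J2 are always sent; above J2, 2^j * 4^(-(j - J2))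
  = 2^J2 * 2^(-(j - J2)) is a geometric series. Each group contributes at most 2 * 2^J2 expected
  coefficients.\<close>

lemma expected_bits_smooth:
  assumes c: "8 * c + 8 \<le> \<tau>"
    and E: "\<And>j. J2 \<le> j \<Longrightarrow> j < J1 \<Longrightarrow> energy j \<le> c * 2 ^ j / n"
  shows "expected_bits P m n f procedure i \<le> ennreal (real J1 + real b * (4 * 2 ^ J2))"
proof -
  have "expected_bits P m n f procedure i = (\<integral>\<^sup>+z. of_nat (length (message procedure i z)) \<partial>M)"
    by (simp add: expected_bits_def machine_law_def procedure_def)
  also have "\<dots> = (\<integral>\<^sup>+z. ennreal J1 + ennreal b * (\<Sum>j<J1. ennreal (card (level j)) * indicator (A j) z) \<partial>M)"
  proof (rule nn_integral_cong)
    fix z assume z: "z \<in> space M"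
    have "(\<Sum>j\<in>sent (fst z). real (card (level j))) = (\<Sum>j<J1. real (card (level j)) * indicator (A j) z)"
      using z by (intro sum.mono_neutral_cong_left) (auto simp: sent_def A_def)
    moreover have "real (length (message procedure i z)) = J1 + b * (\<Sum>j\<in>sent (fst z). real (card (level j)))"
      using length_message [of i "fst z" "snd z"] by simp
    ultimately have "real (length (message procedure i z)) = J1 + b * (\<Sum>j<J1. real (card (level j)) * indicator (A j) z)"
      by simp
    then have "ennreal (real (length (message procedure i z))) =
        ennreal (J1 + b * (\<Sum>j<J1. real (card (level j)) * indicator (A j) z))" by simp
    also have "\<dots> = ennreal J1 + ennreal b * (\<Sum>j<J1. ennreal (card (level j)) * indicator (A j) z)"
      by (subst ennreal_plus, simp, simp add: sum_nonneg, subst ennreal_mult, simp, simp add: sum_nonneg,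
          subst sum_ennreal [symmetric]) (auto simp: ennreal_mult ennreal_indicator)
    finally show "of_nat (length (message procedure i z)) = \<dots>"
      by (simp add: ennreal_of_nat_eq_real_of_nat)
  qed
  also have "\<dots> = ennreal J1 + ennreal b * (\<Sum>j<J1. ennreal (card (level j)) * emeasure M (A j))"
    by (subst nn_integral_add, simp, measurable, subst nn_integral_cmult, measurable, subst nn_integral_sum)
      (auto simp: emeasure_space_1 nn_integral_cmult_indicator)
  also have "\<dots> = ennreal (J1 + b * (\<Sum>j<J1. card (level j) * prob (A j)))"
    by (subst ennreal_plus, simp, simp add: sum_nonneg, subst ennreal_mult, simp, simp add: sum_nonneg,
        subst sum_ennreal [symmetric]) (auto simp: ennreal_mult emeasure_eq_measure)
  also have "\<dots> \<le> ennreal (real J1 + real b * (4 * 2 ^ J2))"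
  proof (rule ennreal_leI)
    note K = card_level_labels_le [unfolded card_level_labels]
    have split: "(\<Sum>j<J1. g j) = (\<Sum>j<J2. g j) + (\<Sum>j\<in>{J2..<J1}. g j)" for g :: "nat \<Rightarrow> real"
      using J by (simp add: lessThan_atLeast0 sum.atLeastLessThan_concat)
    have "(\<Sum>j<J2. card (level j) * prob (A j)) \<le> (\<Sum>j<J2. 2 * 2 ^ j * 1)"
      by (intro sum_mono mult_mono K) auto
    also have "\<dots> \<le> 2 * 2 ^ J2"
      using sum_pow2_le [of J2] by (simp add: sum_distrib_left [symmetric])
    finally have 1: "(\<Sum>j<J2. card (level j) * prob (A j)) \<le> 2 * 2 ^ J2" .
    have "(\<Sum>j\<in>{J2..<J1}. card (level j) * prob (A j)) \<le> (\<Sum>j\<in>{J2..<J1}. 2 ^ J2 * (1 / 2) ^ (j - J2))"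
    proof (rule sum_mono)
      fix j assume "j \<in> {J2..<J1}"
      then have j: "J2 \<le> j" "j < J1" by auto
      have "card (level j) * prob (A j) \<le> 2 * 2 ^ j * (1 / 2 ^ 12 * (1 / 4) ^ (j - J2))"
        by (intro mult_mono K active_unlikely [OF j c E [OF j]]) auto
      also have "(2 :: real) ^ j = 2 ^ J2 * 2 ^ (j - J2)" using j by (simp flip: power_add)
      also have "2 * (2 ^ J2 * 2 ^ (j - J2)) * (1 / 2 ^ 12 * (1 / 4) ^ (j - J2)) =
          2 / 2 ^ 12 * (2 ^ J2 * (2 * (1 / 4)) ^ (j - J2) :: real)"
        unfolding power_mult_distrib by simp
      also have "\<dots> \<le> 1 * (2 ^ J2 * (2 * (1 / 4)) ^ (j - J2))"
        by (intro mult_right_mono) auto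
      finally show "card (level j) * prob (A j) \<le> 2 ^ J2 * (1 / 2) ^ (j - J2)" by simp
    qed
    also have "\<dots> = 2 ^ J2 * (\<Sum>k<J1 - J2. (1 / 2) ^ k)"
      using J by (simp add: sum_distrib_left [symmetric] sum.shift_bounds_nat_ivl [of _ 0 J2 "J1 - J2", simplified, symmetric]
          lessThan_atLeast0) (simp add: sum.atLeastLessThan_shift_0 [of _ J2 J1] lessThan_atLeast0)
    also have "(\<Sum>k<J1 - J2. (1 / 2) ^ k) \<le> (2 :: real)"
      by (simp add: sum_gp_strict)
    finally have "(\<Sum>j\<in>{J2..<J1}. card (level j) * prob (A j)) \<le> 2 * 2 ^ J2" by simp
    then have "(\<Sum>j<J1. card (level j) * prob (A j)) \<le> 4 * 2 ^ J2" using 1 unfolding split by linarith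
    then show "real J1 + b * (\<Sum>j<J1. card (level j) * prob (A j)) \<le> real J1 + real b * (4 * 2 ^ J2)"
      by (intro add_left_mono mult_left_mono) auto
  qed
  finally show ?thesis .
qed

end

section \<open>Rates\<close>

lemma floor_log2:
  assumes "1 \<le> R"
  defines "J \<equiv> nat \<lfloor>log 2 R\<rfloor>"
  shows "2 ^ J \<le> R" "R \<le> 2 * 2 ^ J" "real J \<le> log 2 R"
proof -
  have "0 \<le> log 2 R" using assms(1) by simp
  then have J: "real J = of_int \<lfloor>log 2 R\<rfloor>" unfolding J_def by simp
  then show 1: "real J \<le> log 2 R" by linarith
  have "2 powr real J \<le> 2 powr log 2 R" using 1 by simp
  then show "2 ^ J \<le> R" using assms(1) by (simp add: powr_realpow)
  have "log 2 R \<le> real (Suc J)" using J by simp linarith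
  then have "2 powr log 2 R \<le> 2 powr real (Suc J)" by simp
  then have "R \<le> 2 ^ Suc J" using assms(1) by (simp add: powr_realpow del: of_nat_Suc)
  then show "R \<le> 2 * 2 ^ J" by simp
qed

text \<open>For R = n^(1/(1+2s)) one has R^(-2s) = R / n, the balance of squared bias and variance.
  \<kappa> absorbs the passage from R to a power of two.\<close>

lemma bias_rate:
  fixes s \<kappa> :: real
  assumes "0 < n" "0 < s" "0 < \<kappa>" and R: "real n powr (1 / (1 + 2 * s)) \<le> \<kappa> * 2 ^ J"
  shows "(2 powr (- 2 * s)) ^ J \<le> \<kappa> powr (2 * s) * (real n powr (1 / (1 + 2 * s)) / n)"
proof -
  let ?R = "real n powr (1 / (1 + 2 * s))"
  have Rpos: "0 < ?R" using assms by simp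
  have "(2 powr (- 2 * s)) ^ J = (2 ^ J) powr (- 2 * s)"
    by (simp add: powr_realpow [symmetric] powr_powr mult.commute)
  also have "\<dots> \<le> (?R / \<kappa>) powr (- 2 * s)"
    using assms Rpos by (intro powr_mono2') (auto simp: field_simps)
  also have "\<dots> = \<kappa> powr (2 * s) * ?R powr (- 2 * s)"
    using assms Rpos powr_minus_divide [of \<kappa> "2 * s"] by (simp add: powr_divide)
  also have "?R powr (- 2 * s) = ?R / n"
  proof -
    have "1 / (1 + 2 * s) * (- 2 * s) = 1 / (1 + 2 * s) - 1" using assms by (simp add: field_simps)
    then have "?R powr (- 2 * s) = real n powr (1 / (1 + 2 * s) - 1)" by (simp only: powr_powr)
    then show ?thesis using assms by (simp add: powr_diff)
  qed
  finally show ?thesis .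
qed

lemma eventually_le_powr:
  fixes c e :: real
  assumes "0 < e"
  shows "\<forall>\<^sub>F n in sequentially. c \<le> real n powr e"
proof -
  let ?c = "max 1 c"
  have "\<forall>\<^sub>F n in sequentially. ?c powr (1 / e) \<le> real n"
    by (rule eventually_sequentiallyI [of "nat \<lceil>?c powr (1 / e)\<rceil>"]) linarith
  then show ?thesis
  proof eventually_elim
    case (elim n)
    then have "(?c powr (1 / e)) powr e \<le> real n powr e" using assms by (intro powr_mono2) auto
    moreover have "(?c powr (1 / e)) powr e = ?c" using assms by (simp add: powr_powr)
    ultimately show ?case by simp
  qed
qed

text \<open>ln n <= n^d / d with d half the gap between the exponents; the other half absorbs the
  constant.\<close>

lemma eventually_log_powr_le:
  fixes a c :: real
  assumes "a < c"
  shows "\<forall>\<^sub>F n in sequentially. log 2 (real n) * (2 * real n powr a) \<le> real n powr c"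
proof -
  define d where "d = (c - a) / 2"
  have d: "0 < d" "c = a + d + d" using assms by (auto simp: d_def)
  have "\<forall>\<^sub>F n in sequentially. 2 / (ln 2 * d) \<le> real n powr d" by (rule eventually_le_powr) (fact d)
  then show ?thesis using eventually_ge_at_top [of 1]
  proof eventually_elim
    case (elim n)
    have "log 2 (real n) * (2 * real n powr a) = 2 / ln 2 * real n powr a * ln n"
      by (simp add: log_def)
    also have "\<dots> \<le> 2 / ln 2 * real n powr a * (real n powr d / d)"
      using elim d by (intro mult_left_mono ln_powr_bound) auto
    also have "\<dots> = real n powr a * real n powr d * (2 / (ln 2 * d))" by simp
    also have "\<dots> \<le> real n powr a * real n powr d * real n powr d"
      using elim by (intro mult_left_mono) auto
    also have "\<dots> = real n powr c" by (simp only: d(2) powr_add)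
    finally show ?case .
  qed
qed

definition silent_procedure :: distributed_procedure where
  "silent_procedure = \<lparr>seed = \<lambda>_. return borel 0, encode = \<lambda>i x u. [], decode = \<lambda>y t. 0\<rparr>"

lemma silent_procedure: "distributed_estimator m silent_procedure" "length (message silent_procedure i z) = 0"
  by (auto simp: distributed_estimator_def silent_procedure_def message_def split_beta L2_zero
      intro!: prob_space_return)

lemma besov_norm_bound:
  assumes \<psi>: "orthonormal_basis01 \<psi>" and f: "f \<in> besov_ball \<psi> s L" and s: "0 < s"
  shows "ip f f \<le> L\<^sup>2 / (1 - 2 powr (- 2 * s))"
  using besov_tail [OF \<psi> f s, of 0] by (simp add: labels_def)

text \<open>All constants depend on L, s1 and s2 only. \<open>c\<close> bounds the level energies of
  the smoother class: L^2 * 2^(-2*s2*J2) <= L^2 * 2^(2*s2) * R2 / n, and R2 <= 2 * 2^j for j >= J2.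
  \<tau> meets both 1024 <= \<tau> and 8*c + 8 <= \<tau>. The condition log n * m <= R2 keeps the
  selection bias, summed over levels, within the rate.\<close>

lemma protocol_at_scale:
  fixes P :: "(real \<Rightarrow> real) measure" and \<psi> :: "nat \<Rightarrow> nat \<Rightarrow> real \<Rightarrow> real" and s1 s2 L p F :: real and n m :: nat
  assumes P: "wiener_law P" and \<psi>: "orthonormal_basis01 \<psi>" and L: "0 < L"
    and s: "0 < s1" "s1 < s2"
  defines "R1 \<equiv> real n powr (1 / (1 + 2 * s1))" and "R2 \<equiv> real n powr (1 / (1 + 2 * s2))"
  defines "F \<equiv> L\<^sup>2 / (1 - 2 powr (- 2 * s1)) + L\<^sup>2 / (1 - 2 powr (- 2 * s2))"
  defines "c \<equiv> 2 * L\<^sup>2 * 2 powr (2 * s2)"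
  defines "\<tau> \<equiv> 1024 + 8 * c"
  defines "q \<equiv> 769 + 8 * (2 * F + 2)\<^sup>2"
  defines "C \<equiv> 21 + 2 * (8 * \<tau> + 48 * q + 6 * 2 ^ 14 + 119) + F * (16 powr (2 * s1) + 2 powr (2 * s2))"
  assumes n: "2 \<le> n" "F \<le> real n" and R: "8 * R2 \<le> R1" and m: "0 < m" "log 2 n * m \<le> R2"
    and mR: "(real m)\<^sup>2 \<le> 4 * R2" and nm: "5 * log 2 n \<le> real m"
  shows "\<exists>D. distributed_estimator m D \<and>
    (\<forall>i x u. real (length (message D i (x, u))) \<le> R1 * log 2 n) \<and>
    (\<forall>f\<in>besov_ball \<psi> s1 L. (\<forall>i. expected_bits P m n f D i \<le> ennreal (C * (R1 * log 2 n))) \<and>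
        risk P m n f D \<le> ennreal (C * (R1 / n))) \<and>
    (\<forall>f\<in>besov_ball \<psi> s2 L. (\<forall>i. expected_bits P m n f D i \<le> ennreal (C * (R2 * log 2 n))) \<and>
        risk P m n f D \<le> ennreal (C * (R2 / n)))"
proof -
  have n0: "0 < real n" "1 \<le> real n" and n_F: "F \<le> real n" using n by auto
  have log1: "1 \<le> log 2 n" using n by simp
  have R2_1: "1 \<le> R2" unfolding R2_def using n0 s by (intro ge_one_powr_ge_zero) auto
  have R1_8: "1 \<le> R1 / 8" "1 \<le> R1" using R R2_1 by auto
  have R1_n: "R1 \<le> n"
  proof -
    have "R1 \<le> real n powr 1" unfolding R1_def using n0 s by (intro powr_mono) auto
    then show ?thesis using n0 by simp
  qed
  have R2_R1: "R2 \<le> R1" using R R2_1 by simp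
  define J2 where "J2 = nat \<lfloor>log 2 R2\<rfloor>"
  \<comment> \<open>The hard budget R1 * log n has constant 1, while up to 6 * log n bits per
    coefficient are spent, header included; the divisor 8 makes this fit. 8 * R2 <= R1 keeps J2 <=
    J1 nevertheless.\<close>
  define J1 where "J1 = nat \<lfloor>log 2 (R1 / 8)\<rfloor>"
  \<comment> \<open>The alphabet has at most 2*n^2 + 1 <= n^4 values.\<close>
  define b where "b = nat \<lceil>4 * log 2 n\<rceil>"
  note J2 = floor_log2 [OF R2_1, folded J2_def]
  note J1 = floor_log2 [OF R1_8(1), folded J1_def]
  have J1_log: "real J1 \<le> log 2 n"
  proof -
    have "log 2 (R1 / 8) \<le> log 2 n" using R1_8 R1_n by (intro log_mono) auto
    then show ?thesis using J1(3) by linarith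
  qed
  have b: "real b \<le> 5 * log 2 n" "4 * log 2 n \<le> real b"
    using log1 by (auto simp: b_def) linarith
  have J21: "J2 \<le> J1"
    unfolding J2_def J1_def using R R2_1 by (intro nat_mono floor_mono log_mono) auto
  have J1m: "real J1 * m \<le> R2"
    using m(2) J1_log by (meson mult_right_mono of_nat_0_le_iff order_trans)
  have J2m: "real J2 * m \<le> R2"
    using J1m J21 by (meson mult_right_mono of_nat_0_le_iff of_nat_mono order_trans)
  have q01: "0 < 2 powr (- 2 * s)" "2 powr (- 2 * s) < 1" if "0 < s" for s :: real
    using that by (auto simp: powr_less_one)
  have F_parts: "0 \<le> L\<^sup>2 / (1 - 2 powr (- 2 * s1))" "0 \<le> L\<^sup>2 / (1 - 2 powr (- 2 * s2))"
    using q01 [of s1] q01 [of s2] s by auto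
  have F0: "0 \<le> F" using F_parts by (simp add: F_def)
  have c0: "0 \<le> c" by (simp add: c_def)
  have q0: "0 \<le> q" by (simp add: q_def)
  have "\<exists>G>0. \<forall>a\<in>labels J1.
      ip (\<psi> (fst a) (snd a)) (\<psi> (fst a) (snd a)) - grid_inner G (\<psi> (fst a) (snd a)) (\<psi> (fst a) (snd a))
        \<le> 1 / (real n ^ 3 * 2 ^ J1)"
    by (rule grid_inner_approx_finite) (use n0 in \<open>auto intro: basis_L2 [OF \<psi>]\<close>)
  then obtain G where G: "0 < G" "\<And>a. a \<in> labels J1 \<Longrightarrow>
      ip (\<psi> (fst a) (snd a)) (\<psi> (fst a) (snd a)) - grid_inner G (\<psi> (fst a) (snd a)) (\<psi> (fst a) (snd a))
        \<le> 1 / (real n ^ 3 * 2 ^ J1)"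
    by blast
  have "card (quantized_values n) \<le> 2 ^ b"
  proof -
    have "real (card (quantized_values n)) \<le> 2 * (real n)\<^sup>2 + 1"
      using of_nat_mono [OF card_quantized_values [of n], where 'a = real] by simp
    also have "\<dots> \<le> real n ^ 4"
    proof -
      have n4: "4 \<le> (real n)\<^sup>2" using power_mono [of 2 "real n" 2] n by simp
      then have "4 * (real n)\<^sup>2 \<le> (real n)\<^sup>2 * (real n)\<^sup>2" by (intro mult_right_mono) auto
      then have "4 * (real n)\<^sup>2 \<le> real n ^ 4" by (simp flip: power_add)
      then show ?thesis using n4 by linarith
    qed
    also have "\<dots> = 2 powr (4 * log 2 n)"
      using n0 by (simp add: mult.commute [of 4] powr_powr [symmetric] powr_realpow)
    also have "\<dots> \<le> 2 powr real b" using b by simp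
    also have "\<dots> = real (2 ^ b)" by (simp add: powr_realpow)
    finally show ?thesis by (simp only: of_nat_le_iff)
  qed
  from exists_level_code [OF quantized_values_finite this, of J1]
  obtain enc :: "nat set \<times> (nat \<times> nat \<Rightarrow> real) \<Rightarrow> bool list" where enc: "inj_on enc (payloads J1 (quantized_values n))"
    "\<And>S v. (S, v) \<in> payloads J1 (quantized_values n) \<Longrightarrow> length (enc (S, v)) = J1 + b * (\<Sum>j\<in>S. card (level j))"
    by blast
  interpret protocol P \<psi> n m J1 J2 G b \<tau> enc
  proof
    show "m \<le> n"
    proof -
      have "1 * real m \<le> log 2 n * m" using log1 by (intro mult_right_mono) auto
      then have "real m \<le> real n" using m R2_R1 R1_n by linarith
      then show ?thesis by simp
    qed
    show "(real m)\<^sup>2 \<le> 8 * 2 ^ J2" using mR J2(2) by linarith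
    show "1 - grid_inner G (\<psi> (fst a) (snd a)) (\<psi> (fst a) (snd a)) \<le> 1 / (real n ^ 3 * 2 ^ J1)"
      if "a \<in> labels J1" for a
      using G(2) [OF that] basis_orthonormal [OF \<psi> that that] by simp
    have "real n ^ 5 = 2 powr (5 * log 2 n)"
      using n0 by (simp add: mult.commute [of 5] powr_powr [symmetric] powr_realpow)
    also have "\<dots> \<le> 2 powr real m" using nm by simp
    finally show "real n ^ 5 \<le> 2 ^ m" by (simp add: powr_realpow)
    show "1024 \<le> \<tau>" using c0 by (simp add: \<tau>_def)
  qed (use P \<psi> n m J21 G enc in auto)
  have len: "real (length (message procedure i (x, u))) \<le> R1 * log 2 n" for i x u
  proof -
    have "real (length (message procedure i (x, u))) \<le> real J1 + real b * 2 ^ J1"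
      using of_nat_mono [OF length_message_le [of i x u], where 'a = real] by simp
    also have "\<dots> \<le> log 2 n * 2 ^ J1 + 5 * log 2 n * 2 ^ J1"
    proof -
      have "log 2 n * 1 \<le> log 2 n * 2 ^ J1" using log1 by (intro mult_left_mono) auto
      then show ?thesis using J1_log b by (intro add_mono mult_right_mono) auto
    qed
    also have "\<dots> = 6 * log 2 n * 2 ^ J1" by simp
    also have "\<dots> \<le> 6 * log 2 n * (R1 / 8)" using log1 by (intro mult_left_mono J1) auto
    also have "\<dots> \<le> R1 * log 2 n" using log1 R1_8 by simp
    finally show ?thesis .
  qed
  have C0: "21 \<le> C"
    using c0 q0 F0 by (auto simp: C_def \<tau>_def intro!: add_nonneg_nonneg)
  have signal: "protocol_signal P \<psi> n m J1 J2 G b \<tau> enc f F"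
    if fB: "f \<in> besov_ball \<psi> s L" and s': "s = s1 \<or> s = s2" for f s
  proof unfold_locales
    show "f \<in> L201" using fB by (simp add: besov_ball_def)
    have "ip f f \<le> L\<^sup>2 / (1 - 2 powr (- 2 * s))" by (rule besov_norm_bound [OF \<psi> fB]) (use s s' in auto)
    also have "\<dots> \<le> F" using F_parts s' by (auto simp: F_def)
    finally show "ip f f \<le> F" .
  qed (rule n_F)
  have rough: "(\<forall>i. expected_bits P m n f procedure i \<le> ennreal (C * (R1 * log 2 n))) \<and>
      risk P m n f procedure \<le> ennreal (C * (R1 / n))"
    if fB: "f \<in> besov_ball \<psi> s1 L" for f
  proof -
    interpret protocol_signal P \<psi> n m J1 J2 G b \<tau> enc f F by (rule signal [OF fB]) simp
    have "expected_bits P m n f procedure i \<le> ennreal (C * (R1 * log 2 n))" for i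
    proof -
      have "expected_bits P m n f procedure i = (\<integral>\<^sup>+z. of_nat (length (message procedure i z)) \<partial>M)"
        by (simp add: expected_bits_def machine_law_def procedure_def)
      also have "\<dots> \<le> (\<integral>\<^sup>+z. ennreal (C * (R1 * log 2 n)) \<partial>M)"
      proof (rule nn_integral_mono)
        fix z
        have "real (length (message procedure i z)) \<le> 1 * (R1 * log 2 n)"
          using len [of i "fst z" "snd z"] by simp
        also have "1 * (R1 * log 2 n) \<le> C * (R1 * log 2 n)"
          using C0 R1_8 log1 by (intro mult_right_mono) auto
        finally show "of_nat (length (message procedure i z)) \<le> ennreal (C * (R1 * log 2 n))"
          unfolding ennreal_of_nat_eq_real_of_nat by (rule ennreal_leI)
      qed
      finally show ?thesis by (simp add: emeasure_space_1)
    qed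
    moreover have "risk P m n f procedure \<le> ennreal (C * (R1 / n))"
    proof (rule order.trans [OF risk_rough ennreal_leI])
      have "(8 * \<tau> + 24 * Cq + 119) * (2 ^ J1 + real J1 * m) / n \<le> (8 * \<tau> + 24 * q + 119) * (R1 + R1) / n"
        using J1(1) J1m R2_R1 R1_8 q0 c0
        by (intro divide_right_mono mult_mono add_mono) (auto simp: Cq_def q_def \<tau>_def)
      also have "\<dots> = 2 * (8 * \<tau> + 24 * q + 119) * (R1 / n)" by simp
      finally have 1: "(8 * \<tau> + 24 * Cq + 119) * (2 ^ J1 + real J1 * m) / n \<le> \<dots>" .
      have "ip f f - (\<Sum>a\<in>labels J1. (\<theta> a)\<^sup>2) \<le> L\<^sup>2 / (1 - 2 powr (- 2 * s1)) * (2 powr (- 2 * s1)) ^ J1"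
        by (rule besov_tail [OF \<psi> fB s(1)])
      also have "\<dots> \<le> F * (16 powr (2 * s1) * (R1 / n))"
      proof (intro mult_mono)
        show "L\<^sup>2 / (1 - 2 powr (- 2 * s1)) \<le> F" using F_parts by (simp add: F_def)
        \<comment> \<open>16 = 8 * 2: the divisor in the definition of J1 and the rounding of the
          logarithm.\<close>
        show "(2 powr (- 2 * s1)) ^ J1 \<le> 16 powr (2 * s1) * (R1 / n)"
          unfolding R1_def using J1(2) n0 s by (intro bias_rate) (auto simp: R1_def)
      qed (use F0 in auto)
      finally have 2: "ip f f - (\<Sum>a\<in>labels J1. (\<theta> a)\<^sup>2) \<le> F * 16 powr (2 * s1) * (R1 / n)"
        by (simp add: mult.assoc)
      have "2 * (8 * \<tau> + 24 * q + 119) + F * 16 powr (2 * s1) \<le> C"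
        using q0 F0 by (simp add: C_def distrib_left)
      then have "(2 * (8 * \<tau> + 24 * q + 119) + F * 16 powr (2 * s1)) * (R1 / n) \<le> C * (R1 / n)"
        using R1_8 n0 by (intro mult_right_mono) auto
      then show "(8 * \<tau> + 24 * Cq + 119) * (2 ^ J1 + real J1 * m) / n + (ip f f - (\<Sum>a\<in>labels J1. (\<theta> a)\<^sup>2)) \<le> C * (R1 / n)"
        using 1 2 by (simp only: distrib_right)
    qed
    ultimately show ?thesis by blast
  qed
  have smooth: "(\<forall>i. expected_bits P m n f procedure i \<le> ennreal (C * (R2 * log 2 n))) \<and>
      risk P m n f procedure \<le> ennreal (C * (R2 / n))"
    if fB: "f \<in> besov_ball \<psi> s2 L" for f
  proof -
    interpret protocol_signal P \<psi> n m J1 J2 G b \<tau> enc f F by (rule signal [OF fB]) simp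
    have s2: "0 < s2" using s by simp
    have rate: "(2 powr (- 2 * s2)) ^ J2 \<le> 2 powr (2 * s2) * (R2 / n)"
      unfolding R2_def using J2(2) n0 s2 by (intro bias_rate) (auto simp: R2_def)
    have ct: "8 * c + 8 \<le> \<tau>" by (simp add: \<tau>_def)
    have E: "(\<Sum>a\<in>level_labels j. (\<theta> a)\<^sup>2) \<le> c * 2 ^ j / n" if j: "J2 \<le> j" "j < J1" for j
    proof -
      have "(\<Sum>a\<in>level_labels j. (\<theta> a)\<^sup>2) \<le> L\<^sup>2 * (2 powr (- 2 * s2)) ^ j"
        using besov_level_energy [OF \<psi> fB] by (simp add: sum_level_labels)
      also have "\<dots> \<le> L\<^sup>2 * (2 powr (- 2 * s2)) ^ J2"
        using q01 [OF s2] j by (intro mult_left_mono power_decreasing) auto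
      also have "\<dots> \<le> L\<^sup>2 * (2 powr (2 * s2) * (R2 / n))" by (intro mult_left_mono rate) auto
      also have "\<dots> \<le> L\<^sup>2 * (2 powr (2 * s2) * (2 * 2 ^ j / n))"
      proof -
        have "(2 :: real) ^ J2 \<le> 2 ^ j" using j by (intro power_increasing) auto
        then have "R2 \<le> 2 * 2 ^ j" using J2(2) by linarith
        then show ?thesis by (intro mult_left_mono divide_right_mono) auto
      qed
      also have "\<dots> = c * 2 ^ j / n" by (simp add: c_def)
      finally show ?thesis .
    qed
    have "expected_bits P m n f procedure i \<le> ennreal (C * (R2 * log 2 n))" for i
    proof (rule order.trans [OF expected_bits_smooth [OF ct E] ennreal_leI])
      have "real J1 + real b * (4 * 2 ^ J2) \<le> R2 * log 2 n + 5 * log 2 n * (4 * R2)"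
      proof (intro add_mono mult_mono mult_left_mono b J2)
        show "real J1 \<le> R2 * log 2 n"
        proof -
          have "1 * log 2 n \<le> R2 * log 2 n" using R2_1 log1 by (intro mult_right_mono) auto
          then show ?thesis using J1_log by linarith
        qed
      qed (use log1 in auto)
      also have "\<dots> = 21 * (R2 * log 2 n)" by simp
      also have "\<dots> \<le> C * (R2 * log 2 n)" using C0 R2_1 log1 by (intro mult_right_mono) auto
      finally show "real J1 + real b * (4 * 2 ^ J2) \<le> C * (R2 * log 2 n)" .
    qed auto
    moreover have "risk P m n f procedure \<le> ennreal (C * (R2 / n))"
    proof (rule order.trans [OF risk_smooth [OF ct E] ennreal_leI])
      have "(48 * Cq + 6 * 2 ^ 14 + 102) * (2 ^ J2 + real J2 * m) / n \<le> (48 * q + 6 * 2 ^ 14 + 102) * (R2 + R2) / n"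
        using J2(1) J2m R2_1 q0
        by (intro divide_right_mono mult_mono add_mono) (auto simp: Cq_def q_def)
      also have "\<dots> = 2 * (48 * q + 6 * 2 ^ 14 + 102) * (R2 / n)" by simp
      finally have 1: "(48 * Cq + 6 * 2 ^ 14 + 102) * (2 ^ J2 + real J2 * m) / n \<le> \<dots>" .
      have "ip f f - (\<Sum>a\<in>labels J2. (\<theta> a)\<^sup>2) \<le> L\<^sup>2 / (1 - 2 powr (- 2 * s2)) * (2 powr (- 2 * s2)) ^ J2"
        by (rule besov_tail [OF \<psi> fB s2])
      also have "\<dots> \<le> F * (2 powr (2 * s2) * (R2 / n))"
        using F_parts F0 by (intro mult_mono rate) (auto simp: F_def)
      finally have 2: "ip f f - (\<Sum>a\<in>labels J2. (\<theta> a)\<^sup>2) \<le> F * 2 powr (2 * s2) * (R2 / n)"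
        by (simp add: mult.assoc)
      have "2 * (48 * q + 6 * 2 ^ 14 + 102) + F * 2 powr (2 * s2) \<le> C"
        using q0 F0 c0 by (simp add: C_def \<tau>_def distrib_left)
      then have "(2 * (48 * q + 6 * 2 ^ 14 + 102) + F * 2 powr (2 * s2)) * (R2 / n) \<le> C * (R2 / n)"
        using R2_1 n0 by (intro mult_right_mono) auto
      then show "(48 * Cq + 6 * 2 ^ 14 + 102) * (2 ^ J2 + real J2 * m) / n + (ip f f - (\<Sum>a\<in>labels J2. (\<theta> a)\<^sup>2)) \<le> C * (R2 / n)"
        using 1 2 by (simp only: distrib_right)
    next
      show "2 ^ J1 \<le> real n" using J1(1) R1_n R1_8 by linarith
    qed auto
    ultimately show ?thesis by blast
  qed
  show ?thesis using procedure_estimator len rough smooth by blast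
qed

theorem theorem2p5:
  fixes L p s1 s2 :: real
    and m :: "nat \<Rightarrow> nat"
    and P :: "(real \<Rightarrow> real) measure"
    and N :: nat
    and \<psi> :: "nat \<Rightarrow> nat \<Rightarrow> real \<Rightarrow> real"
  assumes "L > 0"
    and "0 < p" and "p < 1 / 2"
    and "\<forall>n\<ge>1. \<bar>real (m n) - real n powr p\<bar> < 1"
    and "0 < s1" and "s1 < s2" and "s2 \<le> 1 / (4 * p) - 1 / 2"
    and "wiener_law P"
    and "cdv_wavelet_basis N \<psi>" and "s2 < real N"
  shows "\<exists>D :: nat \<Rightarrow> distributed_procedure.
    (\<forall>n\<ge>1. 5 * log 2 (real n) \<le> real (m n) \<longrightarrow>
       distributed_estimator (m n) (D n) \<and>
       (\<forall>i\<in>{1..m n}. \<forall>x\<in>space path_space. \<forall>u.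
          real (length (message (D n) i (x, u))) \<le> real n powr (1 / (1 + 2 * s1)) * log 2 (real n))) \<and>
    (\<forall>s\<in>{s1, s2}.
       (\<exists>C>0. \<forall>\<^sub>F n in sequentially. 5 * log 2 (real n) \<le> real (m n) \<longrightarrow>
          (MAX i\<in>{1..m n}. SUP f\<in>besov_ball \<psi> s L. expected_bits P (m n) n f (D n) i)
            \<le> ennreal (C * (real n powr (1 / (1 + 2 * s)) * log 2 (real n)))) \<and>
       (\<exists>C>0. \<forall>\<^sub>F n in sequentially. 5 * log 2 (real n) \<le> real (m n) \<longrightarrow>
          (SUP f\<in>besov_ball \<psi> s L. risk P (m n) n f (D n))
            \<le> ennreal (C * real n powr (- (2 * s) / (1 + 2 * s)))))"
proof -
  have \<psi>: "orthonormal_basis01 \<psi>" using assms(9) by (simp add: cdv_wavelet_basis_def)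
  define R where "R s n = real n powr (1 / (1 + 2 * s))" for s and n :: nat
  define F where "F = L\<^sup>2 / (1 - 2 powr (- 2 * s1)) + L\<^sup>2 / (1 - 2 powr (- 2 * s2))"
  define c where "c = 2 * L\<^sup>2 * 2 powr (2 * s2)"
  define \<tau> where "\<tau> = 1024 + 8 * c"
  define q where "q = 769 + 8 * (2 * F + 2)\<^sup>2"
  define C where "C = 21 + 2 * (8 * \<tau> + 48 * q + 6 * 2 ^ 14 + 119) + F * (16 powr (2 * s1) + 2 powr (2 * s2))"
  define good where "good n D \<longleftrightarrow> distributed_estimator (m n) D \<and>
    (\<forall>i x u. real (length (message D i (x, u))) \<le> R s1 n * log 2 n) \<and>
    (\<forall>s\<in>{s1, s2}. \<forall>f\<in>besov_ball \<psi> s L. (\<forall>i. expected_bits P (m n) n f D i \<le> ennreal (C * (R s n * log 2 n))) \<and>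
        risk P (m n) n f D \<le> ennreal (C * (R s n / n)))" for n D
  \<comment> \<open>The first inequality is the upper bound on s2 solved for p; it becomes m^2 <= 4
    * n^(2p) <= 4 * \<open>R s2 n\<close> below.\<close>
  have \<alpha>: "2 * p \<le> 1 / (1 + 2 * s2)" "1 / (1 + 2 * s2) < 1 / (1 + 2 * s1)"
    using assms(2,5-7) by (auto simp: field_simps)
  have ev: "\<forall>\<^sub>F n in sequentially. 5 * log 2 (real n) \<le> real (m n) \<longrightarrow> (\<exists>D. good n D)"
  proof -
    have "\<forall>\<^sub>F n in sequentially. F \<le> real n powr 1" by (rule eventually_le_powr) simp
    moreover have "\<forall>\<^sub>F n in sequentially. 8 \<le> real n powr (1 / (1 + 2 * s1) - 1 / (1 + 2 * s2))"
      by (rule eventually_le_powr) (use \<alpha> in simp)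
    \<comment> \<open>Since p < 2p, the exponent p lies strictly below 1/(1+2*s2), and the gap
      absorbs the logarithm.\<close>
    moreover have "\<forall>\<^sub>F n in sequentially. log 2 (real n) * (2 * real n powr p) \<le> R s2 n"
      unfolding R_def by (rule eventually_log_powr_le) (use \<alpha> assms(2) in linarith)
    ultimately show ?thesis using eventually_ge_at_top [of 2]
    proof eventually_elim
      case (elim n)
      show ?case
      proof
        assume nm: "5 * log 2 (real n) \<le> real (m n)"
        have n0: "0 < real n" "1 \<le> real n" using elim(4) by auto
        have m: "\<bar>real (m n) - real n powr p\<bar> < 1" using assms(4) elim(4) by simp
        have np: "1 \<le> real n powr p" using n0 assms(2) by (intro ge_one_powr_ge_zero) auto
        have m2: "real (m n) \<le> 2 * real n powr p" using m np by linarith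
        have g1: "0 < m n" using m np by linarith
        have g2: "log 2 n * m n \<le> R s2 n"
          using elim(3,4) m2 by (meson mult_left_mono order_trans zero_le_log_cancel_iff
              n0 less_imp_le one_less_numeral_iff semiring_norm(76))
        have "(real (m n))\<^sup>2 \<le> (2 * real n powr p)\<^sup>2" by (rule power_mono [OF m2]) simp
        also have "\<dots> = 4 * real n powr (2 * p)"
          by (simp only: power_mult_distrib power2_eq_square mult_2 [of p] powr_add)
        also have "\<dots> \<le> 4 * R s2 n"
          unfolding R_def using n0 \<alpha> by (intro mult_left_mono powr_mono) auto
        finally have g3: "(real (m n))\<^sup>2 \<le> 4 * R s2 n" .
        have g4: "8 * R s2 n \<le> R s1 n"
          unfolding R_def using elim(2) n0 by (simp add: powr_diff field_simps)
        have "\<exists>D. distributed_estimator (m n) D \<and>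
          (\<forall>i x u. real (length (message D i (x, u))) \<le> R s1 n * log 2 n) \<and>
          (\<forall>f\<in>besov_ball \<psi> s1 L. (\<forall>i. expected_bits P (m n) n f D i \<le> ennreal (C * (R s1 n * log 2 n))) \<and>
            risk P (m n) n f D \<le> ennreal (C * (R s1 n / n))) \<and>
          (\<forall>f\<in>besov_ball \<psi> s2 L. (\<forall>i. expected_bits P (m n) n f D i \<le> ennreal (C * (R s2 n * log 2 n))) \<and>
            risk P (m n) n f D \<le> ennreal (C * (R s2 n / n)))"
          unfolding C_def q_def \<tau>_def c_def F_def R_def
          by (rule protocol_at_scale [OF assms(8) \<psi> assms(1,5,6) elim(4) _ g4 [unfolded R_def] g1
                g2 [unfolded R_def] g3 [unfolded R_def] nm])
            (use elim(1) n0 in \<open>simp add: F_def\<close>)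
        then show "\<exists>D. good n D" unfolding good_def by auto
      qed
    qed
  qed
  define D where "D n = (if \<exists>D. good n D then SOME D. good n D else silent_procedure)" for n
  have D: "good n (D n)" if "\<exists>D. good n D" for n
    using someI_ex [OF that] that by (simp add: D_def)
  have C: "0 < C"
  proof -
    have "0 \<le> L\<^sup>2 / (1 - 2 powr (- 2 * s))" if "0 < s" for s :: real
      using powr_less_one [of 2 "- 2 * s"] that by simp
    then have F: "0 \<le> F" using assms(5,6) by (simp add: F_def)
    have "0 \<le> c" "0 \<le> q" by (auto simp: c_def q_def)
    with F show ?thesis by (auto simp: C_def \<tau>_def intro!: add_pos_nonneg)
  qed
  have rate: "R s n / n = real n powr (- (2 * s) / (1 + 2 * s))" if "0 < s" "1 \<le> n" for s n
  proof -
    have "1 / (1 + 2 * s) - 1 = - (2 * s) / (1 + 2 * s)" using that by (simp add: field_simps)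
    moreover have "real n powr (1 / (1 + 2 * s) - 1) = R s n / n"
      using that by (simp add: R_def powr_diff)
    ultimately show ?thesis by simp
  qed
  show ?thesis
  proof (intro exI [of _ D] conjI ballI allI impI)
    fix n :: nat assume n: "1 \<le> n" "5 * log 2 (real n) \<le> real (m n)"
    show "distributed_estimator (m n) (D n)"
      using D [of n] silent_procedure by (cases "\<exists>D. good n D") (auto simp: good_def D_def)
    show "real (length (message (D n) i (x, u))) \<le> real n powr (1 / (1 + 2 * s1)) * log 2 (real n)" for i x u
      using D [of n] silent_procedure(2) [of i "(x, u)"] n
      by (cases "\<exists>D. good n D") (auto simp: good_def D_def R_def)
  next
    fix s assume s: "s \<in> {s1, s2}"
    have ev': "\<forall>\<^sub>F n in sequentially. 5 * log 2 (real n) \<le> real (m n) \<longrightarrow> good n (D n)"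
      using ev by eventually_elim (auto intro: D)
    show "\<exists>C>0. \<forall>\<^sub>F n in sequentially. 5 * log 2 (real n) \<le> real (m n) \<longrightarrow>
          (MAX i\<in>{1..m n}. SUP f\<in>besov_ball \<psi> s L. expected_bits P (m n) n f (D n) i)
            \<le> ennreal (C * (real n powr (1 / (1 + 2 * s)) * log 2 (real n)))"
    proof (intro exI [of _ C] conjI C)
      show "\<forall>\<^sub>F n in sequentially. 5 * log 2 (real n) \<le> real (m n) \<longrightarrow>
          (MAX i\<in>{1..m n}. SUP f\<in>besov_ball \<psi> s L. expected_bits P (m n) n f (D n) i)
            \<le> ennreal (C * (real n powr (1 / (1 + 2 * s)) * log 2 (real n)))"
        using ev' eventually_ge_at_top [of 1]
      proof eventually_elim
        case (elim n)
        \<comment> \<open>A bound on the maximum needs a nonempty index set: n^p >= 1 and |m - n^p|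
          < 1 give m >= 1.\<close>
        have "1 \<le> real n powr p" using elim(2) assms(2) by (intro ge_one_powr_ge_zero) auto
        then have "0 < real (m n)" using assms(4) [rule_format, OF elim(2)] by linarith
        then have ne: "{1..m n} \<noteq> {}" by simp
        show ?case
        proof
          assume "5 * log 2 (real n) \<le> real (m n)"
          then have g: "good n (D n)" using elim by blast
          show "(MAX i\<in>{1..m n}. SUP f\<in>besov_ball \<psi> s L. expected_bits P (m n) n f (D n) i)
            \<le> ennreal (C * (real n powr (1 / (1 + 2 * s)) * log 2 (real n)))"
          proof (rule Max.boundedI)
            fix a assume "a \<in> (\<lambda>i. SUP f\<in>besov_ball \<psi> s L. expected_bits P (m n) n f (D n) i) ` {1..m n}"
            then obtain i where "a = (SUP f\<in>besov_ball \<psi> s L. expected_bits P (m n) n f (D n) i)" by blast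
            then show "a \<le> ennreal (C * (real n powr (1 / (1 + 2 * s)) * log 2 (real n)))"
              using g s unfolding good_def R_def by (auto intro!: SUP_least)
          qed (use ne in auto)
        qed
      qed
    qed
    show "\<exists>C>0. \<forall>\<^sub>F n in sequentially. 5 * log 2 (real n) \<le> real (m n) \<longrightarrow>
          (SUP f\<in>besov_ball \<psi> s L. risk P (m n) n f (D n))
            \<le> ennreal (C * real n powr (- (2 * s) / (1 + 2 * s)))"
    proof (intro exI [of _ C] conjI C)
      have s0: "0 < s" using s assms(5,6) by auto
      show "\<forall>\<^sub>F n in sequentially. 5 * log 2 (real n) \<le> real (m n) \<longrightarrow>
          (SUP f\<in>besov_ball \<psi> s L. risk P (m n) n f (D n))
            \<le> ennreal (C * real n powr (- (2 * s) / (1 + 2 * s)))"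
        using ev' eventually_ge_at_top [of 1]
      proof eventually_elim
        case (elim n)
        show ?case
          using elim(1) s unfolding rate [OF s0 elim(2), symmetric] good_def
          by (auto intro!: SUP_least)
      qed
    qed
  qed
qed

end
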